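(* There exist a universal constant $c_0>0$ and, for each $u,v\in(0,2)$, a constant $C_{u,v}>0$ depending only on $u,v$, such that the following holds. Let $(D,\mathcal{D},\rho)$ be a probability space and let $\{\phi_i\}_{i\in\mathbb{N}}$ be a bounded Riesz basis of $L^2_\rho(D)$ with Riesz constants $a_\phi,b_\phi>0$ and bound $K_\phi<\infty$ (see context). Let $0<\varepsilon<1$, $s,n,m\in\mathbb{N}$, and let $x_1,\ldots,x_m$ be drawn i.i.d. from $\rho$, where $$ m\geq c_0\cdot\frac{K_\phi^2}{a_\phi}\cdot s\cdot\left(\log^2\left(2\frac{K_\phi^2}{a_\phi}s\right)\log(2n)+\log(2/\varepsilon)\right). $$ Then the following holds with probability at least $1-\varepsilon$. For any $f\in L^2_\rho(D)$ that is defined everywhere, with coefficients $c=(c_i)_{i\in\mathbb{N}}$ (so $f=\sum_i c_i\phi_i$ in $L^2_\rho(D)$) and $c_{[n]}=(c_i)_{i=1}^n$, the approximation $\hat f=\mathcal{R}_{s,n}(f)$ is at most $2s$-sparse (a linear combination of at most $2s$ of the functions $\phi_1,\dots,\phi_n$) and satisfies, for all $0<u,v<2$, $$ \|f-\hat f\|_{L^2_\rho}\leq C_{u,v}\sqrt{b_\phi}\left\{\frac{\sigma_s(c_{[n]})_1}{\sqrt s}+\frac{\sqrt{b_\phi}}{\sqrt{a_\phi}}\left[\left(\frac1s\sum_{j>s}\sigma_j(c)_2^u\right)^{\frac1u}+\left(\frac1n\sum_{j>n/2}\tau_j(c)_2^v\right)^{\frac1v}\right]\right\} $$ and, for all $p\in(2,\infty]$,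 $$ \|f-\hat f\|_{L^p_\rho}\leq C_{u,v}(b_\phi)^{1/p}(K_\phi)^{1-2/p}\left\{\frac{\sigma_s(c_{[n]})_1}{s^{\frac1p}}+\frac{\tau_n(c)_1}{s^{\frac1p}}+\frac{s^{\frac12-\frac1p}\sqrt{b_\phi}}{\sqrt{a_\phi}}\left[\left(\frac1s\sum_{j>s}\sigma_j(c)_2^u\right)^{\frac1u}+\left(\frac1n\sum_{j>n/2}\tau_j(c)_2^v\right)^{\frac1v}\right]\right\}. $$
   Context: Bounded Riesz basis: $\{\phi_i\}_{i\in\mathbb{N}}$ is a Riesz basis of $L^2_\rho(D)$ (the space of complex-valued square-integrable functions on $D$), i.e. a family of functions $D\to\mathbb{C}$ whose linear span is dense in $L^2_\rho(D)$ with $a_\phi\|c\|_2^2\leq\|\sum_i c_i\phi_i\|_{L^2_\rho}^2\leq b_\phi\|c\|_2^2$ for all $c\in\ell^2(\mathbb{N})$, and $K_\phi=\sup_{i}\|\phi_i\|_{L^\infty_\rho}<\infty$. A vector is $s$-sparse if it has at most $s$ nonzero entries. For $1\le p\le\infty$: $\sigma_s(c)_p=\inf\{\|c-z\|_p : z \text{ is } s\text{-sparse}\}$ and $\tau_n(c)_p=\left(\sum_{i>n}|c_i|^p\right)^{1/p}$ (supremum if $p=\infty$). The sparse recovery procedure $\mathcal{R}_{s,n}$: given the samples $f(x_1),\ldots,f(x_m)$, set $b=\frac{1}{\sqrt m}(f(x_i))_{i=1}^m\in\mathbb{C}^m$ and $A=\frac{1}{\sqrt m}(\phi_j(x_i))_{i,j=1}^{m,n}\in\mathbb{C}^{m\times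 n}$. Let $\check c\in\mathbb{C}^n$ be the (unique) minimizer of smallest $\ell^2$-norm of the problem $\min_{z\in\mathbb{C}^n}\lambda\|z\|_1+\|Az-b\|_2$ with $\lambda=\frac{3}{14}\sqrt{a_\phi/s}$. Let $\hat c=H_{2s}(\check c)$, where $H_{2s}$ is hard thresholding, which keeps the $2s$ largest entries in absolute value and sets all others to zero. Then $\mathcal{R}_{s,n}(f)=\hat f=\sum_{i=1}^n\hat c_i\phi_i$. The convention $1/\infty=0$ is used.
   Formalization: The event does not depend on f, but for each f the samples must also avoid a null set of points where f differs from its pointwise series; uniformly over all everywhere-defined f the claim fails (f the indicator of the samples). *)

theory Defs
  imports "HOL-Probability.Probability"
begin

text \<open>
  Families and coefficient sequences indexed by the positive integers are indexed here by
  \<^typ>\<open>nat\<close> starting at 0: the function $\phi_{i+1}$ is \<open>phi i\<close>, the index set $[n]$ is \<open>{..<n}\<close>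
  and the index range $i > n$ is \<open>{n..}\<close>. A vector in $\mathbb{C}^n$ is a sequence vanishing on
  \<open>{n..}\<close>. Norms, best approximation errors and tails may be infinite, so they are extended
  nonnegative reals.
\<close>

section \<open>Norms, sparsity, best approximation\<close>

text \<open>Only used with exponents \<open>r > 0\<close>.\<close>
definition enn_powr :: "ennreal \<Rightarrow> real \<Rightarrow> ennreal"
  where "enn_powr x r = (if x = \<infinity> then \<infinity> else ennreal (enn2real x powr r))"

definition Lp_norm :: "ennreal \<Rightarrow> 'a measure \<Rightarrow> ('a \<Rightarrow> complex) \<Rightarrow> ennreal"
  where "Lp_norm p M f =
    (if p = \<infinity> then esssup M (\<lambda>x. ennreal (cmod (f x)))
     else enn_powr (\<integral>\<^sup>+x. ennreal (cmod (f x) powr enn2real p) \<partial>M) (1 / enn2real p))"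

definition L2_space :: "'a measure \<Rightarrow> ('a \<Rightarrow> complex) set"
  where "L2_space M = {f \<in> borel_measurable M. Lp_norm 2 M f < \<infinity>}"

abbreviation seq_norm :: "ennreal \<Rightarrow> (nat \<Rightarrow> complex) \<Rightarrow> ennreal"
  where "seq_norm p c \<equiv> Lp_norm p (count_space UNIV) c"

definition sparse :: "nat \<Rightarrow> (nat \<Rightarrow> complex) \<Rightarrow> bool"
  where "sparse s z \<longleftrightarrow> finite {i. z i \<noteq> 0} \<and> card {i. z i \<noteq> 0} \<le> s"

definition best_approx_error :: "nat \<Rightarrow> ennreal \<Rightarrow> (nat \<Rightarrow> complex) \<Rightarrow> ennreal"  (* sigma *)
  where "best_approx_error s p c = (INF z\<in>{z. sparse s z}. seq_norm p (\<lambda>i. c i - z i))"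

definition tail_error :: "nat \<Rightarrow> ennreal \<Rightarrow> (nat \<Rightarrow> complex) \<Rightarrow> ennreal"  (* tau *)
  where "tail_error n p c = Lp_norm p (count_space {n..}) c"

definition trunc :: "nat \<Rightarrow> (nat \<Rightarrow> complex) \<Rightarrow> nat \<Rightarrow> complex"  (* restriction to [n] *)
  where "trunc n c = (\<lambda>i. if i < n then c i else 0)"

section \<open>Bounded Riesz bases\<close>

definition lincomb :: "(nat \<Rightarrow> 'a \<Rightarrow> complex) \<Rightarrow> nat \<Rightarrow> (nat \<Rightarrow> complex) \<Rightarrow> 'a \<Rightarrow> complex"
  where "lincomb phi n c = (\<lambda>y. \<Sum>i<n. c i * phi i y)"

text \<open>\<open>f\<close> is the sum of the series \<open>\<Sum>i. c i * phi i\<close> in the \<open>L\<^sup>2\<close> norm.\<close>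
definition L2_expansion ::
    "'a measure \<Rightarrow> (nat \<Rightarrow> 'a \<Rightarrow> complex) \<Rightarrow> (nat \<Rightarrow> complex) \<Rightarrow> ('a \<Rightarrow> complex) \<Rightarrow> bool"
  where "L2_expansion M phi c f \<longleftrightarrow>
    (\<lambda>n. Lp_norm 2 M (\<lambda>y. f y - lincomb phi n c y)) \<longlonglongrightarrow> 0"

definition bounded_riesz_basis ::
    "'a measure \<Rightarrow> (nat \<Rightarrow> 'a \<Rightarrow> complex) \<Rightarrow> real \<Rightarrow> real \<Rightarrow> real \<Rightarrow> bool"
  where "bounded_riesz_basis M phi a b K \<longleftrightarrow>
    a > 0 \<and> b > 0 \<and> K \<ge> 0 \<and>
    (\<forall>i. phi i \<in> L2_space M) \<and>
    (\<forall>f\<in>L2_space M. \<forall>\<delta>>0. \<exists>n z. Lp_norm 2 M (\<lambda>y. f y - lincomb phi n z y) < ennreal \<delta>) \<and>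
    (\<forall>c. seq_norm 2 c < \<infinity> \<longrightarrow>
      (\<exists>g\<in>L2_space M. L2_expansion M phi c g \<and>
        ennreal a * (seq_norm 2 c)\<^sup>2 \<le> (Lp_norm 2 M g)\<^sup>2 \<and>
        (Lp_norm 2 M g)\<^sup>2 \<le> ennreal b * (seq_norm 2 c)\<^sup>2)) \<and>
    (SUP i. Lp_norm \<infinity> M (phi i)) = ennreal K"

section \<open>The sparse recovery procedure\<close>

definition Cvec :: "nat \<Rightarrow> (nat \<Rightarrow> complex) set"
  where "Cvec n = {z. \<forall>i\<ge>n. z i = 0}"

definition sample_matrix ::
    "nat \<Rightarrow> (nat \<Rightarrow> 'a) \<Rightarrow> (nat \<Rightarrow> 'a \<Rightarrow> complex) \<Rightarrow> nat \<Rightarrow> nat \<Rightarrow> complex"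
  where "sample_matrix m x phi i j = phi j (x i) / complex_of_real (sqrt (real m))"

definition sample_vector :: "nat \<Rightarrow> (nat \<Rightarrow> 'a) \<Rightarrow> ('a \<Rightarrow> complex) \<Rightarrow> nat \<Rightarrow> complex"
  where "sample_vector m x f i = f (x i) / complex_of_real (sqrt (real m))"

definition srlasso_objective ::
    "real \<Rightarrow> nat \<Rightarrow> nat \<Rightarrow> (nat \<Rightarrow> nat \<Rightarrow> complex) \<Rightarrow> (nat \<Rightarrow> complex) \<Rightarrow> (nat \<Rightarrow> complex) \<Rightarrow> real"
  where "srlasso_objective lam m n A d z =
    lam * (\<Sum>j<n. cmod (z j)) + sqrt (\<Sum>i<m. (cmod ((\<Sum>j<n. A i j * z j) - d i))\<^sup>2)"

definition srlasso_minimizer ::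
    "real \<Rightarrow> nat \<Rightarrow> nat \<Rightarrow> (nat \<Rightarrow> nat \<Rightarrow> complex) \<Rightarrow> (nat \<Rightarrow> complex) \<Rightarrow> nat \<Rightarrow> complex"
  where "srlasso_minimizer lam m n A d =
    (THE z. is_arg_min (\<lambda>w. sqrt (\<Sum>j<n. (cmod (w j))\<^sup>2))
                       (is_arg_min (srlasso_objective lam m n A d) (\<lambda>w. w \<in> Cvec n)) z)"

text \<open>
  Keeping the \<open>k\<close> largest entries is ambiguous if there are ties. Every admissible selection is
  allowed; the recovery guarantee below is required for all of them.
\<close>
definition hard_thresholdings :: "nat \<Rightarrow> nat \<Rightarrow> (nat \<Rightarrow> complex) \<Rightarrow> (nat \<Rightarrow> complex) set"
  where "hard_thresholdings k n z =
    {(\<lambda>i. if i \<in> S then z i else 0) | S.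
       S \<subseteq> {..<n} \<and> card S = min k n \<and> (\<forall>i\<in>S. \<forall>j\<in>{..<n} - S. cmod (z j) \<le> cmod (z i))}"

definition recovered_coeffs ::
    "real \<Rightarrow> (nat \<Rightarrow> 'a \<Rightarrow> complex) \<Rightarrow> nat \<Rightarrow> nat \<Rightarrow> nat \<Rightarrow> (nat \<Rightarrow> 'a) \<Rightarrow> ('a \<Rightarrow> complex)
      \<Rightarrow> (nat \<Rightarrow> complex) set"
  where "recovered_coeffs a phi s n m x f =
    hard_thresholdings (2 * s) n
      (srlasso_minimizer (3 / 14 * sqrt (a / real s)) m n (sample_matrix m x phi)
        (sample_vector m x f))"

section \<open>The error bounds\<close>

definition approx_tail_term :: "nat \<Rightarrow> nat \<Rightarrow> real \<Rightarrow> real \<Rightarrow> (nat \<Rightarrow> complex) \<Rightarrow> ennreal"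
  where "approx_tail_term s n u v c =
    enn_powr (ennreal (1 / real s) *
      (\<Sum>\<^sub>\<infinity>j\<in>{j. j > s}. enn_powr (best_approx_error j 2 c) u)) (1 / u) +
    enn_powr (ennreal (1 / real n) *
      (\<Sum>\<^sub>\<infinity>j\<in>{j. real j > real n / 2}. enn_powr (tail_error j 2 c) v)) (1 / v)"

definition L2_bound ::
    "real \<Rightarrow> real \<Rightarrow> real \<Rightarrow> nat \<Rightarrow> nat \<Rightarrow> real \<Rightarrow> real \<Rightarrow> (nat \<Rightarrow> complex) \<Rightarrow> ennreal"
  where "L2_bound Cuv a b s n u v c =
    ennreal (Cuv * sqrt b) *
      (best_approx_error s 1 (trunc n c) / ennreal (sqrt (real s)) +
       ennreal (sqrt b / sqrt a) * approx_tail_term s n u v c)"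

text \<open>Division in \<^typ>\<open>ennreal\<close> satisfies \<open>1 / \<infinity> = 0\<close>, so \<open>r\<close> below is $1/p$ for all \<open>p \<in> (2, \<infinity>]\<close>.\<close>
definition Lp_bound ::
    "real \<Rightarrow> real \<Rightarrow> real \<Rightarrow> real \<Rightarrow> nat \<Rightarrow> nat \<Rightarrow> real \<Rightarrow> real \<Rightarrow> ennreal \<Rightarrow> (nat \<Rightarrow> complex) \<Rightarrow> ennreal"
  where "Lp_bound Cuv a b K s n u v p c =
    (let r = enn2real (1 / p) in
      ennreal (Cuv * b powr r * K powr (1 - 2 * r)) *
        (best_approx_error s 1 (trunc n c) / ennreal (real s powr r) +
         tail_error n 1 c / ennreal (real s powr r) +
         ennreal (real s powr (1 / 2 - r) * sqrt b / sqrt a) * approx_tail_term s n u v c))"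

definition recovery_succeeds ::
    "(real \<Rightarrow> real \<Rightarrow> real) \<Rightarrow> 'a measure \<Rightarrow> (nat \<Rightarrow> 'a \<Rightarrow> complex) \<Rightarrow> real \<Rightarrow> real \<Rightarrow> real
      \<Rightarrow> nat \<Rightarrow> nat \<Rightarrow> nat \<Rightarrow> (nat \<Rightarrow> 'a) \<Rightarrow> ('a \<Rightarrow> complex) \<Rightarrow> (nat \<Rightarrow> complex) \<Rightarrow> bool"
  where "recovery_succeeds C M phi a b K s n m x f c \<longleftrightarrow>
    (\<forall>chat \<in> recovered_coeffs a phi s n m x f.
      sparse (2 * s) chat \<and>
      (\<forall>u v. 0 < u \<and> u < 2 \<and> 0 < v \<and> v < 2 \<longrightarrow>
        Lp_norm 2 M (\<lambda>y. f y - lincomb phi n chat y) \<le> L2_bound (C u v) a b s n u v c \<and>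
        (\<forall>p. p > 2 \<longrightarrow>
          Lp_norm p M (\<lambda>y. f y - lincomb phi n chat y) \<le> Lp_bound (C u v) a b K s n u v p c)))"

text \<open>
  The samples are the coordinates of the product space, and \<open>E\<close> is the event of probability at
  least \<open>1 - \<epsilon>\<close>; it does not depend on \<open>f\<close>. Since the coefficients only determine \<open>f\<close> almost
  everywhere while the recovery uses point values, no single event can serve literally all everywhere
  defined \<open>f\<close>: the indicator function of \<open>{x\<^sub>1, \<dots>, x\<^sub>m}\<close> has vanishing coefficients if \<open>\<rho>\<close> has no
  atoms, but need not be recovered as 0. Hence each \<open>f\<close> comes with a null set \<open>N\<close> that the samples
  have to avoid, which they do almost surely. It consists only of points at which \<open>f\<close> differs from its
  pointwise series, and is therefore empty if \<open>f\<close> is everywhere the sum of its series.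
\<close>
definition recovery_guarantee :: "real \<Rightarrow> (real \<Rightarrow> real \<Rightarrow> real) \<Rightarrow> 'a measure \<Rightarrow> bool"
  where "recovery_guarantee c0 C M \<longleftrightarrow>
    (\<forall>phi a b K \<epsilon> s n m.
      prob_space M \<and> bounded_riesz_basis M phi a b K \<and>
      0 < \<epsilon> \<and> \<epsilon> < 1 \<and> s \<ge> 1 \<and> n \<ge> 1 \<and> m \<ge> 1 \<and>
      real m \<ge> c0 * (K\<^sup>2 / a) * real s *
        ((ln (2 * (K\<^sup>2 / a) * real s))\<^sup>2 * ln (2 * real n) + ln (2 / \<epsilon>)) \<longrightarrow>
      (\<exists>E \<in> sets (PiM {..<m} (\<lambda>_. M)).
        measure (PiM {..<m} (\<lambda>_. M)) E \<ge> 1 - \<epsilon> \<and>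
        (\<forall>f\<in>L2_space M. \<forall>c. L2_expansion M phi c f \<longrightarrow>
          (\<exists>N \<in> null_sets M.
            (\<forall>y\<in>N. \<not> (\<lambda>i. c i * phi i y) sums f y) \<and>
            (\<forall>x\<in>E. (\<forall>i<m. x i \<notin> N) \<longrightarrow> recovery_succeeds C M phi a b K s n m x f c)))))"

text \<open>
  A constant that is bound by an existential quantifier in a theorem about \<^typ>\<open>'a measure\<close> may
  depend on the type \<^typ>\<open>'a\<close>. To express that \<open>c0\<close> and \<open>C\<close> are universal, their existence is asserted
  over the fixed type \<^typ>\<open>nat \<Rightarrow> complex\<close>, where no type variable occurs, and the same constants
  are asserted to serve for every probability space over any type \<^typ>\<open>'a\<close>.
\<close>
definition universal_recovery_constants :: "real \<Rightarrow> (real \<Rightarrow> real \<Rightarrow> real) \<Rightarrow> bool"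
  where "universal_recovery_constants c0 C \<longleftrightarrow>
    c0 > 0 \<and> (\<forall>u v. 0 < u \<and> u < 2 \<and> 0 < v \<and> v < 2 \<longrightarrow> C u v > 0) \<and>
    (\<forall>M :: (nat \<Rightarrow> complex) measure. recovery_guarantee c0 C M)"

end

theory Submission
  imports Defs
begin

text \<open>
  Let $g_z = \sum_j z_j \varphi_j$. Everything rests on one comparison of second moments, which
  holds with high probability simultaneously for \<^emph>\<open>all\<close> \<open>z \<in> \<complex>\<^sup>N\<close>:
  \[ \tfrac{2}{25}\, E|g_z|^2 - \delta \|z\|_1^2 \le \tfrac1m \sum_{i} |g_z(x_i)|^2
     \le 13\, E|g_z|^2 + \delta \|z\|_1^2, \]
  where \<open>\<delta>\<close> is of order $K^2 (\log^2 (1/\eta) \log N + \log(1/\varepsilon))/m$ and \<open>\<eta> = \<delta>/K\<^sup>2\<close>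
  (\<open>uniform_second_moment\<close>). The error is measured in the \<open>\<ell>\<^sup>1\<close> norm instead of being restricted to
  sparse vectors. This is what keeps the ratio $b/a$ out of the sample size: with
  $\delta \approx a/s$ the lower estimate is at once a null space property, which mentions only the
  lower Riesz constant, and the upper estimate applies to vectors of any sparsity. The constants
  \<open>2/25\<close> and \<open>13\<close> need not be close to 1; the fixed factor \<open>3/14\<close> in the parameter of the
  square-root LASSO leaves room for a lower constant as small as about \<open>1/20\<close>.

  The comparison is proved by counting. After rescaling, $g_z$ is a convex combination of the \<open>4 N\<close>
  functions $\pm\varphi_j, \pm i\varphi_j$, so an average of $O(4^i \log(1/\gamma))$ randomly drawn
  atoms approximates it up to $2^{-i}/9$ outside a set of measure \<open>\<gamma>\<close>, for the true and the
  empirical measure at once (\<open>maurey\<close>). The first level \<open>i\<close> at which the average is at least $2^{-i}$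
  determines $|g_z|^2$ up to a constant factor, so only the probabilities of the corresponding
  cells have to be compared. A cell of level \<open>i\<close> contributes with weight $4^{-i}$, so its
  frequency may be wrong by about $4^i \eta$, while there are only $N^{O(4^i \log(1/\gamma))}$ cells of
  that level: the powers of 4 cancel and Chernoff's inequality with a union bound over all cells
  suffices (\<open>cells_uniform\<close>).

  Recovery is then deterministic. Comparing the objective at the minimiser and at the truth, and
  using the null space property for the difference, bounds the coefficient error by the best
  \<open>s\<close>-term error and the noise produced by the coefficients outside $[n]$ (\<open>srlasso_recovery\<close>). For the noise, the
  tail is cut into the dyadic blocks $[2^k n, 2^{k+1} n)$. The event is arranged so that the upper
  estimate holds for all numbers \<open>2\<^sup>k\<^sup>+\<^sup>1 n\<close> of columns, with \<open>\<delta>\<close> enlarged by the harmless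
  factor \<open>k + 3\<close>. The \<open>\<ell>\<^sup>1\<close> norm of a block is estimated by its own \<open>\<ell>\<^sup>2\<close> norm on a set of about $2^k s$
  indices, and by the best approximation errors \<open>\<sigma>\<^sub>j\<close> outside it; since \<open>u, v < 2\<close>, all resulting
  series converge like geometric ones (\<open>tail_noise_bound\<close>). The Riesz inequalities turn coefficient errors into
  \<open>L\<^sup>2\<close> errors, and interpolation with the sup norm gives \<open>L\<^sup>p\<close>.

  The point values of \<open>f\<close> enter only through the convergence of the dyadic partial sums, which
  holds almost everywhere whenever the asserted bound is finite. Finally, every probability space can be replaced by
  the distribution of $(\varphi_i)_{i}$ on the sequence space, since every \<open>f \<in> L\<^sup>2\<close> is almost
  everywhere a function of these values; this makes the constants independent of the underlying
  type (\<open>guarantee_from_image\<close>).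
\<close>

section \<open>Relative frequencies in independent samples\<close>

text \<open>
  The moment generating function of a binomial variable, bounded by that of a Poisson variable with
  the same mean. The cases \<open>l = 1\<close> and \<open>l = -1\<close> give the two multiplicative Chernoff bounds below.
\<close>
lemma (in prob_space) mgf_count:
  assumes [measurable]: "A \<in> sets M"
  shows "(\<integral>\<^sup>+x. ennreal (exp (l * (\<Sum>i<m. indicator A (x i)))) \<partial>PiM {..<m::nat} (\<lambda>_. M))
    \<le> ennreal (exp (real m * (prob A * (exp l - 1))))"
proof -
  interpret P: product_sigma_finite "\<lambda>_::nat. M"
    by standard
  have "(\<integral>\<^sup>+x. ennreal (exp (l * (\<Sum>i<m. indicator A (x i)))) \<partial>PiM {..<m} (\<lambda>_. M))
      = (\<integral>\<^sup>+x. (\<Prod>i<m. ennreal (exp (l * indicator A (x i)))) \<partial>PiM {..<m} (\<lambda>_. M))"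
    by (intro nn_integral_cong) (simp only: sum_distrib_left exp_sum[OF finite_lessThan] prod_ennreal[OF exp_ge_zero])
  also have "\<dots> = (\<Prod>i<m. \<integral>\<^sup>+y. ennreal (exp (l * indicator A y)) \<partial>M)"
    by (rule P.product_nn_integral_prod) auto
  also have "(\<integral>\<^sup>+y. ennreal (exp (l * indicator A y)) \<partial>M) = ennreal (1 + prob A * (exp l - 1))"
  proof -
    have i: "integrable M (\<lambda>y. indicator A y :: real)"
      by (simp add: integrable_indicator_iff less_top[symmetric])
    have eq: "exp (l * indicator A y) = 1 + (exp l - 1) * indicator A y" for y
      by (auto simp: indicator_def)
    have "integrable M (\<lambda>y. exp (l * indicator A y))"
      unfolding eq using i by simp
    then have "(\<integral>\<^sup>+y. ennreal (exp (l * indicator A y)) \<partial>M) = ennreal (\<integral>y. exp (l * indicator A y) \<partial>M)"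
      by (rule nn_integral_eq_integral) auto
    also have "(\<integral>y. exp (l * indicator A y) \<partial>M) = 1 + prob A * (exp l - 1)"
      unfolding eq using i by (simp add: prob_space)
    finally show ?thesis .
  qed
  also have "(\<Prod>i<m. ennreal (1 + prob A * (exp l - 1))) \<le> (\<Prod>i<m. ennreal (exp (prob A * (exp l - 1))))"
    by (intro prod_mono_ennreal ennreal_leI exp_ge_add_one_self)
  also have "\<dots> = ennreal (exp (real m * (prob A * (exp l - 1))))"
    by (simp add: prod_constant ennreal_power exp_of_nat_mult[symmetric])
  finally show ?thesis .
qed

lemma (in prob_space) tail_count:
  assumes [measurable]: "A \<in> sets M"
  shows "measure (PiM {..<m::nat} (\<lambda>_. M))
      {x \<in> space (PiM {..<m} (\<lambda>_. M)). T \<le> l * (\<Sum>i<m. indicator A (x i))}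
    \<le> exp (real m * (prob A * (exp l - 1)) - T)"
proof -
  let ?P = "PiM {..<m} (\<lambda>_. M)"
  interpret P: prob_space ?P
    by (intro prob_space_PiM prob_space_axioms)
  have [measurable]: "(\<lambda>x. (\<Sum>i<m. indicator A (x i)) :: real) \<in> borel_measurable ?P"
    by measurable
  have "emeasure ?P {x \<in> space ?P. T \<le> l * (\<Sum>i<m. indicator A (x i))}
     = emeasure ?P {x \<in> space ?P. 1 \<le> ennreal (exp (- T)) * ennreal (exp (l * (\<Sum>i<m. indicator A (x i))))}"
    by (intro arg_cong2[where f = emeasure] refl Collect_cong)
       (simp add: ennreal_mult''[symmetric] exp_add[symmetric] del: ennreal_1 flip: ennreal_1)
  also have "\<dots> \<le> ennreal (exp (- T)) *
      (\<integral>\<^sup>+x. ennreal (exp (l * (\<Sum>i<m. indicator A (x i)))) * indicator (space ?P) x \<partial>?P)"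
    by (rule nn_integral_Markov_inequality) auto
  also have "(\<integral>\<^sup>+x. ennreal (exp (l * (\<Sum>i<m. indicator A (x i)))) * indicator (space ?P) x \<partial>?P)
     = (\<integral>\<^sup>+x. ennreal (exp (l * (\<Sum>i<m. indicator A (x i)))) \<partial>?P)"
    by (intro nn_integral_cong) auto
  also have "ennreal (exp (- T)) * \<dots> \<le> ennreal (exp (- T)) * ennreal (exp (real m * (prob A * (exp l - 1))))"
    by (intro mult_left_mono mgf_count) auto
  also have "\<dots> = ennreal (exp (real m * (prob A * (exp l - 1)) - T))"
    by (simp add: ennreal_mult''[symmetric] exp_add[symmetric])
  finally show ?thesis
    by (simp add: P.emeasure_eq_measure)
qed

definition emean :: "nat \<Rightarrow> (nat \<Rightarrow> 'a) \<Rightarrow> ('a \<Rightarrow> real) \<Rightarrow> real"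
  where "emean m x f = (\<Sum>i<m. f (x i)) / real m"

abbreviation freq :: "nat \<Rightarrow> (nat \<Rightarrow> 'a) \<Rightarrow> 'a set \<Rightarrow> real"
  where "freq m x A \<equiv> emean m x (indicator A)"

text \<open>
  Comparing with \<open>2 * prob A\<close> makes the failure probability independent of \<open>prob A\<close>; this works
  because \<open>exp 1 - 1 \<le> 2\<close>. In the same way \<open>chernoff_lower\<close> uses \<open>exp (-1) - 1 \<le> -1/2\<close>.
\<close>
lemma (in prob_space) chernoff_upper:
  assumes A[measurable]: "A \<in> sets M" and m: "m > 0"
  shows "measure (PiM {..<m} (\<lambda>_. M))
      {x \<in> space (PiM {..<m} (\<lambda>_. M)). freq m x A \<ge> 2 * prob A + \<theta>} \<le> exp (- (real m * \<theta>))"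
proof -
  have "{x \<in> space (PiM {..<m} (\<lambda>_. M)). freq m x A \<ge> 2 * prob A + \<theta>}
     = {x \<in> space (PiM {..<m} (\<lambda>_. M)). real m * (2 * prob A + \<theta>) \<le> 1 * (\<Sum>i<m. indicator A (x i))}"
    using m by (simp add: emean_def field_simps)
  then have "measure (PiM {..<m} (\<lambda>_. M))
      {x \<in> space (PiM {..<m} (\<lambda>_. M)). freq m x A \<ge> 2 * prob A + \<theta>}
     \<le> exp (real m * (prob A * (exp 1 - 1)) - real m * (2 * prob A + \<theta>))"
    using tail_count[OF A, of m "real m * (2 * prob A + \<theta>)" 1] by simp
  also have "\<dots> \<le> exp (- (real m * \<theta>))"
  proof -
    have "exp 1 - 1 \<le> (2::real)" using exp_le by linarith
    then have "prob A * (exp 1 - 1) \<le> prob A * 2"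
      by (rule mult_left_mono) (rule measure_nonneg)
    then have "real m * (prob A * (exp 1 - 1)) \<le> real m * (prob A * 2)"
      by (rule mult_left_mono) (rule of_nat_0_le_iff)
    then show ?thesis by (simp add: algebra_simps)
  qed
  finally show ?thesis .
qed

lemma (in prob_space) chernoff_lower:
  assumes A[measurable]: "A \<in> sets M" and m: "m > 0"
  shows "measure (PiM {..<m} (\<lambda>_. M))
      {x \<in> space (PiM {..<m} (\<lambda>_. M)). freq m x A \<le> prob A / 2 - \<theta>} \<le> exp (- (real m * \<theta>))"
proof -
  have "{x \<in> space (PiM {..<m} (\<lambda>_. M)). freq m x A \<le> prob A / 2 - \<theta>}
     = {x \<in> space (PiM {..<m} (\<lambda>_. M)). real m * (\<theta> - prob A / 2) \<le> -1 * (\<Sum>i<m. indicator A (x i))}"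
    using m by (simp add: emean_def field_simps)
  then have "measure (PiM {..<m} (\<lambda>_. M))
      {x \<in> space (PiM {..<m} (\<lambda>_. M)). freq m x A \<le> prob A / 2 - \<theta>}
     \<le> exp (real m * (prob A * (exp (-1) - 1)) - real m * (\<theta> - prob A / 2))"
    using tail_count[OF A, of m "real m * (\<theta> - prob A / 2)" "-1"] by simp
  also have "\<dots> \<le> exp (- (real m * \<theta>))"
  proof -
    have "exp (-1) - 1 \<le> (-1/2::real)"
      using exp_ge_add_one_self[of "1::real"] by (simp add: exp_minus field_simps)
    then have "prob A * (exp (-1) - 1) \<le> prob A * (- 1 / 2)"
      by (rule mult_left_mono) (rule measure_nonneg)
    then have "real m * (prob A * (exp (-1) - 1)) \<le> real m * (prob A * (- 1 / 2))"
      by (rule mult_left_mono) (rule of_nat_0_le_iff)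
    then show ?thesis by (simp add: algebra_simps)
  qed
  finally show ?thesis .
qed

section \<open>Approximation of convex combinations by averages of atoms\<close>

lemma hoeffding_average:
  fixes a :: "nat \<Rightarrow> real" and q :: "nat pmf"
  assumes a: "\<And>j. j \<in> set_pmf q \<Longrightarrow> \<bar>a j\<bar> \<le> 1" and L: "L > 0" and r: "r \<ge> 0"
  shows "measure_pmf.prob (Pi_pmf {..<L} 0 (\<lambda>_. q))
      {k. \<bar>(\<Sum>l<L. a (k l)) / real L - measure_pmf.expectation q a\<bar> \<ge> r} \<le> 2 * exp (- (real L * r\<^sup>2 / 2))"
proof -
  define P where "P = Pi_pmf {..<L} 0 (\<lambda>_. q)"
  have comp: "map_pmf (\<lambda>k. k l) P = q" if "l < L" for l
    unfolding P_def using that by (subst Pi_pmf_component) auto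
  have dist: "distr (measure_pmf P) borel (\<lambda>k. a (k l)) = distr (measure_pmf q) borel a" if "l < L" for l
  proof -
    have "distr (measure_pmf q) borel a = distr (measure_pmf (map_pmf (\<lambda>k. k l) P)) borel a"
      using comp[OF that] by simp
    also have "\<dots> = distr (measure_pmf P) borel (\<lambda>k. a (k l))"
      by (subst map_pmf_rep_eq, subst distr_distr) (auto simp: o_def)
    finally show ?thesis by simp
  qed
  interpret H: Hoeffding_ineq_iid "measure_pmf P" "{..<L}" "\<lambda>l k. a (k l)" "\<lambda>k. a (k 0)" "-1" 1
    "measure_pmf.expectation P (\<lambda>k. a (k 0))"
  proof (unfold_locales, goal_cases)
    case 2
    show ?case
      unfolding P_def
      by (rule prob_space.indep_vars_compose2[OF measure_pmf.prob_space_axioms, where Y = "\<lambda>l. a" and X = "\<lambda>l k. k l"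
            and M' = "\<lambda>_. count_space UNIV"])
         (auto intro!: indep_vars_Pi_pmf)
  next
    case (3 l)
    then show ?case using dist[of l] dist[of 0] L by simp
  next
    case 5
    show ?case
    proof (rule AE_pmfI)
      fix k assume "k \<in> set_pmf P"
      then have "k 0 \<in> set_pmf (map_pmf (\<lambda>k. k 0) P)" by auto
      then have "k 0 \<in> set_pmf q" using comp[OF L] by simp
      from a[OF this] show "a (k 0) \<in> {- 1..1}" by auto
    qed
  qed auto
  have e: "measure_pmf.expectation P (\<lambda>k. a (k 0)) = measure_pmf.expectation q a"
    using comp[OF L] integral_map_pmf[of "\<lambda>k. k 0" P a] by simp
  show ?thesis
    using H.Hoeffding_ineq_abs_ge'[of r] r L
    unfolding e by (simp add: P_def lessThan_empty_iff)
qed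

lemma emean_mono:
  "(\<And>i. i < m \<Longrightarrow> f (x i) \<le> g (x i)) \<Longrightarrow> emean m x f \<le> emean m x g"
  unfolding emean_def by (intro divide_right_mono sum_mono) auto

lemma emean_add: "emean m x (\<lambda>y. f y + g y) = emean m x f + emean m x g"
  by (simp add: emean_def sum.distrib add_divide_distrib)

lemma emean_cmult: "emean m x (\<lambda>y. c * f y) = c * emean m x f"
  by (simp add: emean_def sum_distrib_left)

lemma emean_sum: "emean m x (\<lambda>y. \<Sum>i\<in>I. f i y) = (\<Sum>i\<in>I. emean m x (f i))"
  unfolding emean_def by (subst sum.swap) (simp add: sum_divide_distrib)

lemma emean_const: "m > 0 \<Longrightarrow> emean m x (\<lambda>y. c) = c"
  by (simp add: emean_def)

lemma hoeffding_average_complex: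
  fixes a :: "nat \<Rightarrow> complex" and q :: "nat pmf"
  assumes a: "\<And>j. j \<in> set_pmf q \<Longrightarrow> cmod (a j) \<le> 1" and fin: "finite (set_pmf q)"
    and L: "L > 0" and r: "r \<ge> 0"
  shows "measure_pmf.prob (Pi_pmf {..<L} 0 (\<lambda>_. q))
      {k. cmod ((\<Sum>l<L. a (k l)) / of_nat L - measure_pmf.expectation q a) > r}
    \<le> 4 * exp (- (real L * r\<^sup>2 / 4))"
proof -
  define P where "P = Pi_pmf {..<L} 0 (\<lambda>_. q)"
  define u where "u = r / sqrt 2"
  have u: "u \<ge> 0" "u\<^sup>2 = r\<^sup>2 / 2"
    using r by (auto simp: u_def power_divide)
  have int: "integrable (measure_pmf q) a"
    by (rule integrable_measure_pmf_finite[OF fin])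
  let ?X = "\<lambda>f. {k. \<bar>(\<Sum>l<L. f (a (k l))) / real L - measure_pmf.expectation q (\<lambda>j. f (a j))\<bar> \<ge> u}"
  have "{k. cmod ((\<Sum>l<L. a (k l)) / of_nat L - measure_pmf.expectation q a) > r} \<subseteq> ?X Re \<union> ?X Im"
  proof
    fix k assume "k \<in> {k. cmod ((\<Sum>l<L. a (k l)) / of_nat L - measure_pmf.expectation q a) > r}"
    then have *: "cmod ((\<Sum>l<L. a (k l)) / of_nat L - measure_pmf.expectation q a) > r" (is "cmod ?w > r")
      by simp
    have re: "Re ?w = (\<Sum>l<L. Re (a (k l))) / real L - measure_pmf.expectation q (\<lambda>j. Re (a j))"
      using int by (simp add: Re_divide_of_nat)
    have im: "Im ?w = (\<Sum>l<L. Im (a (k l))) / real L - measure_pmf.expectation q (\<lambda>j. Im (a j))"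
      using int by (simp add: Im_divide_of_nat)
    have "\<not> (\<bar>Re ?w\<bar> < u \<and> \<bar>Im ?w\<bar> < u)"
    proof
      assume "\<bar>Re ?w\<bar> < u \<and> \<bar>Im ?w\<bar> < u"
      then have "(Re ?w)\<^sup>2 + (Im ?w)\<^sup>2 \<le> u\<^sup>2 + u\<^sup>2"
        by (intro add_mono) (auto simp: abs_le_square_iff[symmetric])
      then have "(cmod ?w)\<^sup>2 \<le> r\<^sup>2"
        by (simp add: cmod_power2 u(2))
      then have "cmod ?w \<le> r"
        using r by (rule power2_le_imp_le)
      with * show False by simp
    qed
    then show "k \<in> ?X Re \<union> ?X Im"
      unfolding re im by auto
  qed
  then have "measure_pmf.prob P {k. cmod ((\<Sum>l<L. a (k l)) / of_nat L - measure_pmf.expectation q a) > r}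
      \<le> measure_pmf.prob P (?X Re \<union> ?X Im)"
    by (intro measure_pmf.finite_measure_mono) auto
  also have "\<dots> \<le> measure_pmf.prob P (?X Re) + measure_pmf.prob P (?X Im)"
    by (intro measure_Un_le) auto
  also have "\<dots> \<le> 2 * exp (- (real L * u\<^sup>2 / 2)) + 2 * exp (- (real L * u\<^sup>2 / 2))"
    unfolding P_def
    by (intro add_mono hoeffding_average L u order_trans[OF abs_Re_le_cmod a]
        order_trans[OF abs_Im_le_cmod a])
  finally show ?thesis
    unfolding P_def u(2) by simp
qed

definition atom_average :: "nat \<Rightarrow> (nat \<Rightarrow> 'a \<Rightarrow> complex) \<Rightarrow> (nat \<Rightarrow> nat) \<Rightarrow> 'a \<Rightarrow> complex"
  where "atom_average L \<psi> k y = (\<Sum>l<L. \<psi> (k l) y) / of_nat L"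

text \<open>
  Maurey's empirical method. At each fixed point a random average of \<open>L\<close> atoms misses \<open>g\<close> by more than \<open>r\<close>
  only with small probability. Integrating this over the sum of the true and the empirical
  measure, some single average is good for both.
\<close>
lemma (in prob_space) maurey:
  fixes \<psi> :: "nat \<Rightarrow> 'a \<Rightarrow> complex" and q :: "nat pmf"
  assumes meas: "\<And>j. j < N \<Longrightarrow> \<psi> j \<in> borel_measurable M"
    and bd: "\<And>j y. j < N \<Longrightarrow> y \<in> space M \<Longrightarrow> cmod (\<psi> j y) \<le> 1"
    and q: "set_pmf q \<subseteq> {..<N}" and L: "L > 0" and r: "r \<ge> 0" and m: "m > 0"
    and x: "\<And>i. i < m \<Longrightarrow> x i \<in> space M"
    and g: "g = (\<lambda>y. measure_pmf.expectation q (\<lambda>j. \<psi> j y))"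
  shows "\<exists>k. (\<forall>l<L. k l < N) \<and>
    prob {y\<in>space M. cmod (atom_average L \<psi> k y - g y) > r} +
    freq m x {y\<in>space M. cmod (atom_average L \<psi> k y - g y) > r} \<le> 8 * exp (- (real L * r\<^sup>2 / 4))"
proof -
  define P where "P = Pi_pmf {..<L} 0 (\<lambda>_. q)"
  define S where "S = set_pmf P"
  define B where "B = (\<lambda>k. {y\<in>space M. cmod (atom_average L \<psi> k y - g y) > r})"
  define c where "c = 4 * exp (- (real L * r\<^sup>2 / 4))"
  have finq: "finite (set_pmf q)"
    using q finite_subset by blast
  have S_eq: "S = PiE_dflt {..<L} 0 (\<lambda>_. set_pmf q)"
    unfolding S_def P_def by (subst set_Pi_pmf) (auto simp: o_def)
  have fin: "finite S"
    unfolding S_eq by (intro finite_PiE_dflt finq) auto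
  have SN: "k l < N" if "k \<in> S" "l < L" for k l
    using that q unfolding S_eq PiE_dflt_def by auto
  have gsum: "g y = (\<Sum>j\<in>set_pmf q. of_real (pmf q j) * \<psi> j y)" for y
    unfolding g by (subst integral_measure_pmf[OF finq]) (auto simp: scaleR_conv_of_real)
  have g_meas[measurable]: "g \<in> borel_measurable M"
    unfolding gsum using q meas by (intro borel_measurable_sum borel_measurable_times) auto
  have h_meas: "atom_average L \<psi> k \<in> borel_measurable M" if "k \<in> S" for k
    unfolding atom_average_def using SN[OF that] meas by (intro borel_measurable_divide borel_measurable_sum) auto
  have B_meas: "B k \<in> sets M" if "k \<in> S" for k
    using h_meas[OF that] unfolding B_def by measurable
  have pt: "(\<Sum>k\<in>S. pmf P k * indicator (B k) y) \<le> c" if y: "y \<in> space M" for y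
  proof -
    have "(\<Sum>k\<in>S. pmf P k * indicator (B k) y) = measure_pmf.prob P {k. y \<in> B k}"
    proof -
      have "measure_pmf.prob P {k. y \<in> B k} = measure_pmf.expectation P (indicator {k. y \<in> B k})"
        by simp
      also have "\<dots> = (\<Sum>k\<in>S. pmf P k * indicator {k. y \<in> B k} k)"
        by (subst integral_measure_pmf[OF fin]) (auto simp: S_def)
      finally show ?thesis by (simp add: indicator_def)
    qed
    also have "\<dots> \<le> c"
      unfolding P_def c_def B_def g atom_average_def using y bd q
      by (simp, intro hoeffding_average_complex finq L r) auto
    finally show ?thesis .
  qed
  have "\<exists>k\<in>S. prob (B k) + freq m x (B k) \<le> 2 * c"
  proof (rule ccontr)
    assume neg: "\<not> ?thesis"
    have "2 * c = (\<Sum>k\<in>S. pmf P k * (2 * c))"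
      using sum_pmf_eq_1[OF fin, of P] by (simp add: S_def sum_distrib_right[symmetric])
    also have "\<dots> < (\<Sum>k\<in>S. pmf P k * (prob (B k) + freq m x (B k)))"
    proof (rule sum_strict_mono)
      show "S \<noteq> {}" unfolding S_def by (rule set_pmf_not_empty)
      show "pmf P k * (2 * c) < pmf P k * (prob (B k) + freq m x (B k))" if "k \<in> S" for k
        using neg that pmf_positive[of k P] by (intro mult_strict_left_mono) (auto simp: S_def not_le)
    qed (rule fin)
    also have "\<dots> = (\<Sum>k\<in>S. pmf P k * prob (B k)) + (\<Sum>k\<in>S. pmf P k * freq m x (B k))"
      by (simp add: distrib_left sum.distrib)
    also have "(\<Sum>k\<in>S. pmf P k * freq m x (B k)) = emean m x (\<lambda>y. \<Sum>k\<in>S. pmf P k * indicator (B k) y)"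
      by (simp add: emean_sum emean_cmult)
    also have "\<dots> \<le> emean m x (\<lambda>y. c)"
      by (intro emean_mono pt x)
    also have "\<dots> = c" using m by (rule emean_const)
    also have "(\<Sum>k\<in>S. pmf P k * prob (B k)) = (\<integral>y. (\<Sum>k\<in>S. pmf P k * indicator (B k) y) \<partial>M)"
      using B_meas by (subst Bochner_Integration.integral_sum)
        (auto simp: emeasure_eq_measure intro!: sum.cong)
    also have "\<dots> \<le> (\<integral>y. c \<partial>M)"
      using B_meas by (intro integral_mono pt) (auto simp: emeasure_eq_measure)
    also have "\<dots> = c" by (simp add: prob_space)
    finally show False by simp
  qed
  then show ?thesis
    using SN unfolding B_def c_def by auto
qed

section \<open>The order of magnitude of a function, read off its approximations\<close>

text \<open>
  If \<open>h i\<close> approximates a number \<open>g\<close> up to a fraction of $2^{-i}$, then the first \<open>i\<close> with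
  $|h_i| \ge 2^{-i}$ reveals the order of magnitude of \<open>g\<close>.
\<close>
definition layer :: "(nat \<Rightarrow> complex) \<Rightarrow> nat \<Rightarrow> bool"
  where "layer h i \<longleftrightarrow> cmod (h i) \<ge> (1/2)^i \<and> (\<forall>j<i. cmod (h j) < (1/2)^j)"

lemma layer_sum_cases:
  obtains (none) "\<And>i. i \<le> t \<Longrightarrow> cmod (h i) < (1/2)^i" "(\<Sum>i\<le>t. (1/4)^i * of_bool (layer h i)) = (0::real)"
  | (one) i where "i \<le> t" "layer h i" "(\<Sum>i\<le>t. (1/4)^i * of_bool (layer h i)) = ((1/4)^i::real)"
proof (cases "\<exists>i\<le>t. cmod (h i) \<ge> (1/2)^i")
  case False
  then have "cmod (h i) < (1/2)^i" if "i \<le> t" for i using that by (meson not_le)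
  moreover from this have "(\<Sum>i\<le>t. (1/4)^i * of_bool (layer h i)) = (0::real)"
    by (intro sum.neutral) (auto simp: layer_def not_le)
  ultimately show ?thesis by (rule none)
next
  case True
  define i where "i = (LEAST i. cmod (h i) \<ge> (1/2)^i)"
  from True have 1: "cmod (h i) \<ge> (1/2)^i"
    unfolding i_def by (metis (mono_tags, lifting) LeastI)
  from True have 2: "i \<le> t"
    unfolding i_def by (meson Least_le order_trans)
  have 3: "cmod (h j) < (1/2)^j" if "j < i" for j
    using not_less_Least[of j "\<lambda>i. cmod (h i) \<ge> (1/2)^i"] that unfolding i_def by (simp add: not_le)
  have lay: "layer h j \<longleftrightarrow> j = i" for j
    using 1 3 by (auto simp: layer_def) (metis linorder_neqE_nat not_le)
  have "(\<Sum>j\<le>t. (1/4)^j * of_bool (layer h j)) = (\<Sum>j\<le>t. if j = i then (1/4)^j else (0::real))"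
    by (intro sum.cong) (auto simp: lay)
  also have "\<dots> = (1/4)^i" using 2 by simp
  finally show ?thesis using 2 lay by (intro one[of i]) auto
qed

lemma layer_sum_bounds: "0 \<le> (\<Sum>i\<le>t. (1/4)^i * of_bool (layer h i) :: real)"
  "(\<Sum>i\<le>t. (1/4)^i * of_bool (layer h i)) \<le> (1::real)"
proof -
  show "0 \<le> (\<Sum>i\<le>t. (1/4)^i * of_bool (layer h i) :: real)"
    by (intro sum_nonneg) auto
  show "(\<Sum>i\<le>t. (1/4)^i * of_bool (layer h i)) \<le> (1::real)"
    by (cases rule: layer_sum_cases[of t h]) (auto simp: power_le_one)
qed

text \<open>
  If \<open>i\<close> is the layer of \<open>h\<close>, then $|g|$ lies between $\tfrac89 2^{-i}$, by the condition at \<open>i\<close>, and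
  $\tfrac{10}9 2^{-(i-1)}$, by the failure of the condition at \<open>i - 1\<close>. If there is no layer up to
  \<open>t\<close>, then $|g|$ is below $\tfrac{10}9 2^{-t}$.
\<close>
lemma layer_sum_approx:
  assumes h: "\<And>i. i \<le> t \<Longrightarrow> cmod (h i - g) \<le> (1/2)^i / 9" and g: "cmod g \<le> 1"
  shows "64/81 * (\<Sum>i\<le>t. (1/4)^i * of_bool (layer h i)) \<le> (cmod g)\<^sup>2"
    and "(cmod g)\<^sup>2 \<le> 400/81 * (\<Sum>i\<le>t. (1/4)^i * of_bool (layer h i)) + 100/81 * (1/4)^t"
proof -
  have sq: "((1/2)^i)\<^sup>2 = (1/4::real)^i" for i
    by (simp add: power_mult_distrib power2_eq_square flip: power_mult_distrib)
  have lo: "cmod g \<ge> cmod (h i) - (1/2)^i / 9" and up: "cmod g \<le> cmod (h i) + (1/2)^i / 9" if "i \<le> t" for i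
    using h[OF that] norm_triangle_ineq2[of "h i" g] norm_triangle_ineq2[of g "h i"]
    by (auto simp: norm_minus_commute)
  have "64/81 * (\<Sum>i\<le>t. (1/4)^i * of_bool (layer h i)) \<le> (cmod g)\<^sup>2 \<and>
    (cmod g)\<^sup>2 \<le> 400/81 * (\<Sum>i\<le>t. (1/4)^i * of_bool (layer h i)) + 100/81 * (1/4)^t"
  proof (cases rule: layer_sum_cases[of t h])
    case none
    have "cmod g \<le> 10/9 * (1/2)^t" using up[of t] none(1)[of t] by simp
    then have "(cmod g)\<^sup>2 \<le> (10/9 * (1/2)^t)\<^sup>2" by (intro power_mono) auto
    also have "\<dots> = 100/81 * (1/4)^t" unfolding power_mult_distrib sq by (simp add: power2_eq_square)
    finally show ?thesis unfolding none(2) by simp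
  next
    case (one i)
    have "cmod g \<ge> 8/9 * (1/2)^i" using lo[of i] one by (simp add: layer_def)
    then have "(8/9 * (1/2)^i)\<^sup>2 \<le> (cmod g)\<^sup>2" by (intro power_mono) auto
    then have 1: "64/81 * (1/4)^i \<le> (cmod g)\<^sup>2"
      unfolding power_mult_distrib sq by (simp add: power2_eq_square)
    have "cmod g \<le> 20/9 * (1/2)^i"
    proof (cases i)
      case 0
      then show ?thesis using g by simp
    next
      case (Suc j)
      then show ?thesis using up[of j] one by (auto simp: layer_def)
    qed
    then have "(cmod g)\<^sup>2 \<le> (20/9 * (1/2)^i)\<^sup>2" by (intro power_mono) auto
    then have 2: "(cmod g)\<^sup>2 \<le> 400/81 * (1/4)^i"
      unfolding power_mult_distrib sq by (simp add: power2_eq_square)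
    have "0 \<le> 100/81 * (1/4::real)^t" by simp
    with 1 2 show ?thesis unfolding one(3) by linarith
  qed
  then show "64/81 * (\<Sum>i\<le>t. (1/4)^i * of_bool (layer h i)) \<le> (cmod g)\<^sup>2"
    and "(cmod g)\<^sup>2 \<le> 400/81 * (\<Sum>i\<le>t. (1/4)^i * of_bool (layer h i)) + 100/81 * (1/4)^t" by auto
qed

section \<open>Frequencies of all cells\<close>

text \<open>
  The number of atoms at level \<open>j\<close>. Precision $2^{-j}/9$ with failure probability of order $8^{-t}$
  costs a multiple of $4^j (t+1)$ atoms by Hoeffding's inequality.
\<close>
definition atoms_at_level :: "nat \<Rightarrow> nat \<Rightarrow> nat"
  where "atoms_at_level t j = 1000 * (t + 1) * 4 ^ j"

text \<open>
  A function on \<open>slots t i\<close> with values below \<open>N\<close> chooses the atoms of the averages of levels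
  \<open>0, \<dots>, i\<close>, which is all that a cell of level \<open>i\<close> depends on.
\<close>
definition slots :: "nat \<Rightarrow> nat \<Rightarrow> (nat \<times> nat) set"
  where "slots t i = (SIGMA j:{..i}. {..<atoms_at_level t j})"

definition level_approx :: "(nat \<Rightarrow> 'a \<Rightarrow> complex) \<Rightarrow> nat \<Rightarrow> (nat \<times> nat \<Rightarrow> nat) \<Rightarrow> 'a \<Rightarrow> nat \<Rightarrow> complex"
  where "level_approx \<psi> t \<kappa> y j = atom_average (atoms_at_level t j) \<psi> (\<lambda>l. \<kappa> (j, l)) y"

definition cell :: "'a measure \<Rightarrow> (nat \<Rightarrow> 'a \<Rightarrow> complex) \<Rightarrow> nat \<Rightarrow> nat \<Rightarrow> (nat \<times> nat \<Rightarrow> nat) \<Rightarrow> 'a set"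
  where "cell M \<psi> t i \<kappa> = {y\<in>space M. layer (level_approx \<psi> t \<kappa> y) i}"

lemma finite_slots: "finite (slots t i)"
  by (simp add: slots_def)

lemma level_approx_cong:
  assumes "\<And>p. p \<in> slots t i \<Longrightarrow> \<kappa> p = \<kappa>' p" "j \<le> i"
  shows "level_approx \<psi> t \<kappa> y j = level_approx \<psi> t \<kappa>' y j"
  using assms unfolding level_approx_def atom_average_def slots_def by (intro arg_cong2[where f = "(/)"] sum.cong) auto

lemma cell_cong:
  assumes "\<And>p. p \<in> slots t i \<Longrightarrow> \<kappa> p = \<kappa>' p"
  shows "cell M \<psi> t i \<kappa> = cell M \<psi> t i \<kappa>'"
proof -
  have "level_approx \<psi> t \<kappa> y j = level_approx \<psi> t \<kappa>' y j" if "j \<le> i" for y j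
    using assms that by (intro level_approx_cong[of t i]) auto
  then have "layer (level_approx \<psi> t \<kappa> y) i \<longleftrightarrow> layer (level_approx \<psi> t \<kappa>' y) i" for y
    unfolding layer_def by (metis order_less_imp_le order_refl)
  then show ?thesis unfolding cell_def by simp
qed

lemma cell_sets:
  assumes "\<And>j. j < N \<Longrightarrow> \<psi> j \<in> borel_measurable M" "\<And>p. p \<in> slots t i \<Longrightarrow> \<kappa> p < N"
  shows "cell M \<psi> t i \<kappa> \<in> sets M"
proof -
  have [measurable]: "(\<lambda>y. level_approx \<psi> t \<kappa> y j) \<in> borel_measurable M" if "j \<le> i" for j
    using assms that unfolding level_approx_def atom_average_def slots_def
    by (intro borel_measurable_divide borel_measurable_sum) auto
  have "cell M \<psi> t i \<kappa> = {y\<in>space M. cmod (level_approx \<psi> t \<kappa> y i) \<ge> (1/2)^i} \<inter>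
      (space M \<inter> (\<Inter>j\<in>{..<i}. {y\<in>space M. cmod (level_approx \<psi> t \<kappa> y j) < (1/2)^j}))"
    by (auto simp: cell_def layer_def)
  also have "\<dots> \<in> sets M"
    by (cases "i = 0") (auto intro!: sets.Int sets.finite_INT borel_measurable_le borel_measurable_less)
  finally show ?thesis .
qed

lemma card_codes_le:
  assumes "N \<ge> 1"
  shows "real (card (PiE (slots t i) (\<lambda>_. {..<N}))) \<le> exp (1334 * (real t + 1) * 4^i * ln (real N))"
proof -
  have "card (slots t i) = (\<Sum>j\<le>i. atoms_at_level t j)"
    unfolding slots_def by simp
  also have "3 * \<dots> \<le> 4000 * (t + 1) * 4 ^ i"
    by (induction i) (auto simp: atoms_at_level_def algebra_simps)
  finally have "3 * card (slots t i) \<le> 4000 * (t + 1) * 4 ^ i" by simp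
  then have "real (3 * card (slots t i)) \<le> real (4000 * (t + 1) * 4 ^ i)"
    by (rule of_nat_mono)
  then have 1: "real (card (slots t i)) \<le> 4000/3 * (real t + 1) * 4 ^ i" by (simp add: algebra_simps)
  have "4000/3 * (real t + 1) * 4 ^ i \<le> 1334 * (real t + 1) * 4 ^ i"
    by (intro mult_right_mono) auto
  with 1 have 2: "real (card (slots t i)) \<le> 1334 * (real t + 1) * 4 ^ i" by linarith
  have "real (card (PiE (slots t i) (\<lambda>_. {..<N}))) = real N ^ card (slots t i)"
    by (simp add: card_PiE finite_slots)
  also have "\<dots> = exp (real (card (slots t i)) * ln (real N))"
    using assms by (simp add: exp_of_nat_mult)
  also have "\<dots> \<le> exp (1334 * (real t + 1) * 4 ^ i * ln (real N))"
    using assms 2 by (simp add: mult_right_mono)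
  finally show ?thesis .
qed

lemma half_powers_sum: "(\<Sum>i\<le>t. (1/2::real)^i) \<le> 2"
proof -
  have "(\<Sum>i\<le>t. (1/2::real)^i) = 2 - (1/2)^t"
    by (induction t) auto
  then show ?thesis by simp
qed

text \<open>
  The permitted error of the frequency of a level-\<open>i\<close> cell. The first summand pays for the number of
  cells, the second one for the confidence level. Splitting it like this keeps the
  factor \<open>t + 1\<close>, the number of levels, away from \<open>ln (2 / \<epsilon>)\<close> in the sample size.
\<close>
definition slack :: "real \<Rightarrow> nat \<Rightarrow> nat \<Rightarrow> real"
  where "slack \<eta> t i = \<eta> * (4^i / (real t + 1) + 2^i)"

lemma slack_sum:
  assumes "\<eta> \<ge> 0"
  shows "(\<Sum>i\<le>t. (1/4)^i * slack \<eta> t i) \<le> 3 * \<eta>"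
proof -
  have "(1/4)^i * slack \<eta> t i = \<eta> * (1 / (real t + 1) + (1/2)^i)" for i
  proof -
    have "(1/4)^i * (4^i / (real t + 1)) = 1 / (real t + 1)"
      by (simp add: power_divide)
    moreover have "(1/4::real)^i * 2^i = (1/2)^i"
      by (simp flip: power_mult_distrib)
    ultimately show ?thesis unfolding slack_def by (simp add: algebra_simps)
  qed
  then have "(\<Sum>i\<le>t. (1/4)^i * slack \<eta> t i) = \<eta> * ((\<Sum>i\<le>t. 1 / (real t + 1)) + (\<Sum>i\<le>t. (1/2)^i))"
    by (simp only: sum_distrib_left sum.distrib[symmetric])
  also have "(\<Sum>i\<le>t. 1 / (real t + 1)) = 1"
    by (simp add: field_simps)
  also have "(\<Sum>i\<le>t. (1/2::real)^i) \<le> 2"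
    by (rule half_powers_sum)
  then have "\<eta> * (1 + (\<Sum>i\<le>t. (1/2)^i)) \<le> \<eta> * (1 + 2)"
    using assms by (intro mult_left_mono) auto
  finally show ?thesis by simp
qed

text \<open>
  By \<open>card_codes_le\<close>, the first summand of the slack absorbs the number of cells. The second one
  is at least $2^i(\ln(2/\varepsilon) + 1)$ after multiplication by \<open>m\<close>, so that the failure
  probabilities of the levels form a geometric series.
\<close>
lemma code_failure_sum:
  assumes N: "N \<ge> 1" and \<epsilon>: "0 < \<epsilon>" "\<epsilon> \<le> 2"
    and m: "real m * \<eta> \<ge> 1334 * (real t + 1)\<^sup>2 * ln (real N) + ln (2 / \<epsilon>) + 1"
  shows "(\<Sum>i\<le>t. real (card (PiE (slots t i) (\<lambda>_. {..<N}))) * (2 * exp (- (real m * slack \<eta> t i)))) \<le> \<epsilon>"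
proof -
  have lN: "ln (real N) \<ge> 0" using N by simp
  have le: "ln (2 / \<epsilon>) \<ge> 0" using \<epsilon> by simp
  have term_le: "real (card (PiE (slots t i) (\<lambda>_. {..<N}))) * (2 * exp (- (real m * slack \<eta> t i))) \<le> \<epsilon> * (1/2)^(i+1)" for i
  proof -
    have "real (t + 1) * (1334 * (real t + 1) * ln (real N)) \<le> real m * \<eta>"
      using m le by (simp add: power2_eq_square algebra_simps)
    then have "1334 * (real t + 1) * ln (real N) \<le> real m * \<eta> / (real t + 1)"
      by (simp add: field_simps)
    from mult_right_mono[OF this, of "4^i"]
    have a: "1334 * (real t + 1) * 4^i * ln (real N) \<le> real m * \<eta> * (4^i / (real t + 1))"
      by (simp add: field_simps)
    have "0 \<le> 1334 * (real t + 1)\<^sup>2 * ln (real N)" using lN by simp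
    then have "ln (2 / \<epsilon>) + 1 \<le> real m * \<eta>" using m by linarith
    then have "(ln (2 / \<epsilon>) + 1) * 2^i \<le> real m * \<eta> * 2^i"
      by (intro mult_right_mono) auto
    moreover have "ln (2 / \<epsilon>) * 1 \<le> ln (2 / \<epsilon>) * 2^i"
      using le by (intro mult_left_mono) auto
    moreover have "real (i + 1) \<le> 2 ^ i"
    proof -
      have "i + 1 \<le> 2 ^ i" by (induction i) auto
      then have "real (i + 1) \<le> real (2 ^ i)" by (rule of_nat_mono)
      then show ?thesis by simp
    qed
    ultimately have b: "ln (2 / \<epsilon>) + real (i + 1) \<le> real m * \<eta> * 2^i"
      by (simp add: algebra_simps)
    have "real m * slack \<eta> t i = real m * \<eta> * (4^i / (real t + 1)) + real m * \<eta> * 2^i"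
      by (simp add: slack_def algebra_simps)
    with a b have c: "1334 * (real t + 1) * 4^i * ln (real N) - real m * slack \<eta> t i \<le> - (ln (2 / \<epsilon>) + real (i + 1))"
      by linarith
    have "real (card (PiE (slots t i) (\<lambda>_. {..<N}))) * (2 * exp (- (real m * slack \<eta> t i)))
       \<le> exp (1334 * (real t + 1) * 4^i * ln (real N)) * (2 * exp (- (real m * slack \<eta> t i)))"
      using card_codes_le[OF N] by (intro mult_right_mono) auto
    also have "\<dots> = 2 * exp (1334 * (real t + 1) * 4^i * ln (real N) - real m * slack \<eta> t i)"
      by (simp add: exp_diff exp_minus field_simps)
    also have "\<dots> \<le> 2 * exp (- (ln (2 / \<epsilon>) + real (i + 1)))"
      using c by simp
    also have "\<dots> = \<epsilon> * exp (-1) ^ (i+1)"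
      using \<epsilon> by (simp add: exp_of_nat_mult[symmetric] exp_add exp_minus exp_diff divide_simps)
    also have "\<dots> \<le> \<epsilon> * (1/2)^(i+1)"
    proof -
      have "exp (-1::real) \<le> 1/2"
        using exp_ge_add_one_self[of "1::real"] by (simp add: exp_minus field_simps)
      then show ?thesis using \<epsilon> by (intro mult_left_mono power_mono) auto
    qed
    finally show ?thesis .
  qed
  have "(\<Sum>i\<le>t. real (card (PiE (slots t i) (\<lambda>_. {..<N}))) * (2 * exp (- (real m * slack \<eta> t i))))
      \<le> (\<Sum>i\<le>t. \<epsilon> * (1/2)^(i+1))"
    by (intro sum_mono term_le)
  also have "\<dots> = \<epsilon> * ((1/2) * (\<Sum>i\<le>t. (1/2)^i))"
    by (simp add: sum_distrib_left)
  also have "(\<Sum>i\<le>t. (1/2::real)^i) \<le> 2"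
    by (rule half_powers_sum)
  then have "\<epsilon> * ((1/2) * (\<Sum>i\<le>t. (1/2)^i)) \<le> \<epsilon> * 1"
    using \<epsilon> by (intro mult_left_mono) auto
  finally show ?thesis by simp
qed

lemma (in prob_space) cells_uniform:
  fixes \<psi> :: "nat \<Rightarrow> 'a \<Rightarrow> complex"
  assumes meas: "\<And>j. j < N \<Longrightarrow> \<psi> j \<in> borel_measurable M" and N: "N \<ge> 1" and m: "m > 0"
    and \<epsilon>: "0 < \<epsilon>" "\<epsilon> \<le> 2"
    and mb: "real m * \<eta> \<ge> 1334 * (real t + 1)\<^sup>2 * ln (real N) + ln (2 / \<epsilon>) + 1"
  shows "\<exists>F\<in>sets (PiM {..<m} (\<lambda>_. M)). measure (PiM {..<m} (\<lambda>_. M)) F \<le> \<epsilon> \<and>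
    (\<forall>x\<in>space (PiM {..<m} (\<lambda>_. M)) - F. \<forall>i\<le>t. \<forall>\<kappa>. (\<forall>p\<in>slots t i. \<kappa> p < N) \<longrightarrow>
      freq m x (cell M \<psi> t i \<kappa>) \<le> 2 * prob (cell M \<psi> t i \<kappa>) + slack \<eta> t i \<and>
      freq m x (cell M \<psi> t i \<kappa>) \<ge> prob (cell M \<psi> t i \<kappa>) / 2 - slack \<eta> t i)"
proof -
  let ?P = "PiM {..<m} (\<lambda>_. M)"
  interpret P: prob_space ?P
    by (intro prob_space_PiM prob_space_axioms)
  define K where "K = (\<lambda>i. PiE (slots t i) (\<lambda>_. {..<N}))"
  define U where "U = (\<lambda>i \<kappa>. {x \<in> space ?P. freq m x (cell M \<psi> t i \<kappa>) \<ge> 2 * prob (cell M \<psi> t i \<kappa>) + slack \<eta> t i})"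
  define V where "V = (\<lambda>i \<kappa>. {x \<in> space ?P. freq m x (cell M \<psi> t i \<kappa>) \<le> prob (cell M \<psi> t i \<kappa>) / 2 - slack \<eta> t i})"
  define F where "F = (\<Union>i\<in>{..t}. \<Union>\<kappa>\<in>K i. U i \<kappa> \<union> V i \<kappa>)"
  have finK: "finite (K i)" for i
    unfolding K_def by (intro finite_PiE finite_slots) auto
  have cs: "cell M \<psi> t i \<kappa> \<in> sets M" if "\<kappa> \<in> K i" for i \<kappa>
    using that by (intro cell_sets[OF meas]) (auto simp: K_def PiE_def Pi_def)
  have fm: "(\<lambda>x. freq m x (cell M \<psi> t i \<kappa>)) \<in> borel_measurable ?P" if "\<kappa> \<in> K i" for i \<kappa>
    unfolding emean_def using cs[OF that] by measurable
  have Us: "U i \<kappa> \<in> sets ?P" and Vs: "V i \<kappa> \<in> sets ?P" if "\<kappa> \<in> K i" for i \<kappa>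
    unfolding U_def V_def using fm[OF that] by measurable
  have UVle: "measure ?P (U i \<kappa> \<union> V i \<kappa>) \<le> 2 * exp (- (real m * slack \<eta> t i))" if "\<kappa> \<in> K i" for i \<kappa>
  proof -
    have "measure ?P (U i \<kappa> \<union> V i \<kappa>) \<le> measure ?P (U i \<kappa>) + measure ?P (V i \<kappa>)"
      by (intro measure_Un_le Us Vs that)
    also have "\<dots> \<le> exp (- (real m * slack \<eta> t i)) + exp (- (real m * slack \<eta> t i))"
      unfolding U_def V_def by (intro add_mono chernoff_upper chernoff_lower cs[OF that] m)
    finally show ?thesis by simp
  qed
  have Fs: "F \<in> sets ?P"
    unfolding F_def by (intro sets.finite_UN finK finite_atMost sets.Un Us Vs)
  have "measure ?P F \<le> (\<Sum>i\<le>t. measure ?P (\<Union>\<kappa>\<in>K i. U i \<kappa> \<union> V i \<kappa>))"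
    unfolding F_def by (intro measure_UNION_le finite_atMost sets.finite_UN finK sets.Un Us Vs)
  also have "\<dots> \<le> (\<Sum>i\<le>t. \<Sum>\<kappa>\<in>K i. measure ?P (U i \<kappa> \<union> V i \<kappa>))"
    by (intro sum_mono measure_UNION_le finK sets.Un Us Vs)
  also have "\<dots> \<le> (\<Sum>i\<le>t. \<Sum>\<kappa>\<in>K i. 2 * exp (- (real m * slack \<eta> t i)))"
    by (intro sum_mono UVle)
  also have "\<dots> = (\<Sum>i\<le>t. real (card (K i)) * (2 * exp (- (real m * slack \<eta> t i))))"
    by simp
  also have "\<dots> \<le> \<epsilon>"
    unfolding K_def by (rule code_failure_sum[OF N \<epsilon> mb])
  finally have Fle: "measure ?P F \<le> \<epsilon>" .
  have "freq m x (cell M \<psi> t i \<kappa>) \<le> 2 * prob (cell M \<psi> t i \<kappa>) + slack \<eta> t i \<and>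
      freq m x (cell M \<psi> t i \<kappa>) \<ge> prob (cell M \<psi> t i \<kappa>) / 2 - slack \<eta> t i"
    if x: "x \<in> space ?P - F" and i: "i \<le> t" and \<kappa>: "\<forall>p\<in>slots t i. \<kappa> p < N" for x i \<kappa>
  proof -
    define \<kappa>' where "\<kappa>' = restrict \<kappa> (slots t i)"
    have K': "\<kappa>' \<in> K i" using \<kappa> by (auto simp: K_def \<kappa>'_def)
    have eq: "cell M \<psi> t i \<kappa> = cell M \<psi> t i \<kappa>'"
      by (rule cell_cong) (simp add: \<kappa>'_def)
    have "x \<notin> U i \<kappa>'" "x \<notin> V i \<kappa>'" using x i K' unfolding F_def by auto
    then show ?thesis using x unfolding eq U_def V_def by auto
  qed
  with Fs Fle show ?thesis by blast
qed

section \<open>Uniform comparison of second moments\<close>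

text \<open>
  This bounds the measure of the points where one of the approximations is bad. The atoms are
  numerous enough for each level to contribute at most $8^{-t}$, which leaves room for \<open>t + 1\<close> levels.
\<close>
lemma bad_probability_sum:
  "(\<Sum>j\<le>t. 8 * exp (- (real (atoms_at_level t j) * ((1/2)^j / 9)\<^sup>2 / 4))) \<le> (1/4)^t"
proof -
  have "8 * exp (- (real (atoms_at_level t j) * ((1/2)^j / 9)\<^sup>2 / 4)) \<le> (1/8)^t" for j
  proof -
    have "4^j * ((1/2::real)^j)\<^sup>2 = 1"
      by (simp add: power2_eq_square flip: power_mult_distrib)
    then have "real (atoms_at_level t j) * ((1/2)^j / 9)\<^sup>2 / 4 = 1000 / 324 * (real t + 1)"
      by (simp add: atoms_at_level_def power_divide field_simps)
    also have "\<dots> \<ge> 3 * (real t + 1)" by simp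
    finally have "exp (- (real (atoms_at_level t j) * ((1/2)^j / 9)\<^sup>2 / 4)) \<le> exp (- (3 * (real t + 1)))"
      by simp
    also have "\<dots> = exp (-1) ^ (3 * (t + 1))"
      by (simp add: exp_of_nat_mult[symmetric] algebra_simps)
    also have "\<dots> \<le> (1/2) ^ (3 * (t + 1))"
      using exp_ge_add_one_self[of "1::real"] by (intro power_mono) (simp_all add: exp_minus field_simps)
    also have "\<dots> = (1/8)^(t+1)"
      by (subst power_mult) (simp add: power3_eq_cube)
    finally show ?thesis by simp
  qed
  then have "(\<Sum>j\<le>t. 8 * exp (- (real (atoms_at_level t j) * ((1/2)^j / 9)\<^sup>2 / 4))) \<le> (\<Sum>j\<le>t. (1/8)^t)"
    by (intro sum_mono)
  also have "\<dots> = (real t + 1) * (1/8)^t" by simp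
  also have "\<dots> \<le> 2^t * (1/8)^t"
  proof -
    have "t + 1 \<le> 2 ^ t" by (induction t) auto
    then have "real (t + 1) \<le> real (2 ^ t)" by (rule of_nat_mono)
    then show ?thesis by (intro mult_right_mono) auto
  qed
  also have "\<dots> = (1/4)^t" by (simp flip: power_mult_distrib)
  finally show ?thesis .
qed

text \<open>
  Two-sided comparison of the empirical and the true second moment up to the constants \<open>2/25\<close> and
  \<open>13\<close> that the layer decomposition yields, with an additive error.
\<close>
definition moments_agree :: "'a measure \<Rightarrow> nat \<Rightarrow> (nat \<Rightarrow> 'a) \<Rightarrow> ('a \<Rightarrow> complex) \<Rightarrow> real \<Rightarrow> bool"
  where "moments_agree M m x g \<delta> \<longleftrightarrow>
    2/25 * (\<integral>y. (cmod (g y))\<^sup>2 \<partial>M) - \<delta> \<le> emean m x (\<lambda>y. (cmod (g y))\<^sup>2) \<and>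
    emean m x (\<lambda>y. (cmod (g y))\<^sup>2) \<le> 13 * (\<integral>y. (cmod (g y))\<^sup>2 \<partial>M) + \<delta>"

text \<open>
  With \<open>S = (\<Sum>i\<le>t. (1/4)^i * indicator (cell i))\<close>, the function $|g|^2$ lies between \<open>64/81 * S\<close> and
  \<open>400/81 * S\<close>, up to an error of order \<open>\<eta>\<close> and a bad set \<open>W\<close> of small measure. Hence
  the comparison of cell frequencies with cell probabilities passes to the second moments.
\<close>
theorem (in prob_space) uniform_second_moment_hull:
  fixes \<psi> :: "nat \<Rightarrow> 'a \<Rightarrow> complex"
  assumes meas: "\<And>j. j < N \<Longrightarrow> \<psi> j \<in> borel_measurable M"
    and bd: "\<And>j y. j < N \<Longrightarrow> y \<in> space M \<Longrightarrow> cmod (\<psi> j y) \<le> 1"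
    and N: "N \<ge> 1" and m: "m > 0" and \<epsilon>: "0 < \<epsilon>" "\<epsilon> \<le> 2" and \<eta>: "(1/4)^t \<le> \<eta>"
    and mb: "real m * \<eta> \<ge> 1334 * (real t + 1)\<^sup>2 * ln (real N) + ln (2 / \<epsilon>) + 1"
  shows "\<exists>F\<in>sets (PiM {..<m} (\<lambda>_. M)). measure (PiM {..<m} (\<lambda>_. M)) F \<le> \<epsilon> \<and>
    (\<forall>x\<in>space (PiM {..<m} (\<lambda>_. M)) - F. \<forall>q g. set_pmf q \<subseteq> {..<N} \<longrightarrow>
      g = (\<lambda>y. measure_pmf.expectation q (\<lambda>j. \<psi> j y)) \<longrightarrow>
      moments_agree M m x g (30 * \<eta>))"
proof -
  let ?P = "PiM {..<m} (\<lambda>_. M)"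
  have \<eta>0: "\<eta> > 0" using \<eta> by (rule less_le_trans[rotated]) simp
  obtain F where F: "F \<in> sets ?P" and F2: "measure ?P F \<le> \<epsilon> \<and>
    (\<forall>x\<in>space ?P - F. \<forall>i\<le>t. \<forall>\<kappa>. (\<forall>p\<in>slots t i. \<kappa> p < N) \<longrightarrow>
      freq m x (cell M \<psi> t i \<kappa>) \<le> 2 * prob (cell M \<psi> t i \<kappa>) + slack \<eta> t i \<and>
      freq m x (cell M \<psi> t i \<kappa>) \<ge> prob (cell M \<psi> t i \<kappa>) / 2 - slack \<eta> t i)"
    using cells_uniform[OF meas N m \<epsilon> mb] by (rule bexE)
  note freqs0 = F2[THEN conjunct2, rule_format]
  have freqs: "freq m x (cell M \<psi> t i \<kappa>) \<le> 2 * prob (cell M \<psi> t i \<kappa>) + slack \<eta> t i"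
      "freq m x (cell M \<psi> t i \<kappa>) \<ge> prob (cell M \<psi> t i \<kappa>) / 2 - slack \<eta> t i"
    if "x \<in> space ?P - F" "i \<le> t" "\<And>p. p \<in> slots t i \<Longrightarrow> \<kappa> p < N" for x i \<kappa>
    using freqs0[OF that(1,2), of \<kappa>] that(3) by simp_all
  have "moments_agree M m x g (30 * \<eta>)"
    if xF: "x \<in> space ?P - F" and q: "set_pmf q \<subseteq> {..<N}"
      and g: "g = (\<lambda>y. measure_pmf.expectation q (\<lambda>j. \<psi> j y))" for x q g
  proof -
    have xs: "x i \<in> space M" if "i < m" for i
      using xF that by (auto simp: space_PiM)
    have finq: "finite (set_pmf q)"
      using q finite_subset by blast
    have gsum: "g y = (\<Sum>j\<in>set_pmf q. of_real (pmf q j) * \<psi> j y)" for y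
      unfolding g by (subst integral_measure_pmf[OF finq]) (auto simp: scaleR_conv_of_real)
    have gm[measurable]: "g \<in> borel_measurable M"
      unfolding gsum using q meas by (intro borel_measurable_sum borel_measurable_times) auto
    have g1: "cmod (g y) \<le> 1" if "y \<in> space M" for y
    proof -
      have "cmod (g y) \<le> (\<Sum>j\<in>set_pmf q. cmod (of_real (pmf q j) * \<psi> j y))"
        unfolding gsum by (rule norm_sum)
      also have "\<dots> \<le> (\<Sum>j\<in>set_pmf q. pmf q j * 1)"
        using bd q that by (intro sum_mono) (auto simp: norm_mult intro!: mult_left_le)
      also have "\<dots> = 1" using sum_pmf_eq_1[OF finq, of q] by simp
      finally show ?thesis .
    qed
    define B where "B = (\<lambda>j k. {y\<in>space M. cmod (atom_average (atoms_at_level t j) \<psi> k y - g y) > (1/2)^j / 9})"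
    have "\<exists>k. (\<forall>l<atoms_at_level t j. k l < N) \<and> prob (B j k) + freq m x (B j k)
        \<le> 8 * exp (- (real (atoms_at_level t j) * ((1/2)^j / 9)\<^sup>2 / 4))" for j
      unfolding B_def using maurey[OF meas bd q _ _ m xs g, of "atoms_at_level t j" "(1/2)^j / 9"]
      by (simp add: atoms_at_level_def)
    then obtain k where k: "\<And>j l. l < atoms_at_level t j \<Longrightarrow> k j l < N"
      and Bk: "\<And>j. prob (B j (k j)) + freq m x (B j (k j)) \<le> 8 * exp (- (real (atoms_at_level t j) * ((1/2)^j / 9)\<^sup>2 / 4))"
      by metis
    define \<kappa> where "\<kappa> = (\<lambda>(j, l). k j l)"
    have \<kappa>N: "\<kappa> p < N" if "p \<in> slots t i" for p i
      using that k by (auto simp: \<kappa>_def slots_def)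
    have Bs: "B j (k j) \<in> sets M" for j
    proof -
      have "atom_average (atoms_at_level t j) \<psi> (k j) \<in> borel_measurable M"
        unfolding atom_average_def using k meas by (intro borel_measurable_divide borel_measurable_sum) auto
      then show ?thesis unfolding B_def by measurable
    qed
    \<comment> \<open>Off \<open>W\<close> all averages are accurate; on \<open>W\<close> the trivial bounds by 1 are used.\<close>
    define W where "W = (\<Union>j\<le>t. B j (k j))"
    have Ws[measurable]: "W \<in> sets M" unfolding W_def using Bs by auto
    define S where "S = (\<lambda>y. \<Sum>i\<le>t. (1/4)^i * indicator (cell M \<psi> t i \<kappa>) y :: real)"
    have cs[measurable]: "cell M \<psi> t i \<kappa> \<in> sets M" for i
      using meas \<kappa>N by (rule cell_sets)
    have S_layer: "S y = (\<Sum>i\<le>t. (1/4)^i * of_bool (layer (level_approx \<psi> t \<kappa> y) i))" if "y \<in> space M" for y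
      unfolding S_def cell_def using that by (intro sum.cong) auto
    have Sm[measurable]: "S \<in> borel_measurable M" unfolding S_def by measurable
    have S01: "0 \<le> S y" "S y \<le> 1" if "y \<in> space M" for y
      unfolding S_layer[OF that] by (rule layer_sum_bounds)+
    have pt: "64/81 * S y \<le> (cmod (g y))\<^sup>2 + indicator W y \<and>
        (cmod (g y))\<^sup>2 \<le> 400/81 * S y + 100/81 * \<eta> + indicator W y" if y: "y \<in> space M" for y
    proof (cases "y \<in> W")
      case True
      have "(cmod (g y))\<^sup>2 \<le> 1" using g1[OF y] by (simp add: power_le_one)
      moreover have "0 \<le> (cmod (g y))\<^sup>2" by (rule zero_le_power2)
      moreover have "indicator W y = (1::real)" using True by simp
      ultimately show ?thesis using S01[OF y] \<eta>0 by linarith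
    next
      case False
      then have "cmod (level_approx \<psi> t \<kappa> y i - g y) \<le> (1/2)^i / 9" if "i \<le> t" for i
        using that y by (auto simp: W_def B_def level_approx_def \<kappa>_def not_less)
      note approx = layer_sum_approx[of t "level_approx \<psi> t \<kappa> y" "g y", OF this g1[OF y],
          folded S_layer[OF y]]
      have "indicator W y = (0::real)" using False by simp
      then show ?thesis using approx \<eta> by linarith
    qed
    have int_g: "integrable M (\<lambda>y. (cmod (g y))\<^sup>2)"
      using g1 by (intro integrable_const_bound[of _ 1]) (auto intro!: AE_I2 power_le_one)
    have int_S: "integrable M S"
      using S01 by (intro integrable_const_bound[of _ 1]) (auto intro!: AE_I2)
    have int_W: "integrable M (indicator W :: 'a \<Rightarrow> real)"
      by (simp add: emeasure_eq_measure)
    define G PS w where "G = expectation (\<lambda>y. (cmod (g y))\<^sup>2)" and "PS = expectation S" and "w = prob W"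
    define G' PS' w' where "G' = emean m x (\<lambda>y. (cmod (g y))\<^sup>2)" and "PS' = emean m x S" and "w' = freq m x W"
    have eW: "expectation (indicator W) = w" by (simp add: w_def)
    have "expectation (\<lambda>y. 64/81 * S y) \<le> expectation (\<lambda>y. (cmod (g y))\<^sup>2 + indicator W y)"
      using pt int_g int_S int_W by (intro integral_mono) auto
    then have 1: "64/81 * PS \<le> G + w"
      using int_g int_W by (simp add: PS_def G_def w_def)
    have "expectation (\<lambda>y. (cmod (g y))\<^sup>2) \<le> expectation (\<lambda>y. 400/81 * S y + 100/81 * \<eta> + indicator W y)"
      using pt int_g int_S int_W by (intro integral_mono) auto
    then have 2: "G \<le> 400/81 * PS + 100/81 * \<eta> + w"
      using int_S int_W by (simp add: PS_def G_def w_def prob_space)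
    have "emean m x (\<lambda>y. 64/81 * S y) \<le> emean m x (\<lambda>y. (cmod (g y))\<^sup>2 + indicator W y)"
      using pt xs by (intro emean_mono) auto
    then have 3: "64/81 * PS' \<le> G' + w'"
      unfolding emean_add emean_cmult PS'_def G'_def w'_def .
    have "emean m x (\<lambda>y. (cmod (g y))\<^sup>2) \<le> emean m x (\<lambda>y. 400/81 * S y + 100/81 * \<eta> + indicator W y)"
      using pt xs by (intro emean_mono) auto
    then have 4: "G' \<le> 400/81 * PS' + 100/81 * \<eta> + w'"
      unfolding emean_add emean_cmult emean_const[OF m] PS'_def G'_def w'_def .
    have PS: "PS = (\<Sum>i\<le>t. (1/4)^i * prob (cell M \<psi> t i \<kappa>))"
      unfolding PS_def S_def by (subst Bochner_Integration.integral_sum) (auto simp: emeasure_eq_measure)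
    have PS': "PS' = (\<Sum>i\<le>t. (1/4)^i * freq m x (cell M \<psi> t i \<kappa>))"
      unfolding PS'_def S_def emean_sum emean_cmult ..
    have "PS' \<le> (\<Sum>i\<le>t. (1/4)^i * (2 * prob (cell M \<psi> t i \<kappa>) + slack \<eta> t i))"
      unfolding PS' using freqs[OF xF _ \<kappa>N] by (intro sum_mono mult_left_mono) auto
    also have "\<dots> = 2 * PS + (\<Sum>i\<le>t. (1/4)^i * slack \<eta> t i)"
      unfolding PS by (simp add: sum_distrib_left sum.distrib[symmetric] algebra_simps)
    finally have 5: "PS' \<le> 2 * PS + 3 * \<eta>"
      using slack_sum[of \<eta> t] \<eta>0 by simp
    have "PS / 2 - (\<Sum>i\<le>t. (1/4)^i * slack \<eta> t i) = (\<Sum>i\<le>t. (1/4)^i * (prob (cell M \<psi> t i \<kappa>) / 2 - slack \<eta> t i))"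
      unfolding PS by (simp add: sum_divide_distrib sum_subtractf[symmetric] algebra_simps)
    also have "\<dots> \<le> PS'"
      unfolding PS' using freqs[OF xF _ \<kappa>N] by (intro sum_mono mult_left_mono) auto
    finally have 6: "PS' \<ge> PS / 2 - 3 * \<eta>"
      using slack_sum[of \<eta> t] \<eta>0 by simp
    have wle: "w \<le> (\<Sum>j\<le>t. prob (B j (k j)))"
      unfolding w_def W_def by (intro measure_UNION_le Bs) auto
    have "indicator W y \<le> (\<Sum>j\<le>t. indicator (B j (k j)) y :: real)" for y
    proof (cases "y \<in> W")
      case True
      then obtain j where j: "j \<le> t" "y \<in> B j (k j)" unfolding W_def by blast
      have "indicator (B j (k j)) y \<le> (\<Sum>j\<le>t. indicator (B j (k j)) y :: real)"
        using j(1) by (intro member_le_sum[of j "{..t}" "\<lambda>j. indicator (B j (k j)) y :: real"]) simp_all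
      then show ?thesis using j True by simp
    next
      case False
      then have "indicator W y = (0::real)" by simp
      then show ?thesis by (simp only:) (intro sum_nonneg, simp)
    qed
    then have "w' \<le> emean m x (\<lambda>y. \<Sum>j\<le>t. indicator (B j (k j)) y)"
      unfolding w'_def by (intro emean_mono)
    then have w'le: "w' \<le> (\<Sum>j\<le>t. freq m x (B j (k j)))"
      unfolding emean_sum .
    have "(\<Sum>j\<le>t. prob (B j (k j))) + (\<Sum>j\<le>t. freq m x (B j (k j))) \<le>
        (\<Sum>j\<le>t. 8 * exp (- (real (atoms_at_level t j) * ((1/2)^j / 9)\<^sup>2 / 4)))"
      unfolding sum.distrib[symmetric] by (intro sum_mono Bk)
    with wle w'le bad_probability_sum[of t] \<eta> have 7: "w + w' \<le> \<eta>" by linarith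
    have 8: "w \<ge> 0" "w' \<ge> 0"
      by (auto simp: w_def w'_def emean_def intro!: divide_nonneg_nonneg sum_nonneg)
    have 9: "G \<ge> 0" unfolding G_def by simp
    show ?thesis
      unfolding moments_agree_def G_def[symmetric] G'_def[symmetric] using 1 2 3 4 5 6 7 8 9 \<eta>0 by linarith
  qed
  with F F2[THEN conjunct1] show ?thesis by (intro bexI[of _ F]) simp_all
qed

lemma sum_lessThan_mult4:
  fixes f :: "nat \<Rightarrow> 'b::comm_monoid_add"
  shows "(\<Sum>k<4 * n. f k) = (\<Sum>j<n. f (4 * j) + f (4 * j + 1) + f (4 * j + 2) + f (4 * j + 3))"
proof (induction n)
  case (Suc n)
  have "{..<4 * Suc n} = {..<4 * n} \<union> {4 * n, 4 * n + 1, 4 * n + 2, 4 * n + 3}" by auto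
  then have "(\<Sum>k<4 * Suc n. f k) = (\<Sum>k<4 * n. f k) + (\<Sum>k\<in>{4 * n, 4 * n + 1, 4 * n + 2, 4 * n + 3}. f k)"
    by (simp only:) (intro sum.union_disjoint; auto)
  then show ?case using Suc by (simp add: add.assoc)
qed simp

lemma moments_rescale:
  fixes D :: real
  assumes "D > 0"
  shows "2/25 * (1 / D * a) - b \<le> 1 / D * c \<Longrightarrow> 2/25 * a - b * D \<le> c"
    and "1 / D * c \<le> 13 * (1 / D * a) + b \<Longrightarrow> c \<le> 13 * a + b * D"
proof -
  assume "2/25 * (1 / D * a) - b \<le> 1 / D * c"
  then have "D * (2/25 * (1 / D * a) - b) \<le> D * (1 / D * c)"
    using assms by (intro mult_left_mono) auto
  then show "2/25 * a - b * D \<le> c" using assms by (simp add: right_diff_distrib mult.commute)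
next
  assume "1 / D * c \<le> 13 * (1 / D * a) + b"
  then have "D * (1 / D * c) \<le> D * (13 * (1 / D * a) + b)"
    using assms by (intro mult_left_mono) auto
  then show "c \<le> 13 * a + b * D" using assms by (simp add: distrib_left mult.commute)
qed

text \<open>
  Up to a factor of at most \<open>sqrt 2\<close>, a combination of the \<open>\<phi>\<^sub>j\<close> with complex coefficients of \<open>\<ell>\<^sup>1\<close> norm 1
  is a convex combination of the functions \<open>\<plusminus>\<phi>\<^sub>j\<close> and \<open>\<plusminus>\<i> \<phi>\<^sub>j\<close>: the weights are the positive and negative
  parts of \<open>Re (z j)\<close> and \<open>Im (z j)\<close>. The factor enters squared, whence \<open>60 = 2 * 30\<close>.
\<close>
theorem (in prob_space) uniform_second_moment:
  fixes \<phi> :: "nat \<Rightarrow> 'a \<Rightarrow> complex"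
  assumes meas: "\<And>j. j < n \<Longrightarrow> \<phi> j \<in> borel_measurable M" and K: "K > 0"
    and bd: "\<And>j y. j < n \<Longrightarrow> y \<in> space M \<Longrightarrow> cmod (\<phi> j y) \<le> K"
    and n: "n \<ge> 1" and m: "m > 0" and \<epsilon>: "0 < \<epsilon>" "\<epsilon> \<le> 2" and \<eta>: "(1/4)^t \<le> \<eta>"
    and mb: "real m * \<eta> \<ge> 1334 * (real t + 1)\<^sup>2 * ln (4 * real n) + ln (2 / \<epsilon>) + 1"
  shows "\<exists>F\<in>sets (PiM {..<m} (\<lambda>_. M)). measure (PiM {..<m} (\<lambda>_. M)) F \<le> \<epsilon> \<and>
    (\<forall>x\<in>space (PiM {..<m} (\<lambda>_. M)) - F. \<forall>z.
      moments_agree M m x (\<lambda>y. \<Sum>j<n. z j * \<phi> j y) (60 * \<eta> * K\<^sup>2 * (\<Sum>j<n. cmod (z j))\<^sup>2))"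
proof -
  let ?P = "PiM {..<m} (\<lambda>_. M)"
  have \<eta>0: "\<eta> > 0" using \<eta> by (rule less_le_trans[rotated]) simp
  define \<psi> where "\<psi> = (\<lambda>k y. \<i> ^ (k mod 4) * \<phi> (k div 4) y / of_real K)"
  have \<psi>_meas: "\<psi> k \<in> borel_measurable M" if "k < 4 * n" for k
  proof -
    have "\<phi> (k div 4) \<in> borel_measurable M" using that by (intro meas) auto
    then show ?thesis unfolding \<psi>_def by measurable
  qed
  have \<psi>_bd: "cmod (\<psi> k y) \<le> 1" if "k < 4 * n" "y \<in> space M" for k y
  proof -
    have "cmod (\<phi> (k div 4) y) \<le> K" using that by (intro bd) auto
    then show ?thesis using K by (simp add: \<psi>_def norm_mult norm_power norm_divide)
  qed
  have mb': "real m * \<eta> \<ge> 1334 * (real t + 1)\<^sup>2 * ln (real (4 * n)) + ln (2 / \<epsilon>) + 1"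
    using mb by simp
  have n4: "4 * n \<ge> 1" using n by simp
  obtain F where F: "F \<in> sets ?P" and F2: "measure ?P F \<le> \<epsilon> \<and>
    (\<forall>x\<in>space ?P - F. \<forall>q g. set_pmf q \<subseteq> {..<4*n} \<longrightarrow>
      g = (\<lambda>y. measure_pmf.expectation q (\<lambda>j. \<psi> j y)) \<longrightarrow>
      moments_agree M m x g (30 * \<eta>))"
    using uniform_second_moment_hull[of "4 * n" \<psi> m \<epsilon> t \<eta>, OF \<psi>_meas \<psi>_bd n4 m \<epsilon> \<eta> mb'] by (rule bexE)
  note hull = F2[THEN conjunct2, rule_format]
  have "moments_agree M m x (\<lambda>y. \<Sum>j<n. z j * \<phi> j y) (60 * \<eta> * K\<^sup>2 * (\<Sum>j<n. cmod (z j))\<^sup>2)"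
    if x: "x \<in> space ?P - F" for x z
  proof -
    define R where "R = (\<Sum>j<n. \<bar>Re (z j)\<bar> + \<bar>Im (z j)\<bar>)"
    define g where "g = (\<lambda>y. \<Sum>j<n. z j * \<phi> j y)"
    have R0: "R \<ge> 0" unfolding R_def by (intro sum_nonneg) auto
    have "R \<le> (\<Sum>j<n. sqrt 2 * cmod (z j))"
      unfolding R_def by (intro sum_mono complex_abs_le_norm)
    also have "\<dots> = sqrt 2 * (\<Sum>j<n. cmod (z j))" by (simp add: sum_distrib_left)
    finally have "R\<^sup>2 \<le> (sqrt 2 * (\<Sum>j<n. cmod (z j)))\<^sup>2" using R0 by (intro power_mono) auto
    then have R2: "R\<^sup>2 \<le> 2 * (\<Sum>j<n. cmod (z j))\<^sup>2" by (simp add: power_mult_distrib)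
    show ?thesis
    proof (cases "R = 0")
      case True
      then have "\<bar>Re (z j)\<bar> + \<bar>Im (z j)\<bar> = 0" if "j < n" for j
        using that unfolding R_def by (subst (asm) sum_nonneg_eq_0_iff) auto
      then have "z j = 0" if "j < n" for j
        using that by (simp add: complex_eq_iff add_nonneg_eq_0_iff)
      then show ?thesis by (simp add: moments_agree_def emean_def)
    next
      case False
      then have Rp: "R > 0" using R0 by simp
      define w where "w = (\<lambda>k. if k < 4 * n then
        (let a = z (k div 4) in max 0 (if k mod 4 = 0 then Re a else if k mod 4 = 1 then Im a
          else if k mod 4 = 2 then - Re a else - Im a)) / R else 0)"
      have w0: "w k \<ge> 0" for k unfolding w_def Let_def using Rp by auto
      have md: "(4 * j) div 4 = j" "(4 * j) mod 4 = 0" "(4 * j + 1) div 4 = j" "(4 * j + 1) mod 4 = 1"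
        "(4 * j + 2) div 4 = j" "(4 * j + 2) mod 4 = 2" "(4 * j + 3) div 4 = j" "(4 * j + 3) mod 4 = 3" for j :: nat
        by presburger+
      have w4: "w (4 * j) = max 0 (Re (z j)) / R" "w (4 * j + 1) = max 0 (Im (z j)) / R"
        "w (4 * j + 2) = max 0 (- Re (z j)) / R" "w (4 * j + 3) = max 0 (- Im (z j)) / R" if "j < n" for j
        using that unfolding w_def by (simp_all only: md Let_def) auto
      have wsum: "(\<Sum>k<4*n. w k) = 1"
      proof -
        have "(\<Sum>k<4*n. w k) = (\<Sum>j<n. (\<bar>Re (z j)\<bar> + \<bar>Im (z j)\<bar>) / R)"
          unfolding sum_lessThan_mult4
          by (intro sum.cong refl) (simp only: w4 lessThan_iff, auto simp: max_def add_divide_distrib)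
        also have "\<dots> = 1" using Rp by (simp add: sum_divide_distrib[symmetric] R_def)
        finally show ?thesis .
      qed
      have wint: "(\<integral>\<^sup>+k. ennreal (w k) \<partial>count_space UNIV) = 1"
      proof -
        have "(\<integral>\<^sup>+k. ennreal (w k) \<partial>count_space UNIV) = (\<Sum>k<4*n. ennreal (w k))"
          by (rule nn_integral_count_space') (auto simp: w_def)
        also have "\<dots> = 1" using w0 wsum by (subst sum_ennreal) auto
        finally show ?thesis .
      qed
      define q where "q = embed_pmf w"
      have pq: "pmf q k = w k" for k
        unfolding q_def using w0 wint by (rule pmf_embed_pmf)
      have qN: "set_pmf q \<subseteq> {..<4 * n}"
        by (auto simp: set_pmf_iff pq w_def split: if_splits)
      define g' where "g' = (\<lambda>y. measure_pmf.expectation q (\<lambda>j. \<psi> j y))"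
      have \<psi>4: "\<psi> (4 * j) y = \<phi> j y / of_real K" "\<psi> (4 * j + 1) y = \<i> * \<phi> j y / of_real K"
        "\<psi> (4 * j + 2) y = - \<phi> j y / of_real K" "\<psi> (4 * j + 3) y = - \<i> * \<phi> j y / of_real K" for j y
        unfolding \<psi>_def md by (simp_all add: power3_eq_cube)
      have g': "g' y = g y / of_real (K * R)" for y
      proof -
        have "g' y = (\<Sum>k<4*n. of_real (w k) * \<psi> k y)"
          unfolding g'_def using qN by (subst integral_measure_pmf[of "{..<4*n}"]) (auto simp: pq scaleR_conv_of_real)
        also have "\<dots> = (\<Sum>j<n. (z j * \<phi> j y) / of_real (K * R))"
          unfolding sum_lessThan_mult4
        proof (intro sum.cong refl)
          fix j assume "j \<in> {..<n}"
          then have j: "j < n" by simp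
          have z: "z j = of_real (Re (z j)) + \<i> * of_real (Im (z j))"
            by (simp add: complex_eq_iff)
          have Re: "of_real (Re (z j)) = (of_real (max 0 (Re (z j))) - of_real (max 0 (- Re (z j))) :: complex)"
            and Im: "of_real (Im (z j)) = (of_real (max 0 (Im (z j))) - of_real (max 0 (- Im (z j))) :: complex)"
            by (auto simp: max_def)
          show "of_real (w (4 * j)) * \<psi> (4 * j) y + of_real (w (4 * j + 1)) * \<psi> (4 * j + 1) y +
             of_real (w (4 * j + 2)) * \<psi> (4 * j + 2) y + of_real (w (4 * j + 3)) * \<psi> (4 * j + 3) y
             = z j * \<phi> j y / of_real (K * R)"
            unfolding w4[OF j] \<psi>4 using K Rp
            by (subst z, subst Re, subst Im) (simp add: field_simps)
        qed
        also have "\<dots> = g y / of_real (K * R)"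
          unfolding g_def by (simp add: sum_divide_distrib)
        finally show ?thesis .
      qed
      have sq: "(cmod (g' y))\<^sup>2 = (1 / (K * R)\<^sup>2) * (cmod (g y))\<^sup>2" for y
        unfolding g' using K Rp by (simp add: norm_divide norm_mult power_divide)
      have h1: "2/25 * ((1 / (K * R)\<^sup>2) * expectation (\<lambda>y. (cmod (g y))\<^sup>2)) - 30 * \<eta>
          \<le> (1 / (K * R)\<^sup>2) * emean m x (\<lambda>y. (cmod (g y))\<^sup>2)"
        and h2: "(1 / (K * R)\<^sup>2) * emean m x (\<lambda>y. (cmod (g y))\<^sup>2)
          \<le> 13 * ((1 / (K * R)\<^sup>2) * expectation (\<lambda>y. (cmod (g y))\<^sup>2)) + 30 * \<eta>"
        using hull[OF x qN g'_def] unfolding moments_agree_def sq emean_cmult by simp_all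
      have KR: "(K * R)\<^sup>2 > 0" using K Rp by simp
      have "30 * \<eta> * (K * R)\<^sup>2 \<le> 30 * \<eta> * (K\<^sup>2 * (2 * (\<Sum>j<n. cmod (z j))\<^sup>2))"
        unfolding power_mult_distrib using R2 \<eta>0 by (intro mult_left_mono) auto
      moreover have "2/25 * expectation (\<lambda>y. (cmod (g y))\<^sup>2) - 30 * \<eta> * (K * R)\<^sup>2 \<le> emean m x (\<lambda>y. (cmod (g y))\<^sup>2)"
        using moments_rescale(1)[OF KR h1] .
      moreover have "emean m x (\<lambda>y. (cmod (g y))\<^sup>2) \<le> 13 * expectation (\<lambda>y. (cmod (g y))\<^sup>2) + 30 * \<eta> * (K * R)\<^sup>2"
        using moments_rescale(2)[OF KR h2] .
      ultimately show ?thesis unfolding moments_agree_def g_def[symmetric] by (simp add: algebra_simps)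
    qed
  qed
  with F F2[THEN conjunct1] show ?thesis by (intro bexI[of _ F]) simp_all
qed

section \<open>The square-root LASSO and hard thresholding\<close>

abbreviation l2n :: "nat \<Rightarrow> (nat \<Rightarrow> complex) \<Rightarrow> real"
  where "l2n n z \<equiv> L2_set (\<lambda>j. cmod (z j)) {..<n}"

abbreviation l1n :: "nat \<Rightarrow> (nat \<Rightarrow> complex) \<Rightarrow> real"
  where "l1n n z \<equiv> (\<Sum>j<n. cmod (z j))"

definition mv :: "nat \<Rightarrow> (nat \<Rightarrow> nat \<Rightarrow> complex) \<Rightarrow> (nat \<Rightarrow> complex) \<Rightarrow> nat \<Rightarrow> complex"
  where "mv n A z i = (\<Sum>j<n. A i j * z j)"

lemma mv_diff: "mv n A (\<lambda>j. z j - w j) i = mv n A z i - mv n A w i"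
  by (simp add: mv_def right_diff_distrib sum_subtractf)

lemma srlasso_objective_eq:
  "srlasso_objective lam m n A d z = lam * l1n n z + l2n m (\<lambda>i. mv n A z i - d i)"
  by (simp add: srlasso_objective_def L2_set_def mv_def)

lemma l2n_triangle: "l2n n (\<lambda>j. z j + w j) \<le> l2n n z + l2n n w"
proof -
  have "l2n n (\<lambda>j. z j + w j) \<le> L2_set (\<lambda>j. cmod (z j) + cmod (w j)) {..<n}"
    by (intro L2_set_mono norm_triangle_ineq) auto
  also have "\<dots> \<le> l2n n z + l2n n w" by (rule L2_set_triangle_ineq)
  finally show ?thesis .
qed

lemma l2n_scale: "l2n n (\<lambda>j. c * z j) = cmod c * l2n n z"
  by (simp add: norm_mult L2_set_right_distrib)

lemma l2n_triangle_minus: "l2n n (\<lambda>j. z j - w j) \<le> l2n n z + l2n n w"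
  using l2n_triangle[where z = z and w = "\<lambda>j. - w j"] by simp

lemma in_box_iff: "(\<forall>j. z j \<in> (if j < n then cball 0 R else {0})) \<longleftrightarrow> (\<forall>j<n. cmod (z j) \<le> R) \<and> (\<forall>j. \<not> j < n \<longrightarrow> z j = (0::complex))"
  by (metis dist_0_norm mem_cball singletonD singletonI)

text \<open>
  Compactness in the product topology makes finite-dimensional vectors, represented as sequences,
  amenable to the existence argument for minimisers.
\<close>
lemma compact_coordinate_box:
  "compact {z \<in> Cvec n. \<forall>j<n. cmod (z j) \<le> R}"
proof -
  have "{z \<in> Cvec n. \<forall>j<n. cmod (z j) \<le> R} = (\<Pi>\<^sub>E j\<in>UNIV. if j < n then cball 0 R else {0})"
    unfolding PiE_UNIV_domain by (intro set_eqI) (simp add: Cvec_def Pi_def in_box_iff, meson not_less)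
  moreover have "compactin (product_topology (\<lambda>_::nat. euclidean) UNIV)
      (\<Pi>\<^sub>E j\<in>UNIV. if j < n then cball (0::complex) R else {0})"
    unfolding compactin_PiE by auto
  ultimately show ?thesis by (simp add: euclidean_product_topology)
qed

lemma continuous_srlasso_objective: "continuous_on UNIV (srlasso_objective lam m n A d)"
  unfolding srlasso_objective_def
  by (intro continuous_intros continuous_on_product_coordinates)

lemma continuous_l2n: "continuous_on UNIV (l2n n)"
  unfolding L2_set_def by (intro continuous_intros continuous_on_product_coordinates)

lemma srlasso_objective_midpoint:
  assumes "lam \<ge> 0"
  shows "srlasso_objective lam m n A d (\<lambda>j. (z j + w j) / 2)
    \<le> (srlasso_objective lam m n A d z + srlasso_objective lam m n A d w) / 2"
proof -
  have "l1n n (\<lambda>j. (z j + w j) / 2) \<le> (\<Sum>j<n. (cmod (z j) + cmod (w j)) / 2)"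
    by (intro sum_mono) (auto simp: norm_divide intro!: divide_right_mono norm_triangle_ineq)
  also have "\<dots> = (l1n n z + l1n n w) / 2"
    by (simp add: sum_divide_distrib[symmetric] sum.distrib)
  finally have 1: "lam * l1n n (\<lambda>j. (z j + w j) / 2) \<le> lam * ((l1n n z + l1n n w) / 2)"
    using assms by (rule mult_left_mono)
  have "mv n A (\<lambda>j. (z j + w j) / 2) i = (mv n A z i + mv n A w i) / 2" for i
    by (simp add: mv_def sum_divide_distrib[symmetric] sum.distrib distrib_left)
  then have "mv n A (\<lambda>j. (z j + w j) / 2) i - d i = (1/2) * ((mv n A z i - d i) + (mv n A w i - d i))" for i
    by (simp add: field_simps)
  then have "l2n m (\<lambda>i. mv n A (\<lambda>j. (z j + w j) / 2) i - d i)
      = l2n m (\<lambda>i. (1/2) * ((mv n A z i - d i) + (mv n A w i - d i)))"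
    by (simp only:)
  also have "\<dots> \<le> 1/2 * (l2n m (\<lambda>i. mv n A z i - d i) + l2n m (\<lambda>i. mv n A w i - d i))"
    unfolding l2n_scale using l2n_triangle[where n = m and z = "\<lambda>i. mv n A z i - d i" and w = "\<lambda>i. mv n A w i - d i"]
    by (simp add: norm_divide)
  finally show ?thesis using 1 unfolding srlasso_objective_eq by argo
qed

text \<open>
  The parallelogram identity; it gives the strict convexity that singles out one minimiser.
\<close>
lemma midpoint_l2n:
  "(l2n n (\<lambda>j. (z j + w j) / 2))\<^sup>2 = ((l2n n z)\<^sup>2 + (l2n n w)\<^sup>2) / 2 - (l2n n (\<lambda>j. z j - w j))\<^sup>2 / 4"
proof -
  have "(cmod ((x + y) / 2))\<^sup>2 = ((cmod x)\<^sup>2 + (cmod y)\<^sup>2) / 2 - (cmod (x - y))\<^sup>2 / 4" for x y :: complex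
    unfolding cmod_power2 by (simp add: power2_eq_square field_simps)
  then have "(\<Sum>j<n. (cmod ((z j + w j) / 2))\<^sup>2) = ((\<Sum>j<n. (cmod (z j))\<^sup>2) + (\<Sum>j<n. (cmod (w j))\<^sup>2)) / 2 - (\<Sum>j<n. (cmod (z j - w j))\<^sup>2) / 4"
    by (simp add: sum_subtractf sum_divide_distrib[symmetric] sum.distrib)
  moreover have "(l2n n f)\<^sup>2 = (\<Sum>j<n. (cmod (f j))\<^sup>2)" for f
    by (simp add: L2_set_def sum_nonneg)
  ultimately show ?thesis by (simp only:)
qed

text \<open>
  A description by \<open>THE\<close> says something only if there is exactly one such vector. Existence: a sublevel
  set of the objective is compact, and so is its set of minimisers. Uniqueness: the midpoint of
  two minimisers is again a minimiser and, unless they coincide, has a smaller \<open>\<ell>\<^sup>2\<close> norm.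
\<close>
theorem srlasso_minimizer_is_minimizer:
  assumes lam: "lam > 0"
  shows "srlasso_minimizer lam m n A d \<in> Cvec n"
    and "w \<in> Cvec n \<Longrightarrow> srlasso_objective lam m n A d (srlasso_minimizer lam m n A d) \<le> srlasso_objective lam m n A d w"
proof -
  let ?G = "srlasso_objective lam m n A d"
  define R where "R = ?G (\<lambda>_. 0) / lam"
  define C where "C = {z \<in> Cvec n. \<forall>j<n. cmod (z j) \<le> R}"
  have zero: "(\<lambda>_. 0) \<in> Cvec n" by (simp add: Cvec_def)
  have G0: "?G (\<lambda>_. 0) \<ge> 0" unfolding srlasso_objective_eq by simp
  have zC: "(\<lambda>_. 0) \<in> C" using G0 lam by (simp add: C_def zero R_def)
  have inC: "z \<in> C" if "z \<in> Cvec n" "?G z \<le> ?G (\<lambda>_. 0)" for z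
  proof -
    have "cmod (z j) \<le> R" if "j < n" for j
    proof -
      have "cmod (z j) \<le> l1n n z" using that by (intro member_le_sum) auto
      also have "lam * l1n n z \<le> ?G (\<lambda>_. 0)"
        using \<open>?G z \<le> ?G (\<lambda>_. 0)\<close> unfolding srlasso_objective_eq[of _ _ _ _ _ z] by (smt (verit) L2_set_nonneg)
      then have "l1n n z \<le> R" unfolding R_def using lam by (simp add: field_simps)
      finally show ?thesis .
    qed
    with that show ?thesis by (simp add: C_def)
  qed
  have cC: "compact C" unfolding C_def by (rule compact_coordinate_box)
  obtain z0 where z0: "z0 \<in> C" "\<And>y. y \<in> C \<Longrightarrow> ?G z0 \<le> ?G y"
    using continuous_attains_inf[OF cC _ continuous_on_subset[OF continuous_srlasso_objective]] zC by blast
  have z0_min: "?G z0 \<le> ?G y" if "y \<in> Cvec n" for y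
  proof (cases "?G y \<le> ?G (\<lambda>_. 0)")
    case True
    then show ?thesis using inC[OF that] z0 by blast
  next
    case False
    then show ?thesis using z0(2)[OF zC] by simp
  qed
  define Z where "Z = C \<inter> {z. ?G z \<le> ?G z0}"
  have cZ: "compact Z" unfolding Z_def
    by (intro compact_Int_closed cC closed_Collect_le continuous_srlasso_objective continuous_on_const)
  have z0Z: "z0 \<in> Z" using z0 by (simp add: Z_def)
  obtain z1 where z1: "z1 \<in> Z" "\<And>y. y \<in> Z \<Longrightarrow> l2n n z1 \<le> l2n n y"
    using continuous_attains_inf[OF cZ _ continuous_on_subset[OF continuous_l2n]] z0Z by blast
  let ?P = "is_arg_min ?G (\<lambda>w. w \<in> Cvec n)"
  have PZ: "?P z \<longleftrightarrow> z \<in> Z" for z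
  proof
    assume "?P z"
    then have *: "z \<in> Cvec n" "\<And>y. y \<in> Cvec n \<Longrightarrow> ?G z \<le> ?G y"
      by (auto simp: is_arg_min_def not_less)
    then show "z \<in> Z" unfolding Z_def using inC[of z] zero z0(1) by (auto simp: C_def)
  next
    assume z: "z \<in> Z"
    then have "?G z \<le> ?G y" if "y \<in> Cvec n" for y
      using z0_min[OF that] by (auto simp: Z_def)
    then show "?P z" using z by (auto simp: is_arg_min_def Z_def C_def not_less)
  qed
  let ?Q = "is_arg_min (\<lambda>w. sqrt (\<Sum>j<n. (cmod (w j))\<^sup>2)) ?P"
  have Qiff: "?Q z \<longleftrightarrow> z \<in> Z \<and> (\<forall>y\<in>Z. l2n n z \<le> l2n n y)" for z
    unfolding is_arg_min_def[of "\<lambda>w. sqrt (\<Sum>j<n. (cmod (w j))\<^sup>2)"] PZ L2_set_def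
    by (auto simp: not_less)
  have "?Q z1" unfolding Qiff using z1 by blast
  moreover have "z = z1" if "?Q z" for z
  proof -
    have z: "z \<in> Z" "l2n n z \<le> l2n n z1" using that z1 unfolding Qiff by auto
    have eq: "l2n n z = l2n n z1" using z z1(2) by (meson order_antisym)
    let ?w = "\<lambda>j. (z j + z1 j) / 2"
    have "?w \<in> Z"
    proof -
      have "?w \<in> Cvec n" using z z1 by (auto simp: Z_def C_def Cvec_def)
      moreover have Gw: "?G ?w \<le> ?G z0"
        using srlasso_objective_midpoint[of lam m n A d z z1] lam z(1) z1(1) by (auto simp: Z_def)
      moreover have "?G z0 \<le> ?G (\<lambda>_. 0)" by (rule z0(2)[OF zC])
      ultimately show ?thesis unfolding Z_def using inC[of ?w] by auto
    qed
    then have "(l2n n z1)\<^sup>2 \<le> (l2n n ?w)\<^sup>2" by (intro power_mono z1) auto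
    then have "(l2n n (\<lambda>j. z j - z1 j))\<^sup>2 \<le> 0"
      unfolding midpoint_l2n eq by simp
    then have "l2n n (\<lambda>j. z j - z1 j) = 0" by simp
    then have "z j = z1 j" if "j < n" for j using that by (subst (asm) L2_set_eq_0_iff) auto
    moreover have "z j = z1 j" if "\<not> j < n" for j
      using that z(1) z1(1) by (auto simp: Z_def C_def Cvec_def)
    ultimately show ?thesis by blast
  qed
  ultimately have eq: "srlasso_minimizer lam m n A d = z1"
    unfolding srlasso_minimizer_def by (rule the_equality)
  show "srlasso_minimizer lam m n A d \<in> Cvec n"
    and "w \<in> Cvec n \<Longrightarrow> ?G (srlasso_minimizer lam m n A d) \<le> ?G w"
    unfolding eq using z1(1) z0_min by (auto simp: Z_def C_def intro: order_trans)
qed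

lemma sum_le_sqrt_card_L2_set:
  assumes "finite S" "card S \<le> k"
  shows "(\<Sum>j\<in>S. \<bar>f j\<bar>) \<le> sqrt (real k) * L2_set f S"
proof -
  have "(\<Sum>j\<in>S. \<bar>f j\<bar>) = (\<Sum>j\<in>S. \<bar>f j\<bar> * \<bar>1\<bar>)" by simp
  also have "\<dots> \<le> L2_set f S * L2_set (\<lambda>_. 1) S" by (rule L2_set_mult_ineq)
  also have "\<dots> \<le> L2_set f S * sqrt (real k)"
    unfolding L2_set_constant using assms by (intro mult_left_mono) auto
  finally show ?thesis by (simp add: mult.commute)
qed

lemma L2_set_mono_set: "finite B \<Longrightarrow> A \<subseteq> B \<Longrightarrow> L2_set f A \<le> L2_set f B"
  unfolding L2_set_def by (intro real_sqrt_le_mono sum_mono2) auto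

text \<open>
  The set \<open>T\<close> contains at least \<open>s\<close> indices outside \<open>S\<close>, all of whose entries are at least as large as any entry
  discarded by \<open>T\<close>. So a discarded entry is at most \<open>1/s\<close> times the \<open>\<ell>\<^sup>1\<close> norm of \<open>z\<close> off \<open>S\<close>.
\<close>
lemma hard_thresholding_error:
  assumes T: "T \<subseteq> {..<n}" "card T = min (2 * s) n"
    and dom: "\<And>i j. i \<in> T \<Longrightarrow> j \<in> {..<n} - T \<Longrightarrow> cmod (z j) \<le> cmod (z i)"
    and S: "S \<subseteq> {..<n}" "card S \<le> s" and s: "s \<ge> 1"
  shows "(\<Sum>j\<in>{..<n} - T. cmod (z j)) \<le> 2 * (\<Sum>j\<in>{..<n} - S. cmod (z j))"
    and "sqrt (real s) * L2_set (\<lambda>j. cmod (z j)) ({..<n} - T) \<le> 2 * (\<Sum>j\<in>{..<n} - S. cmod (z j))"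
proof -
  define \<zeta> where "\<zeta> = (\<Sum>j\<in>{..<n} - S. cmod (z j))"
  have \<zeta>0: "\<zeta> \<ge> 0" unfolding \<zeta>_def by (intro sum_nonneg) auto
  have finS: "finite S" "finite T" using S T finite_subset by blast+
  have main: "(\<Sum>j\<in>{..<n} - T. cmod (z j)) \<le> 2 * \<zeta> \<and>
     sqrt (real s) * L2_set (\<lambda>j. cmod (z j)) ({..<n} - T) \<le> 2 * \<zeta>"
  proof (cases "{..<n} - T = {}")
    case True
    then show ?thesis using \<zeta>0 by (simp only:) simp
  next
    case False
    then have "T \<noteq> {..<n}" by blast
    then have "card T < n" using T(1) psubset_card_mono[of "{..<n}" T] by auto
    then have cT: "card T = 2 * s" using T(2) by simp
    define \<mu> where "\<mu> = Max ((\<lambda>j. cmod (z j)) ` ({..<n} - T))"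
    have \<mu>_ge: "cmod (z j) \<le> \<mu>" if "j \<in> {..<n} - T" for j
      unfolding \<mu>_def using that by (intro Max_ge) auto
    have "\<mu> \<in> (\<lambda>j. cmod (z j)) ` ({..<n} - T)" unfolding \<mu>_def using False by (intro Max_in) auto
    then have \<mu>_le: "\<mu> \<le> cmod (z i)" if "i \<in> T" for i using dom that by auto
    have \<mu>0: "\<mu> \<ge> 0" using \<open>\<mu> \<in> _\<close> by auto
    have "s \<le> card (T - S)"
      using diff_card_le_card_Diff[OF finS(1), of T] cT S(2) by linarith
    then have "real s * \<mu> \<le> real (card (T - S)) * \<mu>" using \<mu>0 by (intro mult_right_mono) auto
    also have "\<dots> = (\<Sum>i\<in>T - S. \<mu>)" by simp
    also have "\<dots> \<le> (\<Sum>i\<in>T - S. cmod (z i))" using \<mu>_le by (intro sum_mono) auto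
    also have "\<dots> \<le> \<zeta>" unfolding \<zeta>_def using T by (intro sum_mono2) auto
    finally have s\<mu>: "real s * \<mu> \<le> \<zeta>" .
    have "(\<Sum>j\<in>{..<n} - T. cmod (z j)) = (\<Sum>j\<in>({..<n} - T) - S. cmod (z j)) + (\<Sum>j\<in>({..<n} - T) \<inter> S. cmod (z j))"
      by (subst add.commute, rule sum.Int_Diff) auto
    also have "\<dots> \<le> \<zeta> + (\<Sum>j\<in>({..<n} - T) \<inter> S. \<mu>)"
      unfolding \<zeta>_def using \<mu>_ge by (intro add_mono sum_mono2 sum_mono) auto
    also have "(\<Sum>j\<in>({..<n} - T) \<inter> S. \<mu>) \<le> real s * \<mu>"
    proof -
      have "card (({..<n} - T) \<inter> S) \<le> s" using S(2) card_mono[OF finS(1), of "({..<n} - T) \<inter> S"] by auto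
      then show ?thesis using \<mu>0 by (simp add: mult_right_mono)
    qed
    finally have 1: "(\<Sum>j\<in>{..<n} - T. cmod (z j)) \<le> 2 * \<zeta>" using s\<mu> by simp
    have "(sqrt (real s) * L2_set (\<lambda>j. cmod (z j)) ({..<n} - T))\<^sup>2 = real s * (\<Sum>j\<in>{..<n} - T. (cmod (z j))\<^sup>2)"
      by (simp add: power_mult_distrib L2_set_def sum_nonneg)
    also have "\<dots> \<le> real s * (\<Sum>j\<in>{..<n} - T. \<mu> * cmod (z j))"
      using \<mu>_ge by (intro mult_left_mono sum_mono) (auto simp: power2_eq_square intro!: mult_right_mono)
    also have "\<dots> = (real s * \<mu>) * (\<Sum>j\<in>{..<n} - T. cmod (z j))"
      by (simp add: sum_distrib_left mult.assoc)
    also have "\<dots> \<le> \<zeta> * (2 * \<zeta>)"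
      using s\<mu> 1 \<zeta>0 \<mu>0 by (intro mult_mono sum_nonneg) auto
    also have "\<dots> \<le> (2 * \<zeta>)\<^sup>2" using \<zeta>0 by (simp add: power2_eq_square)
    finally have "sqrt (real s) * L2_set (\<lambda>j. cmod (z j)) ({..<n} - T) \<le> 2 * \<zeta>"
      by (rule power2_le_imp_le) (use \<zeta>0 in simp)
    with 1 show ?thesis by simp
  qed
  show "(\<Sum>j\<in>{..<n} - T. cmod (z j)) \<le> 2 * (\<Sum>j\<in>{..<n} - S. cmod (z j))"
    and "sqrt (real s) * L2_set (\<lambda>j. cmod (z j)) ({..<n} - T) \<le> 2 * (\<Sum>j\<in>{..<n} - S. cmod (z j))"
    using main unfolding \<zeta>_def by auto
qed

text \<open>
  Write \<open>h\<close> for the error of the minimiser, \<open>E\<close> and \<open>Q\<close> for the residuals of the truth and of the minimiser, and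
  \<open>\<alpha> = sqrt s / sqrt a\<close>. Optimality bounds \<open>h\<close> off \<open>S\<close> by \<open>h\<close> on \<open>S\<close> up to $\frac{14}{3} \alpha (E - Q)$,
  and the null space property bounds \<open>h\<close> on \<open>S\<close> by $4 \alpha (E + Q)$ plus a ninth of \<open>h\<close> off \<open>S\<close>. As
  \<open>4 < 14/3\<close>, the residual \<open>Q\<close> enters the sum with a negative sign and can be controlled too.
\<close>
theorem srlasso_recovery:
  assumes a: "a > 0" and s: "s \<ge> 1" and c: "c \<in> Cvec n" and S: "S \<subseteq> {..<n}" "card S \<le> s"
    and nsp: "\<And>z. l2n n z \<le> 18/5 / sqrt a * l2n m (mv n A z) + 1/10 * (l1n n z / sqrt (real s))"
    and chat: "chat \<in> hard_thresholdings (2 * s) n (srlasso_minimizer (3 / 14 * sqrt (a / real s)) m n A d)"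
  defines "bound \<equiv> (\<Sum>j\<in>{..<n} - S. cmod (c j)) + sqrt (real s) / sqrt a * l2n m (\<lambda>i. mv n A c i - d i)"
  shows "l1n n (\<lambda>j. c j - chat j) \<le> 210 * bound"
    and "sqrt (real s) * l2n n (\<lambda>j. c j - chat j) \<le> 210 * bound"
proof -
  define \<alpha> where "\<alpha> = sqrt (real s) / sqrt a"
  have \<alpha>: "\<alpha> > 0" using a s by (simp add: \<alpha>_def)
  have s0: "sqrt (real s) > 0" using s by simp
  define lam where "lam = 3 / 14 * sqrt (a / real s)"
  have lam_eq: "lam = 3 / 14 / \<alpha>" by (simp add: lam_def \<alpha>_def real_sqrt_divide)
  have lam0: "lam > 0" using \<alpha> by (simp add: lam_eq)
  define zc where "zc = srlasso_minimizer lam m n A d"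
  have zc: "zc \<in> Cvec n" "srlasso_objective lam m n A d zc \<le> srlasso_objective lam m n A d c"
    unfolding zc_def using srlasso_minimizer_is_minimizer[OF lam0] c by blast+
  define h where "h = (\<lambda>j. zc j - c j)"
  define E where "E = l2n m (\<lambda>i. mv n A c i - d i)"
  define Q where "Q = l2n m (\<lambda>i. mv n A zc i - d i)"
  define \<sigma> where "\<sigma> = (\<Sum>j\<in>{..<n} - S. cmod (c j))"
  define hS where "hS = (\<Sum>j\<in>S. cmod (h j))"
  define hC where "hC = (\<Sum>j\<in>{..<n} - S. cmod (h j))"
  have finS: "finite S" using S finite_subset by blast
  have split: "l1n n f = (\<Sum>j\<in>S. cmod (f j)) + (\<Sum>j\<in>{..<n} - S. cmod (f j))" for f
    using sum.subset_diff[OF S(1), of "\<lambda>j. cmod (f j)"] by simp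
  have nn: "E \<ge> 0" "Q \<ge> 0" "\<sigma> \<ge> 0" "hS \<ge> 0" "hC \<ge> 0"
    by (auto simp: E_def Q_def \<sigma>_def hS_def hC_def intro!: sum_nonneg)
  have h1: "l1n n h = hS + hC" unfolding split hS_def hC_def ..
  have "l2n m (mv n A h) = l2n m (\<lambda>i. (mv n A zc i - d i) - (mv n A c i - d i))"
    unfolding h_def mv_diff by simp
  also have "\<dots> \<le> Q + E" unfolding Q_def E_def by (rule l2n_triangle_minus)
  finally have Ah: "l2n m (mv n A h) \<le> Q + E" .
  have "sqrt (real s) * l2n n h \<le> sqrt (real s) * (18/5 / sqrt a * l2n m (mv n A h) + 1/10 * (l1n n h / sqrt (real s)))"
    by (intro mult_left_mono nsp) auto
  also have "\<dots> = 18/5 * \<alpha> * l2n m (mv n A h) + 1/10 * l1n n h"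
    using s0 by (simp add: \<alpha>_def algebra_simps)
  also have "\<dots> \<le> 18/5 * \<alpha> * (Q + E) + 1/10 * (hS + hC)"
    unfolding h1 using Ah \<alpha> by (intro add_mono mult_left_mono) auto
  finally have n2: "sqrt (real s) * l2n n h \<le> 18/5 * (\<alpha> * Q) + 18/5 * (\<alpha> * E) + 1/10 * hS + 1/10 * hC"
    by (simp add: algebra_simps add_divide_distrib)
  have "hS \<le> sqrt (real s) * L2_set (\<lambda>j. cmod (h j)) S"
    unfolding hS_def using sum_le_sqrt_card_L2_set[OF finS S(2), of "\<lambda>j. cmod (h j)"] by simp
  also have "\<dots> \<le> sqrt (real s) * l2n n h"
    by (intro mult_left_mono L2_set_mono_set S) auto
  finally have hS2: "hS \<le> sqrt (real s) * l2n n h" .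
  have "lam * (l1n n zc - l1n n c) \<le> E - Q"
    using zc(2) unfolding srlasso_objective_eq E_def Q_def by (simp add: algebra_simps)
  then have "l1n n zc - l1n n c \<le> 14/3 * (\<alpha> * E) - 14/3 * (\<alpha> * Q)"
    using \<alpha> unfolding lam_eq by (simp add: field_simps)
  moreover have "l1n n zc \<ge> (\<Sum>j\<in>S. cmod (c j) - cmod (h j)) + (\<Sum>j\<in>{..<n} - S. cmod (h j) - cmod (c j))"
    unfolding split
  proof (intro add_mono sum_mono)
    fix j
    have "cmod (c j) = cmod (zc j - h j)" "cmod (h j) = cmod (zc j - c j)" by (simp_all add: h_def)
    then show "cmod (c j) - cmod (h j) \<le> cmod (zc j)" "cmod (h j) - cmod (c j) \<le> cmod (zc j)"
      using norm_triangle_ineq4[of "zc j" "h j"] norm_triangle_ineq4[of "zc j" "c j"] by linarith+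
  qed
  moreover have "l1n n c = (\<Sum>j\<in>S. cmod (c j)) + \<sigma>" unfolding split \<sigma>_def ..
  ultimately have opt: "hC \<le> hS + 2 * \<sigma> + 14/3 * (\<alpha> * E) - 14/3 * (\<alpha> * Q)"
    unfolding sum_subtractf hS_def[symmetric] hC_def[symmetric] \<sigma>_def[symmetric] by linarith
  have \<alpha>EQ: "\<alpha> * E \<ge> 0" "\<alpha> * Q \<ge> 0" using \<alpha> nn by auto
  \<comment> \<open>Solving the three linear inequalities; the slack \<open>14/3 - 4\<close> bounds \<open>\<alpha> * Q\<close> as well.\<close>
  have H1: "hS + hC \<le> 15 * \<sigma> + 67 * (\<alpha> * E)" and H2: "sqrt (real s) * l2n n h \<le> 13 * \<sigma> + 58 * (\<alpha> * E)"
    using n2 hS2 opt \<alpha>EQ nn by linarith+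
  obtain T where T: "T \<subseteq> {..<n}" "card T = min (2 * s) n"
    and dom: "\<forall>i\<in>T. \<forall>j\<in>{..<n} - T. cmod (zc j) \<le> cmod (zc i)"
    and chat_eq: "chat = (\<lambda>i. if i \<in> T then zc i else 0)"
    using chat unfolding hard_thresholdings_def zc_def lam_def by blast
  define \<zeta> where "\<zeta> = (\<Sum>j\<in>{..<n} - S. cmod (zc j))"
  have "\<zeta> \<le> (\<Sum>j\<in>{..<n} - S. cmod (c j) + cmod (h j))"
    unfolding \<zeta>_def h_def by (intro sum_mono) (metis add_diff_cancel_left' add.commute diff_add_cancel norm_triangle_ineq)
  also have "\<dots> \<le> \<sigma> + (hS + hC)" using nn by (simp add: sum.distrib \<sigma>_def hC_def)
  finally have \<zeta>: "\<zeta> \<le> 16 * \<sigma> + 67 * (\<alpha> * E)" using H1 by linarith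
  have t1: "(\<Sum>j\<in>{..<n} - T. cmod (zc j)) \<le> 2 * \<zeta>"
    and t2: "sqrt (real s) * L2_set (\<lambda>j. cmod (zc j)) ({..<n} - T) \<le> 2 * \<zeta>"
    unfolding \<zeta>_def using hard_thresholding_error[OF T _ S s, of zc] dom by blast+
  have d1: "l1n n (\<lambda>j. zc j - chat j) = (\<Sum>j\<in>{..<n} - T. cmod (zc j))"
    unfolding chat_eq by (rule sum.mono_neutral_cong_right) auto
  have d2: "l2n n (\<lambda>j. zc j - chat j) = L2_set (\<lambda>j. cmod (zc j)) ({..<n} - T)"
    unfolding chat_eq L2_set_def by (intro arg_cong[of _ _ sqrt] sum.mono_neutral_cong_right) auto
  have dec: "c j - chat j = (zc j - chat j) - h j" for j by (simp add: h_def)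
  have "l1n n (\<lambda>j. c j - chat j) \<le> (\<Sum>j<n. cmod (zc j - chat j) + cmod (h j))"
    unfolding dec by (intro sum_mono norm_triangle_ineq4)
  also have "\<dots> = (\<Sum>j\<in>{..<n} - T. cmod (zc j)) + (hS + hC)"
    unfolding sum.distrib d1 h1 ..
  finally show "l1n n (\<lambda>j. c j - chat j) \<le> 210 * bound"
    using t1 \<zeta> H1 \<alpha>EQ nn unfolding distrib_left bound_def \<sigma>_def[symmetric] E_def[symmetric] \<alpha>_def[symmetric] by linarith
  have "l2n n (\<lambda>j. c j - chat j) \<le> l2n n (\<lambda>j. zc j - chat j) + l2n n h"
    unfolding dec by (rule l2n_triangle_minus)
  then have "sqrt (real s) * l2n n (\<lambda>j. c j - chat j) \<le> sqrt (real s) * (l2n n (\<lambda>j. zc j - chat j) + l2n n h)"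
    by (rule mult_left_mono) auto
  then show "sqrt (real s) * l2n n (\<lambda>j. c j - chat j) \<le> 210 * bound"
    using t2 \<zeta> H2 \<alpha>EQ nn unfolding d2 distrib_left bound_def \<sigma>_def[symmetric] E_def[symmetric] \<alpha>_def[symmetric] by linarith
qed

section \<open>Norms and Riesz sequences\<close>

lemma enn_powr_mono: "r > 0 \<Longrightarrow> x \<le> y \<Longrightarrow> enn_powr x r \<le> enn_powr y r"
  unfolding enn_powr_def
  by (auto simp: top_unique less_top intro!: ennreal_leI powr_mono2 enn2real_mono)

lemma enn_powr_powr_inverse: "r > 0 \<Longrightarrow> enn_powr (enn_powr x r) (1 / r) = x"
  by (cases x) (auto simp: enn_powr_def powr_powr)

lemma enn_powr_ennreal: "x \<ge> 0 \<Longrightarrow> enn_powr (ennreal x) r = ennreal (x powr r)"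
  by (simp add: enn_powr_def)

lemma enn_powr_mult: "r > 0 \<Longrightarrow> k > 0 \<Longrightarrow> enn_powr (ennreal k * x) r = ennreal (k powr r) * enn_powr x r"
  by (cases x) (auto simp: enn_powr_def ennreal_mult_eq_top_iff ennreal_mult[symmetric] powr_mult ennreal_mult_top)

lemma enn_powr_half_sq: "(enn_powr x (1 / 2))\<^sup>2 = x"
  by (cases x) (auto simp: enn_powr_def ennreal_power powr_half_sqrt power2_eq_square ennreal_mult[symmetric])

definition sq_norm :: "'a measure \<Rightarrow> ('a \<Rightarrow> complex) \<Rightarrow> ennreal"
  where "sq_norm M f = (\<integral>\<^sup>+x. ennreal ((cmod (f x))\<^sup>2) \<partial>M)"

lemma Lp_norm_2: "Lp_norm 2 M f = enn_powr (sq_norm M f) (1 / 2)"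
  by (simp add: Lp_norm_def sq_norm_def powr_numeral)

lemma Lp_norm_2_sq: "(Lp_norm 2 M f)\<^sup>2 = sq_norm M f"
  unfolding Lp_norm_2 by (rule enn_powr_half_sq)

lemma Lp_norm_2_le: "r \<ge> 0 \<Longrightarrow> sq_norm M f \<le> ennreal (r\<^sup>2) \<Longrightarrow> Lp_norm 2 M f \<le> ennreal r"
  unfolding Lp_norm_2 using enn_powr_mono[of "1/2" "sq_norm M f" "ennreal (r\<^sup>2)"]
  by (simp add: enn_powr_ennreal powr_half_sqrt)

lemma sq_norm_le_iff: "r \<ge> 0 \<Longrightarrow> sq_norm M f \<le> ennreal (r\<^sup>2) \<longleftrightarrow> Lp_norm 2 M f \<le> ennreal r"
  using Lp_norm_2_le power_mono[of "Lp_norm 2 M f" "ennreal r" 2]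
  by (auto simp: Lp_norm_2_sq ennreal_power)

lemma sq_norm_finite_iff: "Lp_norm 2 M f < \<infinity> \<longleftrightarrow> sq_norm M f < \<infinity>"
  unfolding Lp_norm_2 by (auto simp: enn_powr_def less_top)

lemma sq_norm_tendsto_0_iff: "(\<lambda>n. Lp_norm 2 M (f n)) \<longlonglongrightarrow> 0 \<longleftrightarrow> (\<lambda>n. sq_norm M (f n)) \<longlonglongrightarrow> 0"
proof -
  have sq: "Lp_norm 2 M g < ennreal e \<longleftrightarrow> sq_norm M g < ennreal (e\<^sup>2)" if "e > 0" for g :: "'a \<Rightarrow> complex" and e
  proof (cases "sq_norm M g")
    case (real r)
    have "Lp_norm 2 M g = ennreal (sqrt r)" unfolding Lp_norm_2 real using real by (simp add: enn_powr_ennreal powr_half_sqrt)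
    moreover have "sqrt r < e \<longleftrightarrow> r < e\<^sup>2" using that real real_sqrt_less_iff[of r "e\<^sup>2"] by simp
    ultimately show ?thesis unfolding real using that real by (simp add: ennreal_less_iff)
  next
    case top
    then show ?thesis by (simp add: Lp_norm_2 enn_powr_def)
  qed
  have ev: "X \<longlonglongrightarrow> 0 \<longleftrightarrow> (\<forall>e>0. eventually (\<lambda>n. X n < ennreal e) sequentially)" for X :: "nat \<Rightarrow> ennreal"
  proof
    assume "X \<longlonglongrightarrow> 0"
    then show "\<forall>e>0. eventually (\<lambda>n. X n < ennreal e) sequentially"
      using order_tendstoD(2)[of X 0 sequentially] by simp
  next
    assume *: "\<forall>e>0. eventually (\<lambda>n. X n < ennreal e) sequentially"
    show "X \<longlonglongrightarrow> 0"
    proof (rule order_tendstoI)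
      fix a :: ennreal assume "0 < a"
      then obtain e where e: "0 < e" "e < a" using dense by blast
      then obtain r where r: "r > 0" "e = ennreal r"
        by (cases e) auto
      have "eventually (\<lambda>n. X n < e) sequentially" using * r by blast
      then show "eventually (\<lambda>n. X n < a) sequentially" by eventually_elim (use e in auto)
    qed auto
  qed
  show ?thesis
  proof
    assume "(\<lambda>n. Lp_norm 2 M (f n)) \<longlonglongrightarrow> 0"
    then have h: "\<And>e. e > 0 \<Longrightarrow> eventually (\<lambda>n. sq_norm M (f n) < ennreal (e\<^sup>2)) sequentially"
      unfolding ev using sq by simp
    have "eventually (\<lambda>n. sq_norm M (f n) < ennreal e) sequentially" if "e > 0" for e
      using h[of "sqrt e"] that by simp
    then show "(\<lambda>n. sq_norm M (f n)) \<longlonglongrightarrow> 0" unfolding ev by blast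
  next
    assume "(\<lambda>n. sq_norm M (f n)) \<longlonglongrightarrow> 0"
    then have h: "\<And>e. e > 0 \<Longrightarrow> eventually (\<lambda>n. sq_norm M (f n) < ennreal e) sequentially"
      unfolding ev by blast
    have "eventually (\<lambda>n. Lp_norm 2 M (f n) < ennreal e) sequentially" if "e > 0" for e
      using h[of "e\<^sup>2"] that sq by simp
    then show "(\<lambda>n. Lp_norm 2 M (f n)) \<longlonglongrightarrow> 0" unfolding ev by blast
  qed
qed

lemma L2_expansion_iff: "L2_expansion M phi c f \<longleftrightarrow> (\<lambda>n. sq_norm M (\<lambda>y. f y - lincomb phi n c y)) \<longlonglongrightarrow> 0"
  unfolding L2_expansion_def by (rule sq_norm_tendsto_0_iff)

lemma sq_norm_add_le:
  assumes [measurable]: "f \<in> borel_measurable M" "g \<in> borel_measurable M"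
  shows "sq_norm M (\<lambda>y. f y + g y) \<le> 2 * sq_norm M f + 2 * sq_norm M g"
proof -
  have pt: "(cmod (x + y))\<^sup>2 \<le> 2 * (cmod x)\<^sup>2 + 2 * (cmod y)\<^sup>2" for x y :: complex
  proof -
    have "(cmod (x + y))\<^sup>2 \<le> (cmod x + cmod y)\<^sup>2" by (intro power_mono norm_triangle_ineq) auto
    also have "\<dots> \<le> 2 * (cmod x)\<^sup>2 + 2 * (cmod y)\<^sup>2"
      using zero_le_power2[of "cmod x - cmod y"] by (simp add: power2_eq_square algebra_simps)
    finally show ?thesis .
  qed
  have "sq_norm M (\<lambda>y. f y + g y) \<le> (\<integral>\<^sup>+x. 2 * ennreal ((cmod (f x))\<^sup>2) + 2 * ennreal ((cmod (g x))\<^sup>2) \<partial>M)"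
    unfolding sq_norm_def
  proof (intro nn_integral_mono)
    fix x
    have "ennreal ((cmod (f x + g x))\<^sup>2) \<le> ennreal (2 * (cmod (f x))\<^sup>2 + 2 * (cmod (g x))\<^sup>2)"
      by (intro ennreal_leI pt)
    then show "ennreal ((cmod (f x + g x))\<^sup>2) \<le> 2 * ennreal ((cmod (f x))\<^sup>2) + 2 * ennreal ((cmod (g x))\<^sup>2)"
      by (simp add: ennreal_plus ennreal_mult)
  qed
  also have "\<dots> = 2 * sq_norm M f + 2 * sq_norm M g"
    unfolding sq_norm_def by (simp add: nn_integral_add nn_integral_cmult)
  finally show ?thesis .
qed

lemma sq_norm_AE_cong: "AE y in M. f y = g y \<Longrightarrow> sq_norm M f = sq_norm M g"
  unfolding sq_norm_def by (rule nn_integral_cong_AE) (auto elim: eventually_mono)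

lemma sq_norm_minus_commute: "sq_norm M (\<lambda>y. f y - g y) = sq_norm M (\<lambda>y. g y - f y)"
  by (simp add: sq_norm_def norm_minus_commute)

lemma sq_norm_limit_unique:
  assumes [measurable]: "f \<in> borel_measurable M" "g \<in> borel_measurable M" "\<And>n. S n \<in> borel_measurable M"
    and f: "(\<lambda>n. sq_norm M (\<lambda>y. f y - S n y)) \<longlonglongrightarrow> 0" and g: "(\<lambda>n. sq_norm M (\<lambda>y. g y - S n y)) \<longlonglongrightarrow> 0"
  shows "AE y in M. f y = g y"
proof -
  have "sq_norm M (\<lambda>y. f y - g y) \<le> 2 * sq_norm M (\<lambda>y. f y - S n y) + 2 * sq_norm M (\<lambda>y. g y - S n y)" for n
    using sq_norm_add_le[of "\<lambda>y. f y - S n y" M "\<lambda>y. S n y - g y"] by (simp add: sq_norm_minus_commute[of M "S n" g])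
  moreover have "(\<lambda>n. 2 * sq_norm M (\<lambda>y. f y - S n y) + 2 * sq_norm M (\<lambda>y. g y - S n y)) \<longlonglongrightarrow> 2 * 0 + 2 * 0"
    by (intro tendsto_add ennreal_tendsto_cmult f g) auto
  ultimately have "sq_norm M (\<lambda>y. f y - g y) \<le> 2 * 0 + 2 * 0"
    by (intro LIMSEQ_le_const) auto
  then have "sq_norm M (\<lambda>y. f y - g y) = 0" by simp
  then have "AE y in M. ennreal ((cmod (f y - g y))\<^sup>2) = 0"
    unfolding sq_norm_def by (subst (asm) nn_integral_0_iff_AE) auto
  then show ?thesis by eventually_elim simp
qed

lemma lincomb_measurable:
  "(\<And>j. phi j \<in> borel_measurable M) \<Longrightarrow> lincomb phi n c \<in> borel_measurable M"
  unfolding lincomb_def by (intro borel_measurable_sum borel_measurable_times) auto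

lemma sq_norm_count_ge_sum:
  assumes "finite F" "F \<subseteq> A"
  shows "(\<Sum>j\<in>F. ennreal ((cmod (c j))\<^sup>2)) \<le> sq_norm (count_space A) c"
proof -
  have "(\<Sum>j\<in>F. ennreal ((cmod (c j))\<^sup>2)) = (\<integral>\<^sup>+j. ennreal ((cmod (c j))\<^sup>2) \<partial>count_space F)"
    using assms by (simp add: nn_integral_count_space_finite)
  also have "\<dots> = (\<integral>\<^sup>+j. ennreal ((cmod (c j))\<^sup>2) * indicator F j \<partial>count_space A)"
    using assms by (subst nn_integral_count_space_indicator) (auto simp: nn_integral_count_space_indicator indicator_def intro!: nn_integral_cong)
  also have "\<dots> \<le> sq_norm (count_space A) c"
    unfolding sq_norm_def by (intro nn_integral_mono) (auto simp: indicator_def)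
  finally show ?thesis .
qed

lemma sq_norm_count_trunc: "sq_norm (count_space UNIV) (trunc n c) = ennreal ((l2n n c)\<^sup>2)"
proof -
  have "sq_norm (count_space UNIV) (trunc n c) = (\<Sum>j<n. ennreal ((cmod (trunc n c j))\<^sup>2))"
    unfolding sq_norm_def by (rule nn_integral_count_space') (auto simp: trunc_def)
  also have "\<dots> = ennreal (\<Sum>j<n. (cmod (c j))\<^sup>2)"
    by (subst sum_ennreal[symmetric]) (auto simp: trunc_def)
  finally show ?thesis by (simp add: L2_set_def sum_nonneg)
qed

lemma lincomb_trunc: "lincomb phi k (trunc n c) = lincomb phi (min k n) c"
proof
  fix y
  have "(\<Sum>j<k. trunc n c j * phi j y) = (\<Sum>j<min k n. c j * phi j y)"
    by (rule sum.mono_neutral_cong_right) (auto simp: trunc_def)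
  then show "lincomb phi k (trunc n c) y = lincomb phi (min k n) c y" by (simp add: lincomb_def)
qed

locale riesz = prob_space M for M :: "'a measure" +
  fixes phi :: "nat \<Rightarrow> 'a \<Rightarrow> complex" and a b K :: real
  assumes basis: "bounded_riesz_basis M phi a b K"
begin

lemma a_pos: "a > 0" and b_pos: "b > 0"
  using basis by (auto simp: bounded_riesz_basis_def)

lemma phi_measurable[measurable]: "phi j \<in> borel_measurable M"
  using basis by (auto simp: bounded_riesz_basis_def L2_space_def)

lemma lincomb_meas[measurable]: "lincomb phi n c \<in> borel_measurable M"
  by (intro lincomb_measurable phi_measurable)

text \<open>
  The basis property provides the two inequalities for one limit \<open>g\<close> of the series only; \<open>f\<close> is
  another one, and \<open>L\<^sup>2\<close> limits are unique up to null sets.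
\<close>
lemma expansion_norm:
  assumes f[measurable]: "f \<in> borel_measurable M" and c: "sq_norm (count_space UNIV) c < \<infinity>" and e: "L2_expansion M phi c f"
  shows "ennreal a * sq_norm (count_space UNIV) c \<le> sq_norm M f" "sq_norm M f \<le> ennreal b * sq_norm (count_space UNIV) c"
proof -
  obtain g where g: "g \<in> L2_space M" "L2_expansion M phi c g"
    "ennreal a * (seq_norm 2 c)\<^sup>2 \<le> (Lp_norm 2 M g)\<^sup>2" "(Lp_norm 2 M g)\<^sup>2 \<le> ennreal b * (seq_norm 2 c)\<^sup>2"
    using basis c unfolding bounded_riesz_basis_def sq_norm_finite_iff[symmetric] by blast
  have [measurable]: "g \<in> borel_measurable M" using g by (simp add: L2_space_def)
  have "AE y in M. f y = g y"
    using e g(2) unfolding L2_expansion_iff by (intro sq_norm_limit_unique[of f M g "\<lambda>n. lincomb phi n c"]) auto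
  then have "sq_norm M f = sq_norm M g" by (rule sq_norm_AE_cong)
  with g(3,4) show "ennreal a * sq_norm (count_space UNIV) c \<le> sq_norm M f" "sq_norm M f \<le> ennreal b * sq_norm (count_space UNIV) c"
    unfolding Lp_norm_2_sq by simp_all
qed

lemma lincomb_norm:
  shows "ennreal (a * (l2n n z)\<^sup>2) \<le> sq_norm M (lincomb phi n z)" "sq_norm M (lincomb phi n z) \<le> ennreal (b * (l2n n z)\<^sup>2)"
proof -
  have e: "L2_expansion M phi (trunc n z) (lincomb phi n z)"
    unfolding L2_expansion_iff
  proof (rule tendsto_eventually, rule eventually_sequentiallyI[of n])
    fix k assume "n \<le> k"
    then show "sq_norm M (\<lambda>y. lincomb phi n z y - lincomb phi k (trunc n z) y) = 0"
      by (simp add: lincomb_trunc min_absorb2 sq_norm_def)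
  qed
  show "ennreal (a * (l2n n z)\<^sup>2) \<le> sq_norm M (lincomb phi n z)" "sq_norm M (lincomb phi n z) \<le> ennreal (b * (l2n n z)\<^sup>2)"
    using expansion_norm[OF _ _ e] a_pos b_pos by (simp_all add: sq_norm_count_trunc ennreal_mult)
qed

lemma AE_bounded: "AE y in M. \<forall>j. cmod (phi j y) \<le> K"
proof -
  have K: "K \<ge> 0" "(SUP i. Lp_norm \<infinity> M (phi i)) = ennreal K"
    using basis by (auto simp: bounded_riesz_basis_def)
  have "AE y in M. cmod (phi j y) \<le> K" for j
  proof -
    have "esssup M (\<lambda>x. ennreal (cmod (phi j x))) = Lp_norm \<infinity> M (phi j)" by (simp add: Lp_norm_def)
    also have "\<dots> \<le> (SUP i. Lp_norm \<infinity> M (phi i))" by (rule SUP_upper) simp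
    finally have le: "esssup M (\<lambda>x. ennreal (cmod (phi j x))) \<le> ennreal K" using K by simp
    have "AE y in M. ennreal (cmod (phi j y)) \<le> esssup M (\<lambda>x. ennreal (cmod (phi j x)))" by (rule esssup_AE)
    then show ?thesis by eventually_elim (use le K in \<open>meson ennreal_le_iff order_trans\<close>)
  qed
  then show ?thesis unfolding AE_all_countable by blast
qed

text \<open>
  On a probability space \<open>\<parallel>\<phi>\<^sub>0\<parallel>\<^sub>2 \<le> \<parallel>\<phi>\<^sub>0\<parallel>\<^sub>\<infinity> \<le> K\<close>, while the lower Riesz inequality bounds the left-hand side from
  below. This ensures that the logarithm in the sample size is at least \<open>ln 2\<close>.
\<close>
lemma K_bound: "K > 0" "a \<le> K\<^sup>2"
proof -
  have K: "K \<ge> 0" using basis by (auto simp: bounded_riesz_basis_def)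
  have "ennreal (a * (l2n 1 (\<lambda>_. 1))\<^sup>2) \<le> sq_norm M (lincomb phi 1 (\<lambda>_. 1))" by (rule lincomb_norm)
  also have "\<dots> \<le> (\<integral>\<^sup>+y. ennreal (K\<^sup>2) \<partial>M)"
    unfolding sq_norm_def using AE_bounded
    by (intro nn_integral_mono_AE, eventually_elim) (auto simp: lincomb_def intro!: ennreal_leI power_mono)
  also have "\<dots> = ennreal (K\<^sup>2)" by (simp add: emeasure_space_1)
  finally show "a \<le> K\<^sup>2" by (simp add: L2_set_def)
  with a_pos K show "K > 0" by (cases "K = 0") auto
qed

lemma expansion_diff:
  assumes e: "L2_expansion M phi c f"
  shows "L2_expansion M phi (\<lambda>j. c j - trunc n z j) (\<lambda>y. f y - lincomb phi n z y)"
proof -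
  have eq: "f y - lincomb phi n z y - lincomb phi k (\<lambda>j. c j - trunc n z j) y = f y - lincomb phi k c y"
    if "k \<ge> n" for k y
  proof -
    have "lincomb phi k (\<lambda>j. c j - trunc n z j) y = lincomb phi k c y - lincomb phi k (trunc n z) y"
      by (simp add: lincomb_def left_diff_distrib sum_subtractf)
    then show ?thesis using that by (simp add: lincomb_trunc min_absorb2)
  qed
  have "(\<lambda>k. sq_norm M (\<lambda>y. f y - lincomb phi n z y - lincomb phi k (\<lambda>j. c j - trunc n z j) y)) \<longlonglongrightarrow> 0"
  proof (rule Lim_transform_eventually)
    show "(\<lambda>k. sq_norm M (\<lambda>y. f y - lincomb phi k c y)) \<longlonglongrightarrow> 0" using e by (simp add: L2_expansion_iff)
    show "eventually (\<lambda>k. sq_norm M (\<lambda>y. f y - lincomb phi k c y) =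
        sq_norm M (\<lambda>y. f y - lincomb phi n z y - lincomb phi k (\<lambda>j. c j - trunc n z j) y)) sequentially"
      by (rule eventually_sequentiallyI[of n]) (simp add: eq)
  qed
  then show ?thesis by (simp add: L2_expansion_iff)
qed

end

section \<open>Noise from the tail of the coefficients\<close>

text \<open>
  Stechkin's estimate for dyadic sparsity levels: on \<open>S (l + 1)\<close>, but off \<open>S l\<close>, there are at most
  $2^{l+1} s$ indices and the \<open>\<ell>\<^sup>2\<close> norm is at most \<open>w l\<close>.
\<close>
lemma stechkin_block_sum:
  fixes c :: "nat \<Rightarrow> complex"
  assumes S: "\<And>l. l \<ge> k \<Longrightarrow> finite (S l)" "\<And>l. l \<ge> k \<Longrightarrow> card (S l) \<le> s * 2 ^ l"
    and w: "\<And>l F. l \<ge> k \<Longrightarrow> finite F \<Longrightarrow> L2_set (\<lambda>j. cmod (c j)) (F - S l) \<le> w l"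
    and B: "finite B" and L: "k \<le> L"
  shows "(\<Sum>j\<in>B. cmod (c j)) \<le> sqrt (real (s * 2 ^ k)) * L2_set (\<lambda>j. cmod (c j)) B
    + (\<Sum>l\<in>{k..<L}. sqrt (real (s * 2 ^ (l + 1))) * w l) + sqrt (real (card B)) * w L"
proof -
  have piece: "(\<Sum>j\<in>F \<inter> S l. cmod (c j)) \<le> sqrt (real (s * 2 ^ l)) * L2_set (\<lambda>j. cmod (c j)) F"
    if "l \<ge> k" "finite F" for l F
  proof -
    have "(\<Sum>j\<in>F \<inter> S l. cmod (c j)) \<le> sqrt (real (s * 2 ^ l)) * L2_set (\<lambda>j. cmod (c j)) (F \<inter> S l)"
      using sum_le_sqrt_card_L2_set[of "F \<inter> S l" "s * 2 ^ l" "\<lambda>j. cmod (c j)"] that S(2)[of l]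
        card_mono[OF S(1)[of l], of "F \<inter> S l"] by auto
    also have "\<dots> \<le> sqrt (real (s * 2 ^ l)) * L2_set (\<lambda>j. cmod (c j)) F"
      using that by (intro mult_left_mono L2_set_mono_set) auto
    finally show ?thesis .
  qed
  have split: "(\<Sum>j\<in>F. cmod (c j)) = (\<Sum>j\<in>F \<inter> S l. cmod (c j)) + (\<Sum>j\<in>F - S l. cmod (c j))"
    if "finite F" for F l
    using that by (rule sum.Int_Diff)
  have "(\<Sum>j\<in>B - S k. cmod (c j)) \<le> (\<Sum>l\<in>{k..<L}. sqrt (real (s * 2 ^ (l + 1))) * w l) + (\<Sum>j\<in>B - S L. cmod (c j))"
    using L
  proof (induction L rule: dec_induct)
    case base
    show ?case by simp
  next
    case (step L)
    have "(\<Sum>j\<in>B - S L. cmod (c j)) = (\<Sum>j\<in>(B - S L) \<inter> S (L + 1). cmod (c j)) + (\<Sum>j\<in>(B - S L) - S (L + 1). cmod (c j))"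
      using B by (intro split) auto
    also have "\<dots> \<le> sqrt (real (s * 2 ^ (L + 1))) * L2_set (\<lambda>j. cmod (c j)) (B - S L) + (\<Sum>j\<in>B - S (L + 1). cmod (c j))"
      using B step by (intro add_mono piece sum_mono2) auto
    also have "\<dots> \<le> sqrt (real (s * 2 ^ (L + 1))) * w L + (\<Sum>j\<in>B - S (L + 1). cmod (c j))"
      using B step by (intro add_mono mult_left_mono w) auto
    finally show ?case using step by simp
  qed
  moreover have "(\<Sum>j\<in>B - S L. cmod (c j)) \<le> sqrt (real (card B)) * w L"
  proof -
    have "(\<Sum>j\<in>B - S L. cmod (c j)) \<le> sqrt (real (card B)) * L2_set (\<lambda>j. cmod (c j)) (B - S L)"
      using sum_le_sqrt_card_L2_set[of "B - S L" "card B" "\<lambda>j. cmod (c j)"] B card_mono[OF B, of "B - S L"] by auto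
    also have "\<dots> \<le> sqrt (real (card B)) * w L" using B L by (intro mult_left_mono w) auto
    finally show ?thesis .
  qed
  ultimately show ?thesis using piece[of k B] split[OF B, of k] B by simp
qed

lemma geometric_block:
  fixes y :: real
  assumes "a \<le> L"
  shows "(\<Sum>l\<in>{a..<L}. y ^ l) * (1 - y) = y ^ a - y ^ L"
  using assms
proof (induction L rule: dec_induct)
  case (step L)
  have "(\<Sum>l\<in>{a..<Suc L}. y ^ l) * (1 - y) = (\<Sum>l\<in>{a..<L}. y ^ l) * (1 - y) + y ^ L * (1 - y)"
    using step(1) by (simp only: sum.atLeastLessThan_Suc distrib_right)
  then show ?case unfolding step.IH by (simp add: algebra_simps)
qed simp

definition lin_geom :: "real \<Rightarrow> real"
  where "lin_geom x = (\<Sum>k. (real k + 3) * x ^ k)"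

lemma lin_geom_sums:
  assumes "0 < x" "x < 1"
  shows "summable (\<lambda>k. (real k + 3) * x ^ k)" and "(\<Sum>k<N. (real k + 3) * x ^ k) \<le> lin_geom x" and "lin_geom x > 0"
proof -
  have "summable (\<lambda>k. real k * x ^ k)"
    using geometric_deriv_sums[of x] assms summable_mult[of "\<lambda>n. real (Suc n) * x ^ n" x]
    by (subst summable_Suc_iff[symmetric]) (auto simp: sums_iff algebra_simps)
  moreover have "summable (\<lambda>k. 3 * x ^ k)" using assms by (intro summable_mult summable_geometric) auto
  ultimately show s: "summable (\<lambda>k. (real k + 3) * x ^ k)"
    by (simp add: distrib_right summable_add)
  show "(\<Sum>k<N. (real k + 3) * x ^ k) \<le> lin_geom x"
    unfolding lin_geom_def using assms by (intro sum_le_suminf s) auto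
  show "lin_geom x > 0"
    unfolding lin_geom_def using assms by (intro suminf_pos s) auto
qed

lemma l2n_sum: "l2n m (\<lambda>i. \<Sum>k<N. f k i) \<le> (\<Sum>k<(N::nat). l2n m (f k))"
proof (induction N)
  case (Suc N)
  have "l2n m (\<lambda>i. \<Sum>k<Suc N. f k i) \<le> l2n m (\<lambda>i. \<Sum>k<N. f k i) + l2n m (f N)"
    using l2n_triangle[where z = "\<lambda>i. \<Sum>k<N. f k i" and w = "f N"] by simp
  with Suc show ?case by simp
qed (simp add: L2_set_def)

text \<open>
  Here \<open>T\<close> and \<open>W\<close> measure the decay of the tails and of the best approximation errors; the surplus
  over the critical rate $2^{-k/2}$ is expressed by \<open>x\<close> and \<open>y\<close>. On block number \<open>k\<close> the
  \<open>\<ell>\<^sup>1\<close> norm splits at sparsity $2^{k+1} s$. Up to that sparsity it is governed by the tail, which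
  contributes $\sqrt s\, x^k T$, and beyond it by the best approximation errors, which contribute
  $\sqrt s\, y^k W$. Thus both parts are summable over \<open>k\<close> even with the factor \<open>k + 3\<close>.
\<close>
theorem tail_noise_bound:
  fixes c d :: "nat \<Rightarrow> complex" and A :: "nat \<Rightarrow> nat \<Rightarrow> complex"
  assumes s: "s \<ge> 1" and n: "n \<ge> 1" and x: "0 < x" "x < 1" and y: "0 < y" "y < 1" and T: "T \<ge> 0" and W: "W \<ge> 0"
    and H: "\<And>k z. l2n m (mv (2 ^ (k + 1) * n) A z)
      \<le> \<beta> * (4 * l2n (2 ^ (k + 1) * n) z + sqrt ((real k + 3) / real s) * l1n (2 ^ (k + 1) * n) z)" and \<beta>: "\<beta> \<ge> 0"
    and tail: "\<And>k. L2_set (\<lambda>j. cmod (c j)) {2 ^ k * n..<2 ^ (k + 1) * n} \<le> (1 / sqrt 2) ^ k * x ^ k * T"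
    and S: "\<And>l. l \<ge> 1 \<Longrightarrow> finite (S l)" "\<And>l. l \<ge> 1 \<Longrightarrow> card (S l) \<le> s * 2 ^ l"
    and w: "\<And>l F. l \<ge> 1 \<Longrightarrow> finite F \<Longrightarrow> L2_set (\<lambda>j. cmod (c j)) (F - S l) \<le> (1 / sqrt 2) ^ l * y ^ l * W"
    and conv: "\<And>i. i < m \<Longrightarrow> (\<lambda>k. \<Sum>j<2 ^ k * n. A i j * c j) \<longlonglongrightarrow> d i"
  shows "l2n m (\<lambda>i. mv n A c i - d i) \<le> \<beta> * (6 * lin_geom x * T + 2 * lin_geom y / (1 - y) * W)"
proof -
  define B where "B = (\<lambda>k. {2 ^ k * n..<2 ^ (k + 1) * n})"
  define z where "z = (\<lambda>k j. if j \<in> B k then c j else 0)"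
  have s0: "sqrt (real s) > 0" using s by simp
  have q: "sqrt (real (s * 2 ^ (l + 1))) * (1 / sqrt 2) ^ l = sqrt (real s) * sqrt 2" for l
    by (simp add: real_sqrt_mult real_sqrt_power power_divide)
  have l1B: "(\<Sum>j\<in>B k. cmod (c j)) \<le> sqrt (real s) * (sqrt 2 * (x ^ k * T + y ^ k / (1 - y) * W))" for k
  proof -
    have bound: "(\<Sum>j\<in>B k. cmod (c j)) \<le> sqrt (real s) * (sqrt 2 * (x ^ k * T + y ^ k / (1 - y) * W))
        + sqrt (real (card (B k))) * (y ^ L * W)" if L: "k + 1 \<le> L" for L
    proof -
      have geo: "(\<Sum>l\<in>{k + 1..<L}. y ^ l) \<le> y ^ k / (1 - y)"
      proof -
        have "(\<Sum>l\<in>{k + 1..<L}. y ^ l) * (1 - y) = y ^ (k + 1) - y ^ L"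
          using L by (rule geometric_block)
        then have "(\<Sum>l\<in>{k + 1..<L}. y ^ l) = (y ^ (k + 1) - y ^ L) / (1 - y)"
          using y by (simp add: field_simps)
        also have "\<dots> \<le> y ^ k / (1 - y)"
        proof -
          have "y ^ (k + 1) \<le> y ^ k" "0 \<le> y ^ L" using y by (auto intro: mult_left_le_one_le)
          then show ?thesis using y by (intro divide_right_mono) linarith+
        qed
        finally show ?thesis .
      qed
      have "(\<Sum>j\<in>B k. cmod (c j)) \<le> sqrt (real (s * 2 ^ (k + 1))) * L2_set (\<lambda>j. cmod (c j)) (B k)
        + (\<Sum>l\<in>{k + 1..<L}. sqrt (real (s * 2 ^ (l + 1))) * ((1 / sqrt 2) ^ l * y ^ l * W))
        + sqrt (real (card (B k))) * ((1 / sqrt 2) ^ L * y ^ L * W)"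
        by (rule stechkin_block_sum[of "k + 1" S s c "\<lambda>l. (1 / sqrt 2) ^ l * y ^ l * W"])
           (use S w L in \<open>auto simp: B_def\<close>)
      also have "sqrt (real (s * 2 ^ (k + 1))) * L2_set (\<lambda>j. cmod (c j)) (B k)
          \<le> sqrt (real (s * 2 ^ (k + 1))) * ((1 / sqrt 2) ^ k * x ^ k * T)"
        unfolding B_def by (intro mult_left_mono tail) auto
      also have "\<dots> = sqrt (real (s * 2 ^ (k + 1))) * (1 / sqrt 2) ^ k * (x ^ k * T)" by (simp only: mult.assoc)
      also have "\<dots> = sqrt (real s) * (sqrt 2 * (x ^ k * T))" unfolding q by (simp only: mult.assoc)
      also have "(\<Sum>l\<in>{k + 1..<L}. sqrt (real (s * 2 ^ (l + 1))) * ((1 / sqrt 2) ^ l * y ^ l * W))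
          = (\<Sum>l\<in>{k + 1..<L}. (sqrt (real (s * 2 ^ (l + 1))) * (1 / sqrt 2) ^ l) * (y ^ l * W))"
        by (simp only: mult.assoc)
      also have "\<dots> = sqrt (real s) * (sqrt 2 * ((\<Sum>l\<in>{k + 1..<L}. y ^ l) * W))"
        unfolding q by (simp add: sum_distrib_left sum_distrib_right mult_ac)
      also have "sqrt (real s) * (sqrt 2 * ((\<Sum>l\<in>{k + 1..<L}. y ^ l) * W)) \<le> sqrt (real s) * (sqrt 2 * (y ^ k / (1 - y) * W))"
        using geo W by (intro mult_left_mono mult_right_mono) auto
      also have "sqrt (real (card (B k))) * ((1 / sqrt 2) ^ L * y ^ L * W) \<le> sqrt (real (card (B k))) * (1 * y ^ L * W)"
        using y W by (intro mult_left_mono mult_right_mono power_le_one) auto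
      finally show ?thesis by (simp add: distrib_left)
    qed
    have "(\<lambda>L. sqrt (real s) * (sqrt 2 * (x ^ k * T + y ^ k / (1 - y) * W)) + sqrt (real (card (B k))) * (y ^ L * W))
        \<longlonglongrightarrow> sqrt (real s) * (sqrt 2 * (x ^ k * T + y ^ k / (1 - y) * W)) + sqrt (real (card (B k))) * (0 * W)"
      using y by (intro tendsto_intros LIMSEQ_realpow_zero) auto
    then show ?thesis using bound by (intro LIMSEQ_le_const) auto
  qed
  have blk: "l2n m (mv (2 ^ (k + 1) * n) A (z k)) \<le> \<beta> * (6 * ((real k + 3) * x ^ k) * T + 2 * ((real k + 3) * y ^ k) / (1 - y) * W)" for k
  proof -
    have l1: "l1n (2 ^ (k + 1) * n) (z k) = (\<Sum>j\<in>B k. cmod (c j))"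
      unfolding z_def B_def by (rule sum.mono_neutral_cong_right) auto
    have l2: "l2n (2 ^ (k + 1) * n) (z k) = L2_set (\<lambda>j. cmod (c j)) (B k)"
      unfolding z_def B_def L2_set_def by (intro arg_cong[of _ _ sqrt] sum.mono_neutral_cong_right) auto
    define X Y where "X = x ^ k * T" and "Y = y ^ k / (1 - y) * W"
    have XY: "X \<ge> 0" "Y \<ge> 0" using x y T W by (auto simp: X_def Y_def)
    have k3: "sqrt (real k + 3) * sqrt 2 \<le> 2 * (real k + 3)"
    proof -
      have "sqrt (real k + 3) \<le> real k + 3" by (rule real_le_lsqrt) (auto simp: power2_eq_square algebra_simps)
      moreover have "sqrt 2 \<le> (2::real)" by (rule real_le_lsqrt) auto
      ultimately have "sqrt (real k + 3) * sqrt 2 \<le> (real k + 3) * 2" by (intro mult_mono) auto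
      then show ?thesis by simp
    qed
    have "L2_set (\<lambda>j. cmod (c j)) (B k) \<le> (1 / sqrt 2) ^ k * X" using tail[of k] by (simp add: B_def X_def mult.assoc)
    also have "\<dots> \<le> 1 * X" using XY by (intro mult_right_mono power_le_one) auto
    finally have b2: "L2_set (\<lambda>j. cmod (c j)) (B k) \<le> X" by simp
    have "sqrt ((real k + 3) / real s) * (\<Sum>j\<in>B k. cmod (c j))
        \<le> sqrt ((real k + 3) / real s) * (sqrt (real s) * (sqrt 2 * (X + Y)))"
      unfolding X_def Y_def by (intro mult_left_mono l1B) auto
    also have "\<dots> = (sqrt (real k + 3) * sqrt 2) * (X + Y)" using s0 by (simp add: real_sqrt_divide)
    also have "\<dots> \<le> 2 * (real k + 3) * (X + Y)" using k3 XY by (intro mult_right_mono) auto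
    finally have b1: "sqrt ((real k + 3) / real s) * (\<Sum>j\<in>B k. cmod (c j)) \<le> 2 * (real k + 3) * (X + Y)" .
    have b3: "4 * X \<le> 4 * ((real k + 3) * X)" using XY by (auto simp: mult_le_cancel_right1)
    have "l2n m (mv (2 ^ (k + 1) * n) A (z k))
      \<le> \<beta> * (4 * L2_set (\<lambda>j. cmod (c j)) (B k) + sqrt ((real k + 3) / real s) * (\<Sum>j\<in>B k. cmod (c j)))"
      using H[of k "z k"] unfolding l1 l2 .
    also have "\<dots> \<le> \<beta> * (4 * ((real k + 3) * X) + 2 * (real k + 3) * (X + Y))"
      using b1 b2 b3 by (intro mult_left_mono \<beta>) linarith
    also have "\<dots> = \<beta> * (6 * ((real k + 3) * x ^ k) * T + 2 * ((real k + 3) * y ^ k) / (1 - y) * W)"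
      unfolding X_def Y_def by (simp add: field_simps)
    finally show ?thesis .
  qed
  define D where "D = (\<lambda>N i. (\<Sum>j<2 ^ N * n. A i j * c j) - mv n A c i)"
  have D_eq: "D N i = (\<Sum>k<N. mv (2 ^ (k + 1) * n) A (z k) i)" for N i
  proof (induction N)
    case 0
    show ?case by (simp add: D_def mv_def)
  next
    case (Suc N)
    have "mv (2 ^ (N + 1) * n) A (z N) i = (\<Sum>j\<in>B N. A i j * c j)"
      unfolding mv_def z_def B_def by (rule sum.mono_neutral_cong_right) auto
    moreover have "(\<Sum>j<2 ^ Suc N * n. A i j * c j) = (\<Sum>j<2 ^ N * n. A i j * c j) + (\<Sum>j\<in>B N. A i j * c j)"
      unfolding B_def lessThan_atLeast0 by (subst sum.atLeastLessThan_concat) auto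
    ultimately show ?case using Suc by (simp add: D_def)
  qed
  have DN: "l2n m (D N) \<le> \<beta> * (6 * lin_geom x * T + 2 * lin_geom y / (1 - y) * W)" for N
  proof -
    have "l2n m (D N) = l2n m (\<lambda>i. \<Sum>k<N. mv (2 ^ (k + 1) * n) A (z k) i)" by (simp only: D_eq)
    also have "\<dots> \<le> (\<Sum>k<N. l2n m (mv (2 ^ (k + 1) * n) A (z k)))" by (rule l2n_sum)
    also have "\<dots> \<le> (\<Sum>k<N. \<beta> * (6 * ((real k + 3) * x ^ k) * T + 2 * ((real k + 3) * y ^ k) / (1 - y) * W))"
      by (intro sum_mono blk)
    also have "\<dots> = \<beta> * (6 * (\<Sum>k<N. (real k + 3) * x ^ k) * T + 2 * (\<Sum>k<N. (real k + 3) * y ^ k) / (1 - y) * W)"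
      by (simp only: sum_distrib_left[symmetric] sum_distrib_right[symmetric] sum.distrib sum_divide_distrib[symmetric])
    also have "\<dots> \<le> \<beta> * (6 * lin_geom x * T + 2 * lin_geom y / (1 - y) * W)"
      using x y T W \<beta> by (intro mult_left_mono add_mono mult_right_mono divide_right_mono lin_geom_sums) auto
    finally show ?thesis .
  qed
  have "(\<lambda>N. l2n m (D N)) \<longlonglongrightarrow> l2n m (\<lambda>i. d i - mv n A c i)"
    unfolding L2_set_def D_def by (intro tendsto_intros conv) auto
  then have "l2n m (\<lambda>i. d i - mv n A c i) \<le> \<beta> * (6 * lin_geom x * T + 2 * lin_geom y / (1 - y) * W)"
    using DN by (intro LIMSEQ_le_const2) auto
  then show ?thesis by (simp add: norm_minus_commute)
qed

section \<open>Samples that are stable with high probability\<close>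

lemma half_le_ln2: "1/2 \<le> ln (2::real)"
proof -
  have "exp (1/2::real) \<le> 1 + 1/2 + (1/2)\<^sup>2"
    by (rule exp_bound) auto
  then have "exp (1/2::real) \<le> 2" by (simp add: power2_eq_square)
  then show ?thesis by (subst ln_ge_iff) auto
qed

text \<open>
  One number of levels \<open>t\<close>, of order \<open>ln (2 Q s)\<close>, serves all dyadic column numbers $2^{k+1} n$: both
  \<open>ln (4 * 2 ^ (k + 1) * n)\<close> and the logarithm for the failure probability $\varepsilon 2^{-k-1}$
  grow at most linearly in \<open>k\<close>, and so does the permitted error \<open>(k + 3) * \<eta>\<close>.
\<close>
lemma sample_size_bookkeeping:
  fixes Q \<epsilon> :: real and s n m :: nat
  assumes Q: "Q \<ge> 1" and s: "s \<ge> 1" and n: "n \<ge> 1" and \<epsilon>: "0 < \<epsilon>" "\<epsilon> < 1"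
    and m: "real m \<ge> 2 * 10^11 * Q * real s * ((ln (2 * Q * real s))\<^sup>2 * ln (2 * real n) + ln (2 / \<epsilon>))"
  defines "\<eta> \<equiv> 1 / (225000 * Q * real s)"
  shows "\<exists>t. \<forall>k. (1/4)^t \<le> (real k + 3) * \<eta> \<and>
    real m * ((real k + 3) * \<eta>) \<ge> 1334 * (real t + 1)\<^sup>2 * ln (4 * real (2 ^ (k + 1) * n)) + ln (2 / (\<epsilon> * (1/2)^(k+1))) + 1"
proof -
  define \<Lambda> where "\<Lambda> = ln (2 * Q * real s)"
  define N where "N = ln (2 * real n)"
  define e where "e = ln (2 / \<epsilon>)"
  have Qs: "Q * real s \<ge> 1" using mult_mono[OF Q, of 1 "real s"] Q s by simp
  have \<Lambda>: "\<Lambda> \<ge> ln 2" unfolding \<Lambda>_def using Qs by (simp add: mult.assoc)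
  have N: "N \<ge> ln 2" unfolding N_def using n by simp
  have e: "e \<ge> ln 2" unfolding e_def using \<epsilon> by (simp add: field_simps)
  note l2 = half_le_ln2
  have \<eta>0: "\<eta> > 0" unfolding \<eta>_def using Q s by simp
  have "ln (1 / \<eta>) = ln (112500 * (2 * Q * real s))" unfolding \<eta>_def by (simp add: mult_ac)
  also have "\<dots> = ln 112500 + \<Lambda>" unfolding \<Lambda>_def by (rule ln_mult_pos) (use Q s in auto)
  also have "ln (112500::real) \<le> ln (2 ^ 17)" by simp
  also have "ln ((2::real) ^ 17) = 17 * ln 2" by (subst ln_realpow) auto
  finally have ln\<eta>: "ln (1 / \<eta>) \<le> 18 * \<Lambda>" using \<Lambda> by simp
  have ln\<eta>0: "ln (1 / \<eta>) \<ge> 0" unfolding \<eta>_def using Qs by simp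
  \<comment> \<open>Rounding the natural logarithm suffices for \<open>(1/4)^t \<le> \<eta>\<close>, since \<open>1/4 < exp (-1)\<close>.\<close>
  define t where "t = nat \<lceil>ln (1 / \<eta>)\<rceil>"
  have t1: "ln (1 / \<eta>) \<le> real t" unfolding t_def by linarith
  have t2: "real t + 1 \<le> 22 * \<Lambda>" using ln\<eta> ln\<eta>0 \<Lambda> l2 unfolding t_def by linarith
  have "(1/4::real)^t \<le> exp (-1) ^ t"
    using exp_le by (intro power_mono) (auto simp: exp_minus field_simps)
  also have "\<dots> = exp (- real t)" by (simp add: exp_of_nat_mult[symmetric])
  also have "\<dots> \<le> exp (- ln (1 / \<eta>))" using t1 by simp
  also have "\<dots> = \<eta>" using \<eta>0 by (simp add: exp_minus)
  finally have t3: "(1/4)^t \<le> \<eta>" .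
  have "2 * 10^11 * Q * real s * (\<Lambda>\<^sup>2 * N + e) * \<eta> \<le> real m * \<eta>"
    using m \<eta>0 unfolding \<Lambda>_def N_def e_def by (intro mult_right_mono) auto
  also have "2 * 10^11 * Q * real s * (\<Lambda>\<^sup>2 * N + e) * \<eta> = (2 * 10^11 / 225000) * (\<Lambda>\<^sup>2 * N + e)"
    unfolding \<eta>_def using Q s by (simp add: field_simps)
  finally have m1: "(2 * 10^11 / 225000) * (\<Lambda>\<^sup>2 * N + e) \<le> real m * \<eta>" .
  \<comment> \<open>\<open>1334 * 22\<^sup>2 = 645656\<close>, which stays below \<open>2 * 10^11 / 225000\<close>.\<close>
  have "1334 * (real t + 1)\<^sup>2 * N \<le> 1334 * (22 * \<Lambda>)\<^sup>2 * N"
    using t2 N l2 by (intro mult_right_mono mult_left_mono power_mono) auto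
  also have "\<dots> = 645656 * (\<Lambda>\<^sup>2 * N)" by (simp add: power_mult_distrib)
  finally have m2: "1334 * (real t + 1)\<^sup>2 * N + 2 * e \<le> real m * \<eta>"
  proof -
    assume "1334 * (real t + 1)\<^sup>2 * N \<le> 645656 * (\<Lambda>\<^sup>2 * N)"
    moreover have "0 \<le> \<Lambda>\<^sup>2 * N" using N l2 by auto
    moreover have "8000000/9 * (\<Lambda>\<^sup>2 * N) + 8000000/9 * e \<le> real m * \<eta>"
      using m1 by (simp add: distrib_left)
    ultimately show ?thesis using e l2 by linarith
  qed
  have "(1/4)^t \<le> (real k + 3) * \<eta> \<and>
    real m * ((real k + 3) * \<eta>) \<ge> 1334 * (real t + 1)\<^sup>2 * ln (4 * real (2 ^ (k + 1) * n)) + ln (2 / (\<epsilon> * (1/2)^(k+1))) + 1" for k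
  proof
    show "(1/4)^t \<le> (real k + 3) * \<eta>" using t3 \<eta>0 by (simp add: distrib_right add_increasing)
    have "ln (4 * real (2 ^ (k + 1) * n)) = ln (2 ^ (k + 2) * (2 * real n))" by (simp add: mult_ac)
    also have "\<dots> = ln (2 ^ (k + 2)) + N" unfolding N_def by (rule ln_mult_pos) (use n in auto)
    also have "ln (2 ^ (k + 2)) = (real k + 2) * ln 2" using ln_realpow[of 2 "k + 2"] by (simp add: add.commute)
    also have "(real k + 2) * ln 2 + N \<le> (real k + 2) * N + N" using N by (intro add_mono mult_left_mono) auto
    finally have A: "ln (4 * real (2 ^ (k + 1) * n)) \<le> (real k + 3) * N" by (simp add: algebra_simps)
    have "2 / (\<epsilon> * (1/2)^(k+1)) = 2 ^ (k+1) * (2 / \<epsilon>)" by (simp add: power_divide)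
    then have "ln (2 / (\<epsilon> * (1/2)^(k+1))) = (real k + 1) * ln 2 + e"
    proof -
      assume "2 / (\<epsilon> * (1/2)^(k+1)) = 2 ^ (k+1) * (2 / \<epsilon>)"
      then have "ln (2 / (\<epsilon> * (1/2)^(k+1))) = ln (2 ^ (k+1) * (2 / \<epsilon>))" by (simp only:)
      also have "\<dots> = ln (2 ^ (k+1)) + e" unfolding e_def by (rule ln_mult_pos) (use \<epsilon> in auto)
      finally show ?thesis using ln_realpow[of 2 "k + 1"] by (simp add: add.commute)
    qed
    also have "\<dots> \<le> (real k + 1) * e + e" using e by (intro add_mono mult_left_mono) auto
    finally have B: "ln (2 / (\<epsilon> * (1/2)^(k+1))) + 1 \<le> (real k + 3) * (2 * e)"
    proof -
      assume "ln (2 / (\<epsilon> * (1/2)^(k+1))) \<le> (real k + 1) * e + e"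
      moreover have "(real k + 1) * e + e + 1 \<le> (real k + 3) * (2 * e)"
      proof -
        have "0 \<le> real k * e" "1 \<le> 2 * e" using e l2 by auto
        have "(real k + 1) * e + e + 1 = real k * e + 2 * e + 1" by (simp add: algebra_simps)
        also have "\<dots> \<le> 2 * (real k * e) + 6 * e"
          using \<open>0 \<le> real k * e\<close> \<open>1 \<le> 2 * e\<close> by linarith
        also have "\<dots> = (real k + 3) * (2 * e)" by (simp add: algebra_simps)
        finally show ?thesis .
      qed
      ultimately show ?thesis by linarith
    qed
    have "1334 * (real t + 1)\<^sup>2 * ln (4 * real (2 ^ (k + 1) * n)) \<le> 1334 * (real t + 1)\<^sup>2 * ((real k + 3) * N)"
      using A by (intro mult_left_mono) auto
    from this B have "1334 * (real t + 1)\<^sup>2 * ln (4 * real (2 ^ (k + 1) * n)) + (ln (2 / (\<epsilon> * (1/2)^(k+1))) + 1)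
      \<le> 1334 * (real t + 1)\<^sup>2 * ((real k + 3) * N) + (real k + 3) * (2 * e)" by (rule add_mono)
    also have "\<dots> = (real k + 3) * (1334 * (real t + 1)\<^sup>2 * N + 2 * e)" by algebra
    also have "\<dots> \<le> (real k + 3) * (real m * \<eta>)" using m2 by (intro mult_left_mono) auto
    finally show "real m * ((real k + 3) * \<eta>) \<ge> 1334 * (real t + 1)\<^sup>2 * ln (4 * real (2 ^ (k + 1) * n)) + ln (2 / (\<epsilon> * (1/2)^(k+1))) + 1"
      by (simp add: mult_ac)
  qed
  then show ?thesis by blast
qed

context riesz
begin

lemma emean_samples:
  assumes "m > 0"
  shows "emean m x (\<lambda>y. (cmod (lincomb phi n z y))\<^sup>2) = (l2n m (mv n (sample_matrix m x phi) z))\<^sup>2"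
proof -
  have "mv n (sample_matrix m x phi) z i = lincomb phi n z (x i) / of_real (sqrt (real m))" for i
    by (simp add: mv_def sample_matrix_def lincomb_def sum_divide_distrib mult.commute)
  then show ?thesis using assms
    by (simp add: emean_def L2_set_def sum_nonneg norm_divide power_divide sum_divide_distrib)
qed

text \<open>
  The two properties of the sample points on which the deterministic part of the proof rests: the
  null space property on the first \<open>n\<close> columns and the upper estimate on all dyadic column numbers.
\<close>
definition stable_samples :: "nat \<Rightarrow> nat \<Rightarrow> nat \<Rightarrow> (nat \<Rightarrow> 'a) \<Rightarrow> bool"
  where "stable_samples s n m x \<longleftrightarrow>
    (\<forall>z. l2n n z \<le> 18/5 / sqrt a * l2n m (mv n (sample_matrix m x phi) z) + 1/10 * (l1n n z / sqrt (real s))) \<and>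
    (\<forall>k z. l2n m (mv (2 ^ (k + 1) * n) (sample_matrix m x phi) z)
      \<le> sqrt b * (4 * l2n (2 ^ (k + 1) * n) z + sqrt ((real k + 3) / real s) * l1n (2 ^ (k + 1) * n) z))"

text \<open>
  The constant \<open>225000\<close> makes the \<open>\<ell>\<^sup>1\<close> term of the null space property at most \<open>1/10\<close>: for \<open>k = 0\<close> the
  additive error is \<open>60 * 3 * a / (225000 * s)\<close>, and dividing it by \<open>2/25 * a\<close> gives \<open>1 / (100 * s)\<close>.
\<close>
lemma stable_samplesI:
  assumes s: "s \<ge> 1" and m: "m > 0"
    and lo: "\<And>k z. 2/25 * (a * (l2n (2 ^ (k + 1) * n) z)\<^sup>2) - 60 * ((real k + 3) * (a / (225000 * K\<^sup>2 * real s))) * K\<^sup>2 * (l1n (2 ^ (k + 1) * n) z)\<^sup>2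
      \<le> (l2n m (mv (2 ^ (k + 1) * n) (sample_matrix m x phi) z))\<^sup>2"
    and up: "\<And>k z. (l2n m (mv (2 ^ (k + 1) * n) (sample_matrix m x phi) z))\<^sup>2 \<le>
      13 * (b * (l2n (2 ^ (k + 1) * n) z)\<^sup>2) + 60 * ((real k + 3) * (a / (225000 * K\<^sup>2 * real s))) * K\<^sup>2 * (l1n (2 ^ (k + 1) * n) z)\<^sup>2"
    and ab: "a \<le> b"
  shows "stable_samples s n m x"
  unfolding stable_samples_def
proof (intro conjI allI)
  let ?A = "sample_matrix m x phi"
  have s0: "real s > 0" using s by simp
  note a0 = a_pos and b0 = b_pos and K0 = K_bound(1)
  have coef: "60 * ((real k + 3) * (a / (225000 * K\<^sup>2 * real s))) * K\<^sup>2 = (real k + 3) * a / (3750 * real s)" for k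
    using K0 s0 by (simp add: field_simps)
  fix z
  \<comment> \<open>For \<open>k = 0\<close> the hypotheses concern \<open>2 * n\<close> columns; vectors on \<open>n\<close> columns are padded with zeros.\<close>
  have t1: "l1n (2 ^ (0 + 1) * n) (trunc n z) = l1n n z"
    by (rule sum.mono_neutral_cong_right) (auto simp: trunc_def)
  have t2: "l2n (2 ^ (0 + 1) * n) (trunc n z) = l2n n z"
    unfolding L2_set_def by (intro arg_cong[of _ _ sqrt] sum.mono_neutral_cong_right) (auto simp: trunc_def)
  have t3: "mv (2 ^ (0 + 1) * n) ?A (trunc n z) = mv n ?A z"
    unfolding mv_def by (intro ext sum.mono_neutral_cong_right) (auto simp: trunc_def)
  define X Y Z where "X = l2n n z" and "Y = l2n m (mv n ?A z)" and "Z = l1n n z / sqrt (real s)"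
  have pos: "X \<ge> 0" "Y \<ge> 0" "Z \<ge> 0" by (auto simp: X_def Y_def Z_def intro!: divide_nonneg_nonneg sum_nonneg)
  have "2/25 * (a * X\<^sup>2) - (real 0 + 3) * a / (3750 * real s) * (l1n n z)\<^sup>2 \<le> Y\<^sup>2"
    using lo[of "trunc n z" 0] unfolding coef t1 t2 t3 X_def Y_def .
  moreover have "(l1n n z)\<^sup>2 = real s * Z\<^sup>2" unfolding Z_def using s0 by (simp add: power_divide)
  ultimately have "2/25 * (a * X\<^sup>2) - a / 1250 * Z\<^sup>2 \<le> Y\<^sup>2" using s0 by simp
  then have "X\<^sup>2 \<le> (25/2) * (Y\<^sup>2 / a) + Z\<^sup>2 / 100" using a0 by (simp add: field_simps)
  also have "\<dots> \<le> (18/5 / sqrt a * Y)\<^sup>2 + (1/10 * Z)\<^sup>2"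
  proof -
    have "(18/5 / sqrt a * Y)\<^sup>2 = 324/25 * (Y\<^sup>2 / a)" "(1/10 * Z)\<^sup>2 = Z\<^sup>2 / 100"
      using a0 by (simp_all add: power_mult_distrib power_divide)
    moreover have "0 \<le> Y\<^sup>2 / a" using a0 by simp
    ultimately show ?thesis by linarith
  qed
  also have "\<dots> \<le> (18/5 / sqrt a * Y + 1/10 * Z)\<^sup>2"
    using pos a0 by (subst power2_sum) simp
  finally show "l2n n z \<le> 18/5 / sqrt a * l2n m (mv n ?A z) + 1/10 * (l1n n z / sqrt (real s))"
    unfolding X_def[symmetric] Y_def[symmetric] Z_def[symmetric]
    by (rule power2_le_imp_le) (use pos a0 in auto)
next
  fix k z
  let ?A = "sample_matrix m x phi"
  have s0: "real s > 0" using s by simp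
  note a0 = a_pos and b0 = b_pos and K0 = K_bound(1)
  define X Y where "X = l2n (2 ^ (k + 1) * n) z" and "Y = l1n (2 ^ (k + 1) * n) z"
  have pos: "X \<ge> 0" "Y \<ge> 0" by (auto simp: X_def Y_def intro!: sum_nonneg)
  have "60 * ((real k + 3) * (a / (225000 * K\<^sup>2 * real s))) * K\<^sup>2 = (real k + 3) / real s * (a / 3750)"
    using K0 s0 by (simp add: field_simps)
  also have "\<dots> \<le> (real k + 3) / real s * b" using ab a0 s0 by (intro mult_left_mono) auto
  finally have "60 * ((real k + 3) * (a / (225000 * K\<^sup>2 * real s))) * K\<^sup>2 * Y\<^sup>2 \<le> (real k + 3) / real s * b * Y\<^sup>2"
    by (rule mult_right_mono) simp
  moreover have "13 * (b * X\<^sup>2) \<le> b * (16 * X\<^sup>2)" using b0 by simp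
  ultimately have "(l2n m (mv (2 ^ (k + 1) * n) ?A z))\<^sup>2 \<le> b * (16 * X\<^sup>2) + (real k + 3) / real s * b * Y\<^sup>2"
    using up[of k z] unfolding X_def[symmetric] Y_def[symmetric] by linarith
  also have "\<dots> = b * ((4 * X)\<^sup>2 + (sqrt ((real k + 3) / real s) * Y)\<^sup>2)"
    using s0 by (simp add: power_mult_distrib algebra_simps)
  also have "\<dots> \<le> b * (4 * X + sqrt ((real k + 3) / real s) * Y)\<^sup>2"
    using pos b0 s0 by (intro mult_left_mono) (auto simp: power2_sum)
  also have "\<dots> = (sqrt b * (4 * X + sqrt ((real k + 3) / real s) * Y))\<^sup>2"
    using b0 by (simp add: power_mult_distrib)
  finally show "l2n m (mv (2 ^ (k + 1) * n) ?A z)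
      \<le> sqrt b * (4 * l2n (2 ^ (k + 1) * n) z + sqrt ((real k + 3) / real s) * l1n (2 ^ (k + 1) * n) z)"
    unfolding X_def[symmetric] Y_def[symmetric]
    by (rule power2_le_imp_le) (use pos b0 s0 in auto)
qed

lemma a_le_b: "a \<le> b"
  using order_trans[OF lincomb_norm(1)[where n = 1 and z = "\<lambda>_. 1"] lincomb_norm(2)[where n = 1 and z = "\<lambda>_. 1"]] b_pos
  by (simp add: L2_set_def)

text \<open>
  The functions are first cut off at \<open>K\<close>, since their essential bound holds only almost everywhere;
  almost surely no sample point notices. The failure probabilities $\varepsilon 2^{-k-1}$ of the
  dyadic column numbers add up to \<open>\<epsilon>\<close>.
\<close>
theorem stable_samples_event:
  assumes \<epsilon>: "0 < \<epsilon>" "\<epsilon> < 1" and s: "s \<ge> 1" and n: "n \<ge> 1" and m: "m \<ge> 1"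
    and mb: "real m \<ge> 2 * 10^11 * (K\<^sup>2 / a) * real s * ((ln (2 * (K\<^sup>2 / a) * real s))\<^sup>2 * ln (2 * real n) + ln (2 / \<epsilon>))"
  shows "\<exists>E \<in> sets (PiM {..<m} (\<lambda>_. M)). measure (PiM {..<m} (\<lambda>_. M)) E \<ge> 1 - \<epsilon> \<and>
    (\<forall>x\<in>E. stable_samples s n m x)"
proof -
  let ?P = "PiM {..<m} (\<lambda>_. M)"
  interpret P: prob_space ?P
    by (intro prob_space_PiM prob_space_axioms)
  interpret PP: product_prob_space "\<lambda>_. M" "{..<m}" ..
  define \<psi> where "\<psi> = (\<lambda>j y. if cmod (phi j y) \<le> K then phi j y else 0)"
  have \<psi>_meas: "\<psi> j \<in> borel_measurable M" for j unfolding \<psi>_def by measurable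
  have \<psi>_bd: "cmod (\<psi> j y) \<le> K" for j y unfolding \<psi>_def using K_bound by auto
  define \<eta> where "\<eta> = 1 / (225000 * (K\<^sup>2 / a) * real s)"
  have \<eta>_eq: "\<eta> = a / (225000 * K\<^sup>2 * real s)" by (simp add: \<eta>_def)
  have Ka: "K\<^sup>2 / a \<ge> 1" using K_bound a_pos by simp
  obtain t where t: "\<And>k. (1/4)^t \<le> (real k + 3) * \<eta>"
    "\<And>k. real m * ((real k + 3) * \<eta>) \<ge> 1334 * (real t + 1)\<^sup>2 * ln (4 * real (2 ^ (k + 1) * n)) + ln (2 / (\<epsilon> * (1/2)^(k+1))) + 1"
    using sample_size_bookkeeping[OF Ka s n \<epsilon> mb] unfolding \<eta>_def by auto
  define g where "g = (\<lambda>k z y. \<Sum>j<2 ^ (k + 1) * n. z j * \<psi> j y)"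
  have "\<exists>F\<in>sets ?P. measure ?P F \<le> \<epsilon> * (1/2)^(k+1) \<and>
    (\<forall>x\<in>space ?P - F. \<forall>z.
      moments_agree M m x (g k z) (60 * ((real k + 3) * \<eta>) * K\<^sup>2 * (l1n (2 ^ (k + 1) * n) z)\<^sup>2))" for k
  proof -
    have "\<epsilon> * (1/2)^(k+1) \<le> 1 * 1" using \<epsilon> by (intro mult_mono power_le_one) auto
    then show ?thesis unfolding g_def
      using \<epsilon> n m K_bound t \<psi>_meas \<psi>_bd
      by (intro uniform_second_moment[where t = t]) auto
  qed
  then obtain F where F: "\<And>k. F k \<in> sets ?P" "\<And>k. measure ?P (F k) \<le> \<epsilon> * (1/2)^(k+1)"
    and Fx: "\<And>k. \<forall>x\<in>space ?P - F k. \<forall>z.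
      moments_agree M m x (g k z) (60 * ((real k + 3) * \<eta>) * K\<^sup>2 * (l1n (2 ^ (k + 1) * n) z)\<^sup>2)"
    unfolding Bex_def by moura
  define G where "G = {x\<in>space ?P. \<forall>i\<in>{..<m}. \<forall>j. cmod (phi j (x i)) \<le> K}"
  have G_meas: "G \<in> sets ?P" unfolding G_def by measurable
  have "AE x in ?P. \<forall>i\<in>{..<m}. \<forall>j. cmod (phi j (x i)) \<le> K"
    by (intro AE_finite_allI finite_lessThan PP.AE_component AE_bounded)
       (use AE_PiM_component[of "{..<m}" "\<lambda>_. M" _ "\<lambda>y. \<forall>j. cmod (phi j y) \<le> K"] prob_space_axioms AE_bounded in auto)
  then have G1: "measure ?P G = 1" unfolding G_def by (subst P.prob_Collect_eq_1) auto
  define U where "U = (\<Union>k. F k)"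
  have U_meas: "U \<in> sets ?P" unfolding U_def using F by auto
  have geo: "(\<lambda>k. \<epsilon> * (1/2)^(k+1)) sums \<epsilon>"
    using sums_mult[OF power_half_series, of \<epsilon>] by simp
  have sm: "summable (\<lambda>k. measure ?P (F k))"
    by (rule summable_comparison_test[OF _ sums_summable[OF geo]]) (use F in auto)
  have "measure ?P U \<le> (\<Sum>k. measure ?P (F k))"
    unfolding U_def using F sm by (intro P.finite_measure_subadditive_countably) auto
  also have "\<dots> \<le> (\<Sum>k. \<epsilon> * (1/2)^(k+1))" using F sm sums_summable[OF geo] by (intro suminf_le) auto
  also have "\<dots> = \<epsilon>" using geo by (simp add: sums_iff)
  finally have U\<epsilon>: "measure ?P U \<le> \<epsilon>" .
  have "measure ?P (G - U) = measure ?P G - measure ?P (G \<inter> U)"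
    by (intro P.finite_measure_Diff' G_meas U_meas)
  moreover have "measure ?P (G \<inter> U) \<le> measure ?P U" by (intro P.finite_measure_mono U_meas) auto
  ultimately have "measure ?P (G - U) \<ge> 1 - \<epsilon>" using U\<epsilon> G1 by linarith
  moreover have "G - U \<in> sets ?P" using G_meas U_meas by auto
  moreover have "stable_samples s n m x" if x: "x \<in> G - U" for x
  proof (rule stable_samplesI[OF s])
    fix k z
    have xk: "x \<in> space ?P - F k" using x by (auto simp: G_def U_def)
    have gx: "g k z (x i) = lincomb phi (2 ^ (k + 1) * n) z (x i)" if "i < m" for i
      using x that unfolding g_def lincomb_def \<psi>_def G_def by (intro sum.cong) auto
    have em: "emean m x (\<lambda>y. (cmod (g k z y))\<^sup>2) = (l2n m (mv (2 ^ (k + 1) * n) (sample_matrix m x phi) z))\<^sup>2"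
      using m gx by (subst emean_samples[symmetric]) (auto simp: emean_def)
    have g_meas[measurable]: "g k z \<in> borel_measurable M" unfolding g_def
      by (intro borel_measurable_sum borel_measurable_times \<psi>_meas) auto
    have "sq_norm M (g k z) = sq_norm M (lincomb phi (2 ^ (k + 1) * n) z)"
      using AE_bounded by (intro sq_norm_AE_cong, eventually_elim) (auto simp: g_def lincomb_def \<psi>_def)
    moreover have "expectation (\<lambda>y. (cmod (g k z y))\<^sup>2) = enn2real (sq_norm M (g k z))"
      unfolding sq_norm_def by (rule integral_eq_nn_integral) auto
    ultimately have ex: "expectation (\<lambda>y. (cmod (g k z y))\<^sup>2) = enn2real (sq_norm M (lincomb phi (2 ^ (k + 1) * n) z))"
      by simp
    note ln = lincomb_norm[where n = "2 ^ (k + 1) * n" and z = z]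
    have fin: "sq_norm M (lincomb phi (2 ^ (k + 1) * n) z) < top" using ln(2) by (rule le_less_trans) simp
    have e1: "a * (l2n (2 ^ (k + 1) * n) z)\<^sup>2 \<le> expectation (\<lambda>y. (cmod (g k z y))\<^sup>2)"
      using enn2real_mono[OF ln(1) fin] a_pos unfolding ex by simp
    have e2: "expectation (\<lambda>y. (cmod (g k z y))\<^sup>2) \<le> b * (l2n (2 ^ (k + 1) * n) z)\<^sup>2"
      using enn2real_mono[OF ln(2)] b_pos unfolding ex by simp
    have both: "2/25 * expectation (\<lambda>y. (cmod (g k z y))\<^sup>2) - 60 * ((real k + 3) * \<eta>) * K\<^sup>2 * (l1n (2 ^ (k + 1) * n) z)\<^sup>2
        \<le> emean m x (\<lambda>y. (cmod (g k z y))\<^sup>2)"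
      "emean m x (\<lambda>y. (cmod (g k z y))\<^sup>2)
        \<le> 13 * expectation (\<lambda>y. (cmod (g k z y))\<^sup>2) + 60 * ((real k + 3) * \<eta>) * K\<^sup>2 * (l1n (2 ^ (k + 1) * n) z)\<^sup>2"
      using Fx[of k] xk unfolding moments_agree_def by blast+
    show "2/25 * (a * (l2n (2 ^ (k + 1) * n) z)\<^sup>2) - 60 * ((real k + 3) * (a / (225000 * K\<^sup>2 * real s))) * K\<^sup>2 * (l1n (2 ^ (k + 1) * n) z)\<^sup>2
      \<le> (l2n m (mv (2 ^ (k + 1) * n) (sample_matrix m x phi) z))\<^sup>2"
      using both(1) e1 unfolding em \<eta>_eq by linarith
    show "(l2n m (mv (2 ^ (k + 1) * n) (sample_matrix m x phi) z))\<^sup>2 \<le>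
      13 * (b * (l2n (2 ^ (k + 1) * n) z)\<^sup>2) + 60 * ((real k + 3) * (a / (225000 * K\<^sup>2 * real s))) * K\<^sup>2 * (l1n (2 ^ (k + 1) * n) z)\<^sup>2"
      using both(2) e2 unfolding em \<eta>_eq by linarith
  qed (use m a_le_b in auto)
  ultimately show ?thesis by blast
qed

end

section \<open>Decay rates from the tail terms\<close>

text \<open>
  The average of the powers \<open>X j ^ u\<close> over \<open>J\<close> is at least \<open>X N ^ u\<close>, as \<open>X N\<close> is the smallest of them.
\<close>
lemma weighted_tail_rate:
  fixes X :: "nat \<Rightarrow> ennreal"
  assumes u: "u > 0" and p: "p > 0" and \<kappa>: "\<kappa> > 0" and J: "finite J" "J \<subseteq> I" "\<kappa> * p \<le> real (card J)"
    and X: "\<And>j. j \<in> J \<Longrightarrow> X N \<le> X j"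
  shows "X N \<le> ennreal ((1 / \<kappa>) powr (1 / u)) * enn_powr (ennreal (1 / p) * (\<Sum>\<^sub>\<infinity>j\<in>I. enn_powr (X j) u)) (1 / u)"
proof -
  have "ennreal (\<kappa> * p) * enn_powr (X N) u \<le> ennreal (real (card J)) * enn_powr (X N) u"
    using J(3) by (intro mult_right_mono ennreal_leI) auto
  also have "\<dots> = (\<Sum>j\<in>J. enn_powr (X N) u)" by (simp add: ennreal_of_nat_eq_real_of_nat)
  also have "\<dots> \<le> (\<Sum>j\<in>J. enn_powr (X j) u)" by (intro sum_mono enn_powr_mono u X)
  also have "\<dots> = (\<Sum>\<^sub>\<infinity>j\<in>J. enn_powr (X j) u)" using J by simp
  also have "\<dots> \<le> (\<Sum>\<^sub>\<infinity>j\<in>I. enn_powr (X j) u)"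
    using J by (intro infsum_mono_neutral) (auto intro: nonneg_summable_on_complete)
  finally have "ennreal (1 / p) * (ennreal (\<kappa> * p) * enn_powr (X N) u) \<le> ennreal (1 / p) * (\<Sum>\<^sub>\<infinity>j\<in>I. enn_powr (X j) u)"
    by (rule mult_left_mono) simp
  moreover have "ennreal (1 / p) * (ennreal (\<kappa> * p) * enn_powr (X N) u) = ennreal \<kappa> * enn_powr (X N) u"
    using p \<kappa> by (simp add: mult.assoc[symmetric] ennreal_mult[symmetric])
  ultimately have "ennreal \<kappa> * enn_powr (X N) u \<le> ennreal (1 / p) * (\<Sum>\<^sub>\<infinity>j\<in>I. enn_powr (X j) u)" by simp
  then have "enn_powr (ennreal \<kappa> * enn_powr (X N) u) (1 / u) \<le> enn_powr (ennreal (1 / p) * (\<Sum>\<^sub>\<infinity>j\<in>I. enn_powr (X j) u)) (1 / u)"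
    using u by (intro enn_powr_mono) auto
  moreover have "enn_powr (ennreal \<kappa> * enn_powr (X N) u) (1 / u) = ennreal (\<kappa> powr (1 / u)) * X N"
    using u \<kappa> by (simp add: enn_powr_mult enn_powr_powr_inverse)
  ultimately have "ennreal ((1 / \<kappa>) powr (1 / u)) * (ennreal (\<kappa> powr (1 / u)) * X N)
      \<le> ennreal ((1 / \<kappa>) powr (1 / u)) * enn_powr (ennreal (1 / p) * (\<Sum>\<^sub>\<infinity>j\<in>I. enn_powr (X j) u)) (1 / u)"
    by (intro mult_left_mono) auto
  moreover have "ennreal ((1 / \<kappa>) powr (1 / u)) * (ennreal (\<kappa> powr (1 / u)) * X N) = X N"
    using \<kappa> by (simp add: mult.assoc[symmetric] ennreal_mult[symmetric] powr_mult[symmetric])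
  ultimately show ?thesis by simp
qed

lemma best_approx_error_antimono: "i \<le> j \<Longrightarrow> best_approx_error j p c \<le> best_approx_error i p c"
  unfolding best_approx_error_def sparse_def by (intro INF_superset_mono) auto

lemma sq_norm_count_space: "sq_norm (count_space A) c = (\<integral>\<^sup>+j. ennreal ((cmod (c j))\<^sup>2) * indicator A j \<partial>count_space UNIV)"
  unfolding sq_norm_def by (rule nn_integral_count_space_indicator) auto

lemma tail_error_antimono: "i \<le> j \<Longrightarrow> tail_error j 2 c \<le> tail_error i 2 c"
  unfolding tail_error_def Lp_norm_2 sq_norm_count_space
  by (intro enn_powr_mono nn_integral_mono mult_left_mono) (auto simp: indicator_def)

definition W_term :: "nat \<Rightarrow> real \<Rightarrow> (nat \<Rightarrow> complex) \<Rightarrow> ennreal"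
  where "W_term s u c = enn_powr (ennreal (1 / real s) *
      (\<Sum>\<^sub>\<infinity>j\<in>{j. j > s}. enn_powr (best_approx_error j 2 c) u)) (1 / u)"

definition T_term :: "nat \<Rightarrow> real \<Rightarrow> (nat \<Rightarrow> complex) \<Rightarrow> ennreal"
  where "T_term n v c = enn_powr (ennreal (1 / real n) *
      (\<Sum>\<^sub>\<infinity>j\<in>{j. real j > real n / 2}. enn_powr (tail_error j 2 c) v)) (1 / v)"

lemma approx_tail_term_eq: "approx_tail_term s n u v c = W_term s u c + T_term n v c"
  by (simp add: approx_tail_term_def W_term_def T_term_def)

text \<open>
  The summability exponent \<open>u < 2\<close> gives a decay like $2^{-l/u}$ along dyadic indices, which is
  \<open>decay u ^ l\<close> times the critical rate $2^{-l/2}$.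
\<close>
definition decay :: "real \<Rightarrow> real"
  where "decay u = 2 powr (1 / 2 - 1 / u)"

lemma decay_bounds: "0 < u \<Longrightarrow> u < 2 \<Longrightarrow> 0 < decay u" "0 < u \<Longrightarrow> u < 2 \<Longrightarrow> decay u < 1"
proof -
  assume u: "0 < u" "u < 2"
  show "0 < decay u" by (simp add: decay_def)
  have "1 / 2 - 1 / u < 0" using u by (simp add: field_simps)
  then have "2 powr (1 / 2 - 1 / u) < 2 powr (0::real)" by (intro powr_less_mono) auto
  then show "decay u < 1" by (simp add: decay_def)
qed

lemma dyadic_rate: "u > 0 \<Longrightarrow> (1 / (2 ^ l / 2)) powr (1 / u) = 2 powr (1 / u) * ((1 / sqrt 2) ^ l * decay u ^ l)"
proof -
  assume u: "u > 0"
  have h: "1 / sqrt 2 = 2 powr (- (1 / 2 :: real))" by (simp add: powr_minus powr_half_sqrt field_simps)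
  have "(1 / sqrt 2) * decay u = 2 powr (- (1 / u))"
    unfolding h decay_def powr_add[symmetric] by simp
  then have "(1 / sqrt 2) ^ l * decay u ^ l = (2 powr (- (1 / u))) ^ l" by (simp flip: power_mult_distrib)
  also have "\<dots> = 2 powr (- (1 / u) * real l)" by (simp add: powr_powr flip: powr_realpow)
  finally have 1: "2 powr (1 / u) * ((1 / sqrt 2) ^ l * decay u ^ l) = 2 powr (1 / u + - (1 / u) * real l)"
    by (simp only: powr_add)
  have "(1 / (2 ^ l / 2)) = 2 powr (1 - real l)" by (simp add: powr_diff powr_realpow)
  then have "(1 / (2 ^ l / 2)) powr (1 / u) = 2 powr ((1 - real l) * (1 / u))" by (simp only: powr_powr)
  also have "(1 - real l) * (1 / u) = 1 / u + - (1 / u) * real l" by (simp add: algebra_simps)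
  finally show ?thesis using 1 by simp
qed

lemma best_approx_rate:
  assumes u: "0 < u" and s: "s \<ge> 1" and l: "l \<ge> 1"
  shows "best_approx_error (s * 2 ^ l) 2 c \<le> ennreal (2 powr (1 / u) * ((1 / sqrt 2) ^ l * decay u ^ l)) * W_term s u c"
  unfolding W_term_def dyadic_rate[OF u, symmetric]
proof (rule weighted_tail_rate[where J = "{s<..s * 2 ^ l}"])
  have "(2::real) ^ 1 \<le> 2 ^ l" using l by (intro power_increasing) auto
  then have "real s * 2 \<le> real s * 2 ^ l" by (intro mult_left_mono) auto
  then show "2 ^ l / 2 * real s \<le> real (card {s<..s * 2 ^ l})" by (simp add: of_nat_diff field_simps)
qed (use u s in \<open>auto intro!: best_approx_error_antimono\<close>)

lemma tail_rate:
  assumes v: "0 < v" and n: "n \<ge> 1"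
  shows "tail_error (2 ^ k * n) 2 c \<le> ennreal (2 powr (1 / v) * ((1 / sqrt 2) ^ k * decay v ^ k)) * T_term n v c"
  unfolding T_term_def dyadic_rate[OF v, symmetric]
proof (rule weighted_tail_rate[where J = "{n div 2<..2 ^ k * n}"])
  have "1 * n \<le> 2 ^ k * n" by (intro mult_right_mono) auto
  then have le: "n div 2 \<le> 2 ^ k * n" by linarith
  have "real (n div 2) \<le> real n / 2" by linarith
  also have "\<dots> \<le> 2 ^ k * real n / 2" using mult_right_mono[of 1 "2 ^ k" "real n"] by simp
  finally show "2 ^ k / 2 * real n \<le> real (card {n div 2<..2 ^ k * n})" using le by (simp add: of_nat_diff field_simps)
qed (use v n in \<open>auto intro!: tail_error_antimono\<close>)

text \<open>
  The infimum need not be attained, so a support is only available for each strictly larger error.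
\<close>
lemma near_best_support:
  assumes "best_approx_error k 2 c < ennreal w" "w \<ge> 0"
  shows "\<exists>S. finite S \<and> card S \<le> k \<and> (\<forall>F. finite F \<longrightarrow> L2_set (\<lambda>j. cmod (c j)) (F - S) \<le> w)"
proof -
  obtain z where z: "sparse k z" "seq_norm 2 (\<lambda>i. c i - z i) < ennreal w"
    using assms(1) unfolding best_approx_error_def INF_less_iff by auto
  have "L2_set (\<lambda>j. cmod (c j)) (F - {i. z i \<noteq> 0}) \<le> w" if F: "finite F" for F
  proof -
    have "(\<Sum>j\<in>F - {i. z i \<noteq> 0}. ennreal ((cmod (c j))\<^sup>2)) = (\<Sum>j\<in>F - {i. z i \<noteq> 0}. ennreal ((cmod (c j - z j))\<^sup>2))"
      by (intro sum.cong) auto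
    also have "\<dots> \<le> sq_norm (count_space UNIV) (\<lambda>i. c i - z i)"
      using F by (intro sq_norm_count_ge_sum) auto
    also have "\<dots> \<le> ennreal (w\<^sup>2)" unfolding sq_norm_le_iff[OF assms(2)] using z(2) by simp
    finally have "(\<Sum>j\<in>F - {i. z i \<noteq> 0}. (cmod (c j))\<^sup>2) \<le> w\<^sup>2"
      by (subst (asm) sum_ennreal) auto
    then show ?thesis unfolding L2_set_def using assms(2) by (rule real_le_lsqrt[rotated])
  qed
  then show ?thesis using z(1) by (intro exI[of _ "{i. z i \<noteq> 0}"]) (auto simp: sparse_def)
qed

lemma tail_block_le:
  assumes "tail_error N 2 c \<le> ennreal w" "w \<ge> 0" "finite F" "F \<subseteq> {N..}"
  shows "L2_set (\<lambda>j. cmod (c j)) F \<le> w"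
proof -
  have "(\<Sum>j\<in>F. ennreal ((cmod (c j))\<^sup>2)) \<le> sq_norm (count_space {N..}) c"
    using assms by (intro sq_norm_count_ge_sum) auto
  also have "\<dots> \<le> ennreal (w\<^sup>2)" using assms(1) unfolding sq_norm_le_iff[OF assms(2)] tail_error_def .
  finally have "(\<Sum>j\<in>F. (cmod (c j))\<^sup>2) \<le> w\<^sup>2" by (subst (asm) sum_ennreal) auto
  then show ?thesis unfolding L2_set_def using assms(2) by (rule real_le_lsqrt[rotated])
qed

definition noise_const :: "real \<Rightarrow> real \<Rightarrow> real"
  where "noise_const u v = 6 * lin_geom (decay v) * 2 powr (1 / v) + 2 * lin_geom (decay u) / (1 - decay u) * 2 powr (1 / u)"

lemma noise_const_pos: "0 < u \<Longrightarrow> u < 2 \<Longrightarrow> 0 < v \<Longrightarrow> v < 2 \<Longrightarrow> noise_const u v > 0"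
  unfolding noise_const_def using decay_bounds[of u] decay_bounds[of v]
  by (intro add_pos_pos mult_pos_pos divide_pos_pos lin_geom_sums) auto

lemma le_of_le_add_eps:
  fixes h p q :: real
  assumes "q \<ge> 0" "\<And>\<xi>. \<xi> > 0 \<Longrightarrow> h \<le> p + q * \<xi>"
  shows "h \<le> p"
proof (rule field_le_epsilon)
  fix e :: real assume e: "e > 0"
  have "h \<le> p + q * (e / (q + 1))" using assms e by (intro assms(2)) auto
  also have "q * (e / (q + 1)) \<le> e" using assms(1) e by (simp add: field_simps)
  finally show "h \<le> p + e" by simp
qed

text \<open>
  Supports for the best approximation errors exist only with an arbitrarily small loss \<open>\<xi>\<close> in \<open>W\<close>,
  which is removed at the end. Being additive, the loss also covers the case \<open>W = 0\<close>.
\<close>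
lemma (in riesz) sample_noise_bound:
  assumes u: "0 < u" "u < 2" and v: "0 < v" "v < 2" and s: "s \<ge> 1" and n: "n \<ge> 1"
    and W: "W_term s u c = ennreal W" "W \<ge> 0" and T: "T_term n v c = ennreal T" "T \<ge> 0"
    and st: "stable_samples s n m x"
    and conv: "\<And>i. i < m \<Longrightarrow> (\<lambda>k. lincomb phi (2 ^ k * n) c (x i)) \<longlonglongrightarrow> f (x i)"
  shows "l2n m (\<lambda>i. mv n (sample_matrix m x phi) c i - sample_vector m x f i) \<le> sqrt b * noise_const u v * (W + T)"
    (is "?L \<le> _")
proof -
  note du = decay_bounds[OF u] and dv = decay_bounds[OF v]
  have pos: "0 < 6 * lin_geom (decay v)" "0 < 2 * lin_geom (decay u) / (1 - decay u)"
    using du dv lin_geom_sums(3)[OF du] lin_geom_sums(3)[OF dv] by auto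
  have eps: "?L \<le> sqrt b * (6 * lin_geom (decay v) * (2 powr (1 / v) * T) + 2 * lin_geom (decay u) / (1 - decay u) * (2 powr (1 / u) * W))
     + sqrt b * (2 * lin_geom (decay u) / (1 - decay u) * 2 powr (1 / u)) * \<xi>" if \<xi>: "\<xi> > 0" for \<xi>
  proof -
    define W' where "W' = 2 powr (1 / u) * (W + \<xi>)"
    have W': "W' > 0" using W \<xi> by (simp add: W'_def)
    have "\<exists>S. finite S \<and> card S \<le> s * 2 ^ l \<and>
        (\<forall>F. finite F \<longrightarrow> L2_set (\<lambda>j. cmod (c j)) (F - S) \<le> (1 / sqrt 2) ^ l * decay u ^ l * W')" if l: "l \<ge> 1" for l
    proof (rule near_best_support)
      have "best_approx_error (s * 2 ^ l) 2 c \<le> ennreal (2 powr (1 / u) * ((1 / sqrt 2) ^ l * decay u ^ l)) * ennreal W"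
        using best_approx_rate[OF u(1) s l, of c] unfolding W .
      also have "\<dots> = ennreal ((1 / sqrt 2) ^ l * decay u ^ l * (2 powr (1 / u) * W))"
        using W du by (simp add: ennreal_mult[symmetric] mult_ac)
      also have "\<dots> < ennreal ((1 / sqrt 2) ^ l * decay u ^ l * W')"
        unfolding W'_def using W du \<xi> by (intro ennreal_lessI mult_strict_left_mono mult_pos_pos) auto
      finally show "best_approx_error (s * 2 ^ l) 2 c < ennreal ((1 / sqrt 2) ^ l * decay u ^ l * W')" .
    qed (use du W' in auto)
    then obtain S where S: "\<And>l. l \<ge> 1 \<Longrightarrow> finite (S l)" "\<And>l. l \<ge> 1 \<Longrightarrow> card (S l) \<le> s * 2 ^ l"
      "\<And>l F. l \<ge> 1 \<Longrightarrow> finite F \<Longrightarrow> L2_set (\<lambda>j. cmod (c j)) (F - S l) \<le> (1 / sqrt 2) ^ l * decay u ^ l * W'"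
      by metis
    have tl: "L2_set (\<lambda>j. cmod (c j)) {2 ^ k * n..<2 ^ (k + 1) * n} \<le> (1 / sqrt 2) ^ k * decay v ^ k * (2 powr (1 / v) * T)" for k
    proof (rule tail_block_le)
      have "tail_error (2 ^ k * n) 2 c \<le> ennreal (2 powr (1 / v) * ((1 / sqrt 2) ^ k * decay v ^ k)) * ennreal T"
        using tail_rate[OF v(1) n, where c = c] unfolding T .
      also have "\<dots> = ennreal ((1 / sqrt 2) ^ k * decay v ^ k * (2 powr (1 / v) * T))"
        using T dv by (simp add: ennreal_mult[symmetric] mult_ac)
      finally show "tail_error (2 ^ k * n) 2 c \<le> ennreal ((1 / sqrt 2) ^ k * decay v ^ k * (2 powr (1 / v) * T))" .
    qed (use T dv in auto)
    have cv: "(\<lambda>k. \<Sum>j<2 ^ k * n. sample_matrix m x phi i j * c j) \<longlonglongrightarrow> sample_vector m x f i" if "i < m" for i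
    proof -
      have "(\<lambda>k. lincomb phi (2 ^ k * n) c (x i) / of_real (sqrt (real m))) \<longlonglongrightarrow> f (x i) / of_real (sqrt (real m))"
        using that by (intro tendsto_divide conv tendsto_const) auto
      then show ?thesis by (simp add: lincomb_def sample_matrix_def sample_vector_def sum_divide_distrib mult.commute)
    qed
    have "?L \<le> sqrt b * (6 * lin_geom (decay v) * (2 powr (1 / v) * T) + 2 * lin_geom (decay u) / (1 - decay u) * W')"
    proof (rule tail_noise_bound[OF s n dv du])
      show "l2n m (mv (2 ^ (k + 1) * n) (sample_matrix m x phi) z)
          \<le> sqrt b * (4 * l2n (2 ^ (k + 1) * n) z + sqrt ((real k + 3) / real s) * l1n (2 ^ (k + 1) * n) z)" for k z
        using st[unfolded stable_samples_def, THEN conjunct2, THEN spec, THEN spec, of k z] .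
    qed (fact tl S cv | use T W' b_pos in simp)+
    then show ?thesis unfolding W'_def by (simp add: algebra_simps)
  qed
  have "?L \<le> sqrt b * (6 * lin_geom (decay v) * (2 powr (1 / v) * T) + 2 * lin_geom (decay u) / (1 - decay u) * (2 powr (1 / u) * W))"
  proof (rule le_of_le_add_eps[rotated, OF eps])
    show "0 \<le> sqrt b * (2 * lin_geom (decay u) / (1 - decay u) * 2 powr (1 / u))"
      using pos b_pos by (intro mult_nonneg_nonneg) auto
  qed
  also have "\<dots> \<le> sqrt b * (noise_const u v * (W + T))"
  proof (intro mult_left_mono)
    have "noise_const u v * (W + T) = 6 * lin_geom (decay v) * (2 powr (1 / v) * T) + 2 * lin_geom (decay u) / (1 - decay u) * (2 powr (1 / u) * W)
      + (6 * lin_geom (decay v) * (2 powr (1 / v) * W) + 2 * lin_geom (decay u) / (1 - decay u) * (2 powr (1 / u) * T))"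
      unfolding noise_const_def by algebra
    moreover have "0 \<le> 6 * lin_geom (decay v) * (2 powr (1 / v) * W) + 2 * lin_geom (decay u) / (1 - decay u) * (2 powr (1 / u) * T)"
      using pos W T by (intro add_nonneg_nonneg mult_nonneg_nonneg) auto
    ultimately show "6 * lin_geom (decay v) * (2 powr (1 / v) * T) + 2 * lin_geom (decay u) / (1 - decay u) * (2 powr (1 / u) * W) \<le> noise_const u v * (W + T)"
      by linarith
  qed (use b_pos in auto)
  finally show ?thesis by (simp add: mult.assoc)
qed

section \<open>From coefficients to functions\<close>

lemma sq_norm_count_split: "sq_norm (count_space UNIV) d = ennreal ((l2n n d)\<^sup>2) + sq_norm (count_space {n..}) d"
proof -
  have "sq_norm (count_space UNIV) d = (\<integral>\<^sup>+j. ennreal ((cmod (d j))\<^sup>2) * indicator {..<n} j + ennreal ((cmod (d j))\<^sup>2) * indicator {n..} j \<partial>count_space UNIV)"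
    unfolding sq_norm_def by (intro nn_integral_cong) (auto simp: indicator_def)
  also have "\<dots> = sq_norm (count_space {..<n}) d + sq_norm (count_space {n..}) d"
    unfolding sq_norm_count_space by (rule nn_integral_add) auto
  also have "sq_norm (count_space {..<n}) d = (\<Sum>j<n. ennreal ((cmod (d j))\<^sup>2))"
    unfolding sq_norm_def by (rule nn_integral_count_space_finite) auto
  also have "\<dots> = ennreal ((l2n n d)\<^sup>2)"
    by (subst sum_ennreal) (auto simp: L2_set_def sum_nonneg)
  finally show ?thesis .
qed

text \<open>
  Countable quantifiers only, so that convergence defines a measurable set.
\<close>
lemma nat_quantified_LIMSEQ:
  fixes X :: "nat \<Rightarrow> complex"
  shows "X \<longlonglongrightarrow> L \<longleftrightarrow> (\<forall>e::nat. \<exists>N. \<forall>k. N \<le> k \<longrightarrow> cmod (X k - L) < 1 / (real e + 1))"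
proof
  assume "X \<longlonglongrightarrow> L"
  then show "\<forall>e::nat. \<exists>N. \<forall>k. N \<le> k \<longrightarrow> cmod (X k - L) < 1 / (real e + 1)"
    unfolding LIMSEQ_iff by (intro allI) (drule spec, erule impE, auto)
next
  assume *: "\<forall>e::nat. \<exists>N. \<forall>k. N \<le> k \<longrightarrow> cmod (X k - L) < 1 / (real e + 1)"
  show "X \<longlonglongrightarrow> L"
    unfolding LIMSEQ_iff
  proof (intro allI impI)
    fix r :: real assume "r > 0"
    then obtain e :: nat where e: "inverse (real (Suc e)) < r" using reals_Archimedean by blast
    obtain N where N: "\<forall>k. N \<le> k \<longrightarrow> cmod (X k - L) < 1 / (real e + 1)" using * by blast
    have "cmod (X k - L) < r" if "k \<ge> N" for k
    proof -
      have "cmod (X k - L) < 1 / (real e + 1)" using N that by blast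
      also have "\<dots> = inverse (real (Suc e))" by (simp add: inverse_eq_divide add.commute)
      finally show ?thesis using e by simp
    qed
    then show "\<exists>no. \<forall>k\<ge>no. cmod (X k - L) < r" by blast
  qed
qed

text \<open>
  The sum of \<open>\<bar>f - g k\<bar>\<^sup>2\<close> over \<open>k\<close> has a finite integral, so it is finite almost everywhere and its terms
  tend to 0.
\<close>
lemma AE_tendsto_if_sq_norm_geometric:
  assumes [measurable]: "f \<in> borel_measurable M" "\<And>k. g k \<in> borel_measurable M"
    and sq: "\<And>k. sq_norm M (\<lambda>y. f y - g k y) \<le> ennreal (C * r ^ k)" and r: "0 \<le> r" "r < 1" and C: "C \<ge> 0"
  shows "AE y in M. (\<lambda>k. g k y) \<longlonglongrightarrow> f y"
proof -
  have "(\<integral>\<^sup>+y. (\<Sum>k. ennreal ((cmod (f y - g k y))\<^sup>2)) \<partial>M) = (\<Sum>k. sq_norm M (\<lambda>y. f y - g k y))"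
    unfolding sq_norm_def by (rule nn_integral_suminf) auto
  also have "\<dots> \<le> (\<Sum>k. ennreal (C * r ^ k))"
    by (intro suminf_le sq) auto
  also have "\<dots> < \<infinity>"
    using C r by (subst suminf_ennreal2) (auto intro!: summable_mult summable_geometric)
  finally have "(\<integral>\<^sup>+y. (\<Sum>k. ennreal ((cmod (f y - g k y))\<^sup>2)) \<partial>M) \<noteq> \<infinity>" by simp
  then have "AE y in M. (\<Sum>k. ennreal ((cmod (f y - g k y))\<^sup>2)) \<noteq> \<infinity>"
    by (intro nn_integral_PInf_AE) auto
  then show ?thesis
  proof eventually_elim
    case (elim y)
    then have "summable (\<lambda>k. (cmod (f y - g k y))\<^sup>2)"
      by (intro summable_suminf_not_top) auto
    then have "(\<lambda>k. (cmod (f y - g k y))\<^sup>2) \<longlonglongrightarrow> 0" by (rule summable_LIMSEQ_zero)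
    then have "(\<lambda>k. sqrt ((cmod (f y - g k y))\<^sup>2)) \<longlonglongrightarrow> sqrt 0" by (rule tendsto_real_sqrt)
    then have "(\<lambda>k. cmod (g k y - f y)) \<longlonglongrightarrow> 0" by (simp add: norm_minus_commute)
    then show ?case by (simp add: tendsto_norm_zero_iff LIM_zero_iff)
  qed
qed

context riesz
begin

text \<open>
  The points at which the samples of \<open>f\<close> are useless. Convergence along the dyadic partial sums is
  all that the noise estimate needs and, unlike convergence of the full series, it follows
  almost everywhere from the decay of the tails.
\<close>
definition dyadic_exceptions :: "nat \<Rightarrow> (nat \<Rightarrow> complex) \<Rightarrow> ('a \<Rightarrow> complex) \<Rightarrow> 'a set"
  where "dyadic_exceptions n c f = {y \<in> space M. \<not> (\<lambda>k. lincomb phi (2 ^ k * n) c y) \<longlonglongrightarrow> f y}"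

lemma dyadic_exceptions_not_sums:
  assumes n: "n \<ge> 1" and y: "y \<in> dyadic_exceptions n c f"
  shows "\<not> (\<lambda>i. c i * phi i y) sums f y"
proof
  assume "(\<lambda>i. c i * phi i y) sums f y"
  then have "(\<lambda>N. lincomb phi N c y) \<longlonglongrightarrow> f y" by (simp add: sums_def lincomb_def)
  moreover have "filterlim (\<lambda>k. 2 ^ k * n) at_top sequentially"
  proof (rule filterlim_at_top_mono[OF filterlim_ident])
    show "\<forall>\<^sub>F k in sequentially. k \<le> 2 ^ k * n"
    proof (intro always_eventually allI)
      fix k :: nat
      have "k * 1 \<le> 2 ^ k * n" using n by (intro mult_mono) (auto intro: less_imp_le less_exp)
      then show "k \<le> 2 ^ k * n" by simp
    qed
  qed
  ultimately have "(\<lambda>k. lincomb phi (2 ^ k * n) c y) \<longlonglongrightarrow> f y"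
    by (rule filterlim_compose)
  with y show False by (simp add: dyadic_exceptions_def)
qed

lemma residual_sq_norm:
  assumes f: "f \<in> borel_measurable M" and e: "L2_expansion M phi c f" and fin: "sq_norm (count_space {n..}) c < \<infinity>"
  shows "sq_norm M (\<lambda>y. f y - lincomb phi n z y) \<le> ennreal b * (ennreal ((l2n n (\<lambda>j. c j - z j))\<^sup>2) + sq_norm (count_space {n..}) c)"
proof -
  let ?d = "\<lambda>j. c j - trunc n z j"
  have [measurable]: "f \<in> borel_measurable M" by (rule f)
  have "l2n n ?d = l2n n (\<lambda>j. c j - z j)" by (intro L2_set_cong) (auto simp: trunc_def)
  moreover have "sq_norm (count_space {n..}) ?d = sq_norm (count_space {n..}) c"
    unfolding sq_norm_def by (intro nn_integral_cong) (auto simp: trunc_def)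
  ultimately have eq: "sq_norm (count_space UNIV) ?d = ennreal ((l2n n (\<lambda>j. c j - z j))\<^sup>2) + sq_norm (count_space {n..}) c"
    using sq_norm_count_split[of ?d n] by simp
  have "sq_norm (count_space UNIV) ?d < \<infinity>" unfolding eq using fin by (simp add: less_top)
  then show ?thesis using expansion_norm(2)[OF _ _ expansion_diff[OF e], of n z] unfolding eq by simp
qed

lemma residual_norm:
  assumes f: "f \<in> borel_measurable M" and e: "L2_expansion M phi c f" and t: "tail_error n 2 c \<le> ennreal \<tau>" "\<tau> \<ge> 0"
  shows "Lp_norm 2 M (\<lambda>y. f y - lincomb phi n z y) \<le> ennreal (sqrt b * (l2n n (\<lambda>j. c j - z j) + \<tau>))"
proof (rule Lp_norm_2_le)
  let ?l = "l2n n (\<lambda>j. c j - z j)"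
  have t2: "sq_norm (count_space {n..}) c \<le> ennreal (\<tau>\<^sup>2)" using t unfolding sq_norm_le_iff[OF t(2)] tail_error_def by simp
  then have "sq_norm (count_space {n..}) c < \<infinity>" by (rule le_less_trans) simp
  note residual_sq_norm[OF f e this, of z]
  also have "ennreal b * (ennreal (?l\<^sup>2) + sq_norm (count_space {n..}) c) \<le> ennreal b * (ennreal (?l\<^sup>2) + ennreal (\<tau>\<^sup>2))"
    using t2 by (intro mult_left_mono add_left_mono) auto
  also have "\<dots> = ennreal (b * (?l\<^sup>2 + \<tau>\<^sup>2))"
    using b_pos by (simp add: ennreal_plus[symmetric] ennreal_mult[symmetric] del: ennreal_plus)
  also have "\<dots> \<le> ennreal ((sqrt b * (?l + \<tau>))\<^sup>2)"
    using b_pos t(2) by (intro ennreal_leI) (simp add: power_mult_distrib power2_sum)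
  finally show "sq_norm M (\<lambda>y. f y - lincomb phi n z y) \<le> ennreal ((sqrt b * (?l + \<tau>))\<^sup>2)" .
qed (use b_pos t in auto)

lemma dyadic_exceptions_null:
  assumes f: "f \<in> borel_measurable M" and e: "L2_expansion M phi c f" and x: "0 < x" "x < 1" and T: "T \<ge> 0"
    and tail: "\<And>k. tail_error (2 ^ k * n) 2 c \<le> ennreal ((1 / sqrt 2) ^ k * x ^ k * T)"
  shows "dyadic_exceptions n c f \<in> null_sets M"
proof -
  have [measurable]: "f \<in> borel_measurable M" by (rule f)
  define r where "r = ((1 / sqrt 2) * x)\<^sup>2"
  have r: "0 \<le> r" "r < 1"
  proof -
    show "0 \<le> r" by (simp add: r_def)
    have "(1 / sqrt 2) * x < 1 * 1" using x by (intro mult_strict_mono) auto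
    then show "r < 1" unfolding r_def using x by (intro power_less_one_iff[THEN iffD2]) auto
  qed
  have sq: "sq_norm M (\<lambda>y. f y - lincomb phi (2 ^ k * n) c y) \<le> ennreal (b * T\<^sup>2 * r ^ k)" for k
  proof -
    have t0: "0 \<le> (1 / sqrt 2) ^ k * x ^ k * T" using x T by auto
    have "Lp_norm 2 M (\<lambda>y. f y - lincomb phi (2 ^ k * n) c y) \<le> ennreal (sqrt b * (l2n (2 ^ k * n) (\<lambda>j. c j - c j) + (1 / sqrt 2) ^ k * x ^ k * T))"
      by (rule residual_norm[OF f e tail t0])
    also have "l2n (2 ^ k * n) (\<lambda>j. c j - c j) = 0" by (simp add: L2_set_def)
    finally have "sq_norm M (\<lambda>y. f y - lincomb phi (2 ^ k * n) c y) \<le> ennreal ((sqrt b * (0 + (1 / sqrt 2) ^ k * x ^ k * T))\<^sup>2)"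
      using t0 b_pos by (subst sq_norm_le_iff) auto
    also have "(sqrt b * (0 + (1 / sqrt 2) ^ k * x ^ k * T))\<^sup>2 = b * T\<^sup>2 * r ^ k"
      using b_pos unfolding r_def by (simp add: power_mult_distrib power_mult[symmetric] mult.commute[of 2 k] mult_ac)
        (simp add: power_mult power_divide)
    finally show ?thesis .
  qed
  have ae: "AE y in M. (\<lambda>k. lincomb phi (2 ^ k * n) c y) \<longlonglongrightarrow> f y"
    using b_pos r by (intro AE_tendsto_if_sq_norm_geometric[OF _ _ sq]) auto
  have meas: "dyadic_exceptions n c f \<in> sets M"
    unfolding dyadic_exceptions_def nat_quantified_LIMSEQ by measurable
  show ?thesis
    using ae meas by (subst AE_iff_null_sets) (auto simp: dyadic_exceptions_def elim: eventually_mono)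
qed

lemma residual_bounded:
  assumes null: "dyadic_exceptions n c f \<in> null_sets M" and t: "tail_error n 1 c \<le> ennreal \<tau>" "\<tau> \<ge> 0"
  shows "AE y in M. cmod (f y - lincomb phi n z y) \<le> K * (l1n n (\<lambda>j. c j - z j) + \<tau>)"
proof -
  have one: "enn_powr w 1 = w" for w by (cases w) (auto simp: enn_powr_def)
  have sum_t: "(\<Sum>j\<in>F. cmod (c j)) \<le> \<tau>" if "finite F" "F \<subseteq> {n..}" for F
  proof -
    have "(\<Sum>j\<in>F. ennreal (cmod (c j))) = (\<integral>\<^sup>+j. ennreal (cmod (c j)) \<partial>count_space F)"
      using that by (simp add: nn_integral_count_space_finite)
    also have "\<dots> = (\<integral>\<^sup>+j. ennreal (cmod (c j)) * indicator F j \<partial>count_space UNIV)"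
      by (rule nn_integral_count_space_indicator) auto
    also have "\<dots> \<le> (\<integral>\<^sup>+j. ennreal (cmod (c j)) * indicator {n..} j \<partial>count_space UNIV)"
      using that by (intro nn_integral_mono) (auto simp: indicator_def)
    also have "\<dots> = (\<integral>\<^sup>+j. ennreal (cmod (c j)) \<partial>count_space {n..})"
      by (rule nn_integral_count_space_indicator[symmetric]) auto
    also have "\<dots> = tail_error n 1 c"
      by (simp add: tail_error_def Lp_norm_def one)
    finally have "ennreal (\<Sum>j\<in>F. cmod (c j)) \<le> ennreal \<tau>" using t(1) by (subst (asm) sum_ennreal) auto
    then show ?thesis using t(2) by simp
  qed
  have "AE y in M. y \<notin> dyadic_exceptions n c f" using null by (rule AE_not_in)
  moreover have "AE y in M. y \<in> space M" by (rule AE_space)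
  ultimately show ?thesis using AE_bounded
  proof eventually_elim
    case (elim y)
    then have lim: "(\<lambda>k. lincomb phi (2 ^ k * n) c y) \<longlonglongrightarrow> f y" by (simp add: dyadic_exceptions_def)
    have "cmod (lincomb phi (2 ^ k * n) c y - lincomb phi n z y) \<le> K * (l1n n (\<lambda>j. c j - z j) + \<tau>)" for k
    proof -
      have le: "n \<le> 2 ^ k * n" by simp
      have "lincomb phi (2 ^ k * n) c y = lincomb phi n c y + (\<Sum>j\<in>{n..<2 ^ k * n}. c j * phi j y)"
        unfolding lincomb_def lessThan_atLeast0 using le by (subst sum.atLeastLessThan_concat) auto
      then have "lincomb phi (2 ^ k * n) c y - lincomb phi n z y = (\<Sum>j<n. (c j - z j) * phi j y) + (\<Sum>j\<in>{n..<2 ^ k * n}. c j * phi j y)"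
        by (simp add: lincomb_def left_diff_distrib sum_subtractf)
      also have "cmod \<dots> \<le> (\<Sum>j<n. cmod ((c j - z j) * phi j y)) + (\<Sum>j\<in>{n..<2 ^ k * n}. cmod (c j * phi j y))"
        by (intro order_trans[OF norm_triangle_ineq] add_mono norm_sum)
      also have "\<dots> \<le> (\<Sum>j<n. K * cmod (c j - z j)) + (\<Sum>j\<in>{n..<2 ^ k * n}. K * cmod (c j))"
        using elim by (intro add_mono sum_mono) (auto simp: norm_mult mult.commute[of K] intro!: mult_left_mono)
      also have "\<dots> = K * (l1n n (\<lambda>j. c j - z j) + (\<Sum>j\<in>{n..<2 ^ k * n}. cmod (c j)))"
        by (simp add: sum_distrib_left distrib_left)
      also have "\<dots> \<le> K * (l1n n (\<lambda>j. c j - z j) + \<tau>)"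
        using K_bound by (intro mult_left_mono add_left_mono sum_t) auto
      finally show ?thesis .
    qed
    moreover have "(\<lambda>k. cmod (lincomb phi (2 ^ k * n) c y - lincomb phi n z y)) \<longlonglongrightarrow> cmod (f y - lincomb phi n z y)"
      by (intro tendsto_intros lim)
    ultimately show ?case by (intro LIMSEQ_le_const2) auto
  qed
qed

end

text \<open>
  \<open>\<bar>h\<bar>\<^sup>p \<le> B\<^sup>p\<^sup>-\<^sup>2 \<bar>h\<bar>\<^sup>2\<close>. With \<open>1/\<infinity> = 0\<close> the exponents are also right for \<open>p = \<infinity>\<close>.
\<close>
lemma Lp_norm_interpolation:
  assumes h: "h \<in> borel_measurable M" and B: "AE y in M. cmod (h y) \<le> B" "B > 0"
    and A: "Lp_norm 2 M h \<le> ennreal A" "A > 0" and p: "p > 2"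
  shows "Lp_norm p M h \<le> ennreal (A powr (2 * enn2real (1 / p)) * B powr (1 - 2 * enn2real (1 / p)))"
proof (cases "p = \<infinity>")
  case True
  have [measurable]: "h \<in> borel_measurable M" by (rule h)
  have "esssup M (\<lambda>x. ennreal (cmod (h x))) \<le> ennreal B"
    using B by (intro esssup_I) (auto intro: ennreal_leI elim!: eventually_mono)
  then show ?thesis using True B A by (simp add: Lp_norm_def)
next
  case False
  have [measurable]: "h \<in> borel_measurable M" by (rule h)
  obtain q where q: "p = ennreal q" "q \<ge> 0" using False by (cases p) auto
  have q2: "q > 2" using p q by (simp add: ennreal_less_iff flip: ennreal_numeral)
  have r: "enn2real (1 / p) = 1 / q"
  proof -
    have "1 / p = ennreal (1 / q)" using q2 by (simp add: q(1) divide_ennreal flip: ennreal_1)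
    then show ?thesis using q2 by simp
  qed
  have sqA: "sq_norm M h \<le> ennreal (A\<^sup>2)" using A by (subst sq_norm_le_iff) auto
  have "(\<integral>\<^sup>+x. ennreal (cmod (h x) powr q) \<partial>M) \<le> (\<integral>\<^sup>+x. ennreal (B powr (q - 2)) * ennreal ((cmod (h x))\<^sup>2) \<partial>M)"
  proof (rule nn_integral_mono_AE)
    show "AE x in M. ennreal (cmod (h x) powr q) \<le> ennreal (B powr (q - 2)) * ennreal ((cmod (h x))\<^sup>2)"
      using B(1)
    proof eventually_elim
      case (elim x)
      have "cmod (h x) powr q = cmod (h x) powr (q - 2) * cmod (h x) powr 2"
        unfolding powr_add[symmetric] by simp
      also have "\<dots> \<le> B powr (q - 2) * (cmod (h x))\<^sup>2"
        using elim q2 by (intro mult_mono powr_mono2) (auto simp: powr_numeral)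
      finally show ?case by (simp add: ennreal_mult[symmetric] ennreal_leI)
    qed
  qed
  also have "\<dots> = ennreal (B powr (q - 2)) * sq_norm M h"
    unfolding sq_norm_def by (rule nn_integral_cmult) auto
  also have "\<dots> \<le> ennreal (B powr (q - 2)) * ennreal (A\<^sup>2)" using sqA by (intro mult_left_mono) auto
  also have "\<dots> = ennreal (B powr (q - 2) * A powr 2)" using A by (simp add: ennreal_mult[symmetric] powr_numeral)
  finally have "enn_powr (\<integral>\<^sup>+x. ennreal (cmod (h x) powr q) \<partial>M) (1 / q) \<le> enn_powr (ennreal (B powr (q - 2) * A powr 2)) (1 / q)"
    using q2 by (intro enn_powr_mono) auto
  also have "\<dots> = ennreal ((B powr (q - 2) * A powr 2) powr (1 / q))" by (simp add: enn_powr_ennreal)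
  also have "(B powr (q - 2) * A powr 2) powr (1 / q) = A powr (2 * (1 / q)) * B powr (1 - 2 * (1 / q))"
    using q2 by (simp add: powr_mult powr_powr diff_divide_distrib mult.commute)
  finally show ?thesis unfolding r using False q by (simp add: Lp_norm_def)
qed

section \<open>Recovery guarantee\<close>

text \<open>
  The factor \<open>210\<close> comes from \<open>srlasso_recovery\<close>; the last summand accounts for the coefficients
  outside $[n]$, which the procedure does not recover.
\<close>
definition recovery_const :: "real \<Rightarrow> real \<Rightarrow> real"
  where "recovery_const u v = 210 * (1 + noise_const u v) + 2 powr (1 / v)"

lemma recovery_const_pos: "0 < u \<Longrightarrow> u < 2 \<Longrightarrow> 0 < v \<Longrightarrow> v < 2 \<Longrightarrow> recovery_const u v > 0"
  unfolding recovery_const_def using noise_const_pos[of u v] by (intro add_pos_pos) auto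

text \<open>
  For the \<open>\<ell>\<^sup>1\<close> norm on a finite index set, the best \<open>s\<close>-term approximation is a restriction and is attained.
\<close>
lemma best_support:
  "\<exists>S\<subseteq>{..<n}. card S \<le> s \<and> ennreal (\<Sum>j\<in>{..<n} - S. cmod (c j)) \<le> best_approx_error s 1 (trunc n c)"
proof -
  define \<S> where "\<S> = {S. S \<subseteq> {..<n} \<and> card S \<le> s}"
  have "finite \<S>" unfolding \<S>_def by (rule finite_subset[of _ "Pow {..<n}"]) auto
  moreover have "{} \<in> \<S>" by (simp add: \<S>_def)
  ultimately obtain S where S: "S \<in> \<S>" "\<And>S'. S' \<in> \<S> \<Longrightarrow> (\<Sum>j\<in>{..<n} - S. cmod (c j)) \<le> (\<Sum>j\<in>{..<n} - S'. cmod (c j))"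
    using ex_is_arg_min_if_finite[of \<S> "\<lambda>S. \<Sum>j\<in>{..<n} - S. cmod (c j)"] by (auto simp: is_arg_min_linorder)
  have "ennreal (\<Sum>j\<in>{..<n} - S. cmod (c j)) \<le> seq_norm 1 (\<lambda>i. trunc n c i - z i)" if z: "sparse s z" for z
  proof -
    define S' where "S' = {i. z i \<noteq> 0} \<inter> {..<n}"
    have "card S' \<le> card {i. z i \<noteq> 0}" unfolding S'_def using z by (intro card_mono) (auto simp: sparse_def)
    then have "S' \<in> \<S>" using z by (auto simp: \<S>_def S'_def sparse_def)
    then have "(\<Sum>j\<in>{..<n} - S. cmod (c j)) \<le> (\<Sum>j\<in>{..<n} - S'. cmod (c j))" by (rule S(2))
    also have "\<dots> = (\<Sum>j\<in>{..<n} - S'. cmod (trunc n c j - z j))"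
      by (intro sum.cong) (auto simp: S'_def trunc_def)
    also have "ennreal \<dots> = (\<Sum>j\<in>{..<n} - S'. ennreal (cmod (trunc n c j - z j)))" by (subst sum_ennreal) auto
    also have "\<dots> = (\<integral>\<^sup>+j. ennreal (cmod (trunc n c j - z j)) \<partial>count_space ({..<n} - S'))"
      by (simp add: nn_integral_count_space_finite)
    also have "\<dots> = (\<integral>\<^sup>+j. ennreal (cmod (trunc n c j - z j)) * indicator ({..<n} - S') j \<partial>count_space UNIV)"
      by (rule nn_integral_count_space_indicator) auto
    also have "\<dots> \<le> (\<integral>\<^sup>+j. ennreal (cmod (trunc n c j - z j)) \<partial>count_space UNIV)"
      by (intro nn_integral_mono) (auto simp: indicator_def)
    also have "\<dots> = seq_norm 1 (\<lambda>i. trunc n c i - z i)"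
    proof -
      have "enn_powr w 1 = w" for w by (cases w) (auto simp: enn_powr_def)
      then show ?thesis by (simp add: Lp_norm_def)
    qed
    finally show ?thesis by (auto intro: ennreal_leI)
  qed
  then have "ennreal (\<Sum>j\<in>{..<n} - S. cmod (c j)) \<le> best_approx_error s 1 (trunc n c)"
    unfolding best_approx_error_def by (intro INF_greatest) auto
  with S(1) show ?thesis by (auto simp: \<S>_def)
qed

lemma Lp_norm_zero:
  assumes [measurable]: "h \<in> borel_measurable M" and z: "AE y in M. h y = 0"
  shows "Lp_norm p M h = 0"
proof (cases "p = \<infinity>")
  case True
  have "esssup M (\<lambda>x. ennreal (cmod (h x))) \<le> 0"
    using z by (intro esssup_I) (auto elim!: eventually_mono)
  then show ?thesis using True by (simp add: Lp_norm_def)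
next
  case False
  have "(\<integral>\<^sup>+x. ennreal (cmod (h x) powr enn2real p) \<partial>M) = (\<integral>\<^sup>+x. 0 \<partial>M)"
    using z by (intro nn_integral_cong_AE) (auto elim!: eventually_mono)
  then show ?thesis using False by (simp add: Lp_norm_def enn_powr_def)
qed

lemma recovered_coeffs_sparse: "chat \<in> recovered_coeffs a phi s n m x f \<Longrightarrow> sparse (2 * s) chat"
proof -
  assume "chat \<in> recovered_coeffs a phi s n m x f"
  then obtain S z where S: "S \<subseteq> {..<n}" "card S = min (2 * s) n" "chat = (\<lambda>i. if i \<in> S then z i else 0)"
    unfolding recovered_coeffs_def hard_thresholdings_def by blast
  have fin: "finite S" using S(1) finite_subset by blast
  have sub: "{i. chat i \<noteq> 0} \<subseteq> S" using S(3) by auto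
  show ?thesis unfolding sparse_def
    using finite_subset[OF sub fin] card_mono[OF fin sub] S(2) by linarith
qed

context riesz
begin

lemma coefficient_errors:
  assumes u: "0 < u" "u < 2" and v: "0 < v" "v < 2" and s: "s \<ge> 1" and n: "n \<ge> 1"
    and W: "W_term s u c = ennreal W" "W \<ge> 0" and T: "T_term n v c = ennreal T" "T \<ge> 0"
    and st: "stable_samples s n m x"
    and conv: "\<And>i. i < m \<Longrightarrow> (\<lambda>k. lincomb phi (2 ^ k * n) c (x i)) \<longlonglongrightarrow> f (x i)"
    and chat: "chat \<in> recovered_coeffs a phi s n m x f"
  obtains \<sigma> where "\<sigma> \<ge> 0" "ennreal \<sigma> \<le> best_approx_error s 1 (trunc n c)"
    "l1n n (\<lambda>j. c j - chat j) \<le> 210 * (1 + noise_const u v) * (\<sigma> + sqrt (real s) * (sqrt b / sqrt a * (W + T)))"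
    "sqrt (real s) * l2n n (\<lambda>j. c j - chat j) \<le> 210 * (1 + noise_const u v) * (\<sigma> + sqrt (real s) * (sqrt b / sqrt a * (W + T)))"
proof -
  let ?A = "sample_matrix m x phi" and ?d = "sample_vector m x f"
  obtain S where S: "S \<subseteq> {..<n}" "card S \<le> s" "ennreal (\<Sum>j\<in>{..<n} - S. cmod (c j)) \<le> best_approx_error s 1 (trunc n c)"
    using best_support by blast
  define \<sigma> where "\<sigma> = (\<Sum>j\<in>{..<n} - S. cmod (c j))"
  define E where "E = l2n m (\<lambda>i. mv n ?A c i - ?d i)"
  define D where "D = noise_const u v"
  have D: "D > 0" unfolding D_def using u v by (rule noise_const_pos)
  have E: "E \<le> sqrt b * D * (W + T)"
    unfolding E_def D_def by (rule sample_noise_bound[OF u v s n W T st conv])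
  have \<sigma>0: "\<sigma> \<ge> 0" unfolding \<sigma>_def by (intro sum_nonneg) auto
  have nsp: "l2n n z \<le> 18/5 / sqrt a * l2n m (mv n ?A z) + 1/10 * (l1n n z / sqrt (real s))" for z
    using st[unfolded stable_samples_def, THEN conjunct1, THEN spec, of z] .
  have tr: "(\<Sum>j\<in>{..<n} - S. cmod (trunc n c j)) = \<sigma>" "mv n ?A (trunc n c) = mv n ?A c"
    "l1n n (\<lambda>j. trunc n c j - chat j) = l1n n (\<lambda>j. c j - chat j)"
    "l2n n (\<lambda>j. trunc n c j - chat j) = l2n n (\<lambda>j. c j - chat j)"
    unfolding \<sigma>_def mv_def L2_set_def by (auto simp: trunc_def intro!: sum.cong)
  have cv: "trunc n c \<in> Cvec n" by (auto simp: Cvec_def trunc_def)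
  note rec = srlasso_recovery[OF a_pos s cv S(1,2) nsp chat[unfolded recovered_coeffs_def], unfolded tr, folded E_def]
  have "sqrt (real s) / sqrt a * E \<le> sqrt (real s) / sqrt a * (sqrt b * D * (W + T))"
    using E a_pos by (intro mult_left_mono) auto
  also have "\<dots> = D * (sqrt (real s) * (sqrt b / sqrt a * (W + T)))" by simp
  finally have "\<sigma> + sqrt (real s) / sqrt a * E \<le> \<sigma> + D * (sqrt (real s) * (sqrt b / sqrt a * (W + T)))" by simp
  also have "\<dots> \<le> (1 + D) * (\<sigma> + sqrt (real s) * (sqrt b / sqrt a * (W + T)))"
  proof -
    define P where "P = sqrt (real s) * (sqrt b / sqrt a * (W + T))"
    have "0 \<le> D * \<sigma>" "0 \<le> P"
      unfolding P_def using D \<sigma>0 W T a_pos b_pos by auto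
    moreover have "(1 + D) * (\<sigma> + P) = \<sigma> + D * P + (P + D * \<sigma>)" by algebra
    ultimately show ?thesis unfolding P_def by linarith
  qed
  finally have bd: "210 * (\<sigma> + sqrt (real s) / sqrt a * E) \<le> 210 * (1 + D) * (\<sigma> + sqrt (real s) * (sqrt b / sqrt a * (W + T)))"
    unfolding mult.assoc[of 210] by (rule mult_left_mono) simp
  show ?thesis
    using \<sigma>0 S(3)[folded \<sigma>_def] order_trans[OF rec(1) bd] order_trans[OF rec(2) bd]
    unfolding D_def by (rule that)
qed

text \<open>
  The next two lemmas pass from real to extended nonnegative arithmetic: the bounds in the claim dominate the
  real numbers in which the estimates are carried out.
\<close>
lemma L2_bound_attained:
  assumes C: "C \<ge> 0" and s: "s \<ge> 1" and \<sigma>: "\<sigma> \<ge> 0" "ennreal \<sigma> \<le> best_approx_error s 1 (trunc n c)"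
    and R: "R \<ge> 0" "approx_tail_term s n u v c = ennreal R"
  shows "ennreal (C * sqrt b * ((\<sigma> + sqrt (real s) * (sqrt b / sqrt a * R)) / sqrt (real s))) \<le> L2_bound C a b s n u v c"
proof -
  have s0: "sqrt (real s) > 0" using s by simp
  have "ennreal (C * sqrt b * ((\<sigma> + sqrt (real s) * (sqrt b / sqrt a * R)) / sqrt (real s)))
      = ennreal (C * sqrt b) * (ennreal (\<sigma> / sqrt (real s)) + ennreal (sqrt b / sqrt a * R))"
    using C \<sigma> R s0 a_pos b_pos
    by (simp add: ennreal_mult[symmetric] ennreal_plus[symmetric] add_divide_distrib del: ennreal_plus)
  also have "\<dots> = ennreal (C * sqrt b) * (ennreal \<sigma> / ennreal (sqrt (real s)) + ennreal (sqrt b / sqrt a) * ennreal R)"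
    using \<sigma> R s0 a_pos b_pos ennreal_mult[of "sqrt b / sqrt a" R] by (simp add: divide_ennreal)
  also have "\<dots> \<le> L2_bound C a b s n u v c"
    unfolding L2_bound_def R(2) using \<sigma>(2) by (intro mult_left_mono add_right_mono divide_right_mono_ennreal) auto
  finally show ?thesis .
qed

lemma Lp_bound_attained:
  assumes C: "C \<ge> 0" and s: "s \<ge> 1" and \<sigma>: "\<sigma> \<ge> 0" "ennreal \<sigma> \<le> best_approx_error s 1 (trunc n c)"
    and R: "R \<ge> 0" "approx_tail_term s n u v c = ennreal R" and \<tau>: "\<tau> \<ge> 0" "tail_error n 1 c = ennreal \<tau>"
    and r: "r = enn2real (1 / p)"
  shows "ennreal (C * b powr r * K powr (1 - 2 * r) * ((\<sigma> + sqrt (real s) * (sqrt b / sqrt a * R) + \<tau>) / real s powr r))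
    \<le> Lp_bound C a b K s n u v p c"
proof -
  define S where "S = real s powr r"
  have S: "S > 0" using s by (simp add: S_def)
  have half: "sqrt (real s) / S = real s powr (1 / 2 - r)"
    using s by (simp add: S_def powr_diff powr_half_sqrt)
  have "(\<sigma> + sqrt (real s) * (sqrt b / sqrt a * R) + \<tau>) / S = \<sigma> / S + \<tau> / S + (sqrt (real s) / S) * sqrt b / sqrt a * R"
    by (simp add: add_divide_distrib mult_ac)
  then have "ennreal (C * b powr r * K powr (1 - 2 * r) * ((\<sigma> + sqrt (real s) * (sqrt b / sqrt a * R) + \<tau>) / S))
      = ennreal (C * b powr r * K powr (1 - 2 * r)) * (ennreal (\<sigma> / S) + ennreal (\<tau> / S) + ennreal (real s powr (1 / 2 - r) * sqrt b / sqrt a * R))"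
    using C \<sigma> R \<tau> S a_pos b_pos unfolding half
    by (simp add: ennreal_mult[symmetric] ennreal_plus[symmetric] del: ennreal_plus)
  also have "\<dots> = ennreal (C * b powr r * K powr (1 - 2 * r)) * (ennreal \<sigma> / ennreal S + ennreal \<tau> / ennreal S + ennreal (real s powr (1 / 2 - r) * sqrt b / sqrt a) * ennreal R)"
    using \<sigma> R \<tau> S a_pos b_pos ennreal_mult[of "real s powr (1 / 2 - r) * sqrt b / sqrt a" R]
    by (simp add: divide_ennreal)
  also have "\<dots> \<le> Lp_bound C a b K s n u v p c"
    unfolding Lp_bound_def Let_def r[symmetric] R(2) \<tau>(2) S_def[symmetric] using \<sigma>(2)
    by (intro mult_left_mono add_right_mono divide_right_mono_ennreal) auto
  finally show ?thesis unfolding S_def .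
qed

lemma L2_bound_infinite: "C > 0 \<Longrightarrow> approx_tail_term s n u v c = \<infinity> \<Longrightarrow> L2_bound C a b s n u v c = \<infinity>"
  unfolding L2_bound_def using a_pos b_pos by (simp add: ennreal_mult_top)

lemma Lp_bound_infinite:
  assumes "C > 0" "s \<ge> 1" "approx_tail_term s n u v c = \<infinity> \<or> tail_error n 1 c = \<infinity>"
  shows "Lp_bound C a b K s n u v p c = \<infinity>"
  unfolding Lp_bound_def Let_def using assms a_pos b_pos K_bound(1)
  by (auto simp: ennreal_mult_top ennreal_top_divide)

lemma dyadic_tail_error:
  assumes v: "0 < v" "v < 2" and n: "n \<ge> 1" and T: "T_term n v c = ennreal T" "T \<ge> 0"
  shows "tail_error (2 ^ k * n) 2 c \<le> ennreal ((1 / sqrt 2) ^ k * decay v ^ k * (2 powr (1 / v) * T))"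
proof -
  have "tail_error (2 ^ k * n) 2 c \<le> ennreal (2 powr (1 / v) * ((1 / sqrt 2) ^ k * decay v ^ k)) * ennreal T"
    using tail_rate[OF v(1) n, where c = c] unfolding T .
  also have "\<dots> = ennreal ((1 / sqrt 2) ^ k * decay v ^ k * (2 powr (1 / v) * T))"
    using T decay_bounds[OF v] by (simp add: ennreal_mult[symmetric] mult_ac)
  finally show ?thesis .
qed

lemma dyadic_exceptions_null_if_finite:
  assumes v: "0 < v" "v < 2" and n: "n \<ge> 1" and f: "f \<in> borel_measurable M" and e: "L2_expansion M phi c f"
    and fin: "T_term n v c < \<infinity>"
  shows "dyadic_exceptions n c f \<in> null_sets M"
proof -
  obtain T where T: "T_term n v c = ennreal T" "T \<ge> 0"
    using fin by (cases "T_term n v c") auto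
  show ?thesis
    using T by (intro dyadic_exceptions_null[OF f e decay_bounds[OF v] _ dyadic_tail_error[OF v n T]]) auto
qed

text \<open>
  Let \<open>Y\<close> be \<open>sqrt s\<close> times the brace in the \<open>L\<^sup>2\<close> bound, and \<open>Z = Y + \<tau>\<^sub>n(c)\<^sub>1\<close>. Up to constants, the error has
  coefficients of \<open>\<ell>\<^sup>2\<close> norm at most \<open>Y / sqrt s\<close> and \<open>\<ell>\<^sup>1\<close> norm at most \<open>Z\<close>. Interpolating
  \<open>sqrt b * Z / sqrt s\<close> with \<open>K * Z\<close> gives precisely the power of \<open>s\<close> in the \<open>L\<^sup>p\<close> bound.
\<close>
theorem recovery_bounds:
  assumes u: "0 < u" "u < 2" and v: "0 < v" "v < 2" and s: "s \<ge> 1" and n: "n \<ge> 1"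
    and f: "f \<in> borel_measurable M" and e: "L2_expansion M phi c f"
    and fin: "approx_tail_term s n u v c < \<infinity>"
    and x: "\<And>i. i < m \<Longrightarrow> x i \<in> space M" "\<And>i. i < m \<Longrightarrow> x i \<notin> dyadic_exceptions n c f"
    and st: "stable_samples s n m x" and chat: "chat \<in> recovered_coeffs a phi s n m x f"
  shows "Lp_norm 2 M (\<lambda>y. f y - lincomb phi n chat y) \<le> L2_bound (recovery_const u v) a b s n u v c"
    and "p > 2 \<Longrightarrow> Lp_norm p M (\<lambda>y. f y - lincomb phi n chat y) \<le> Lp_bound (recovery_const u v) a b K s n u v p c"
proof -
  have [measurable]: "f \<in> borel_measurable M" by (rule f)
  obtain W where W: "W_term s u c = ennreal W" "W \<ge> 0"
    using fin unfolding approx_tail_term_eq by (cases "W_term s u c") auto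
  obtain T where T: "T_term n v c = ennreal T" "T \<ge> 0"
    using fin unfolding approx_tail_term_eq by (cases "T_term n v c") auto
  define C where "C = recovery_const u v"
  have C: "C > 0" unfolding C_def using u v by (rule recovery_const_pos)
  define R where "R = W + T"
  have R: "R \<ge> 0" "approx_tail_term s n u v c = ennreal R"
    unfolding approx_tail_term_eq W(1) T(1) R_def using W T by auto
  have null: "dyadic_exceptions n c f \<in> null_sets M"
    using fin unfolding approx_tail_term_eq by (intro dyadic_exceptions_null_if_finite[OF v n f e]) auto
  have conv: "(\<lambda>k. lincomb phi (2 ^ k * n) c (x i)) \<longlonglongrightarrow> f (x i)" if "i < m" for i
    using x[OF that] by (simp add: dyadic_exceptions_def)
  obtain \<sigma> where \<sigma>: "\<sigma> \<ge> 0" "ennreal \<sigma> \<le> best_approx_error s 1 (trunc n c)"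
    and l1: "l1n n (\<lambda>j. c j - chat j) \<le> 210 * (1 + noise_const u v) * (\<sigma> + sqrt (real s) * (sqrt b / sqrt a * R))"
    and l2: "sqrt (real s) * l2n n (\<lambda>j. c j - chat j) \<le> 210 * (1 + noise_const u v) * (\<sigma> + sqrt (real s) * (sqrt b / sqrt a * R))"
    unfolding R_def by (rule coefficient_errors[OF u v s n W T st conv chat])
  define Y where "Y = \<sigma> + sqrt (real s) * (sqrt b / sqrt a * R)"
  have Y: "Y \<ge> 0" unfolding Y_def using \<sigma> R a_pos b_pos by auto
  have s0: "sqrt (real s) > 0" using s by simp
  have t2: "tail_error n 2 c \<le> ennreal (2 powr (1 / v) * T)" using dyadic_tail_error[OF v n T, of 0] by simp
  have TR: "T \<le> Y / sqrt (real s)"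
  proof -
    have "1 * R \<le> sqrt b / sqrt a * R" using R a_le_b a_pos by (intro mult_right_mono) auto
    moreover have "T \<le> R" using W by (simp add: R_def)
    moreover have "Y / sqrt (real s) = \<sigma> / sqrt (real s) + sqrt b / sqrt a * R"
      unfolding Y_def using s0 by (simp add: add_divide_distrib)
    moreover have "\<sigma> / sqrt (real s) \<ge> 0" using \<sigma> by simp
    ultimately show ?thesis by linarith
  qed
  have CY: "l2n n (\<lambda>j. c j - chat j) + 2 powr (1 / v) * T \<le> C * (Y / sqrt (real s))"
  proof -
    have "l2n n (\<lambda>j. c j - chat j) \<le> 210 * (1 + noise_const u v) * (Y / sqrt (real s))"
      using l2 s0 unfolding Y_def[symmetric] by (simp add: field_simps)
    moreover have "2 powr (1 / v) * T \<le> 2 powr (1 / v) * (Y / sqrt (real s))" using TR by (intro mult_left_mono) auto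
    ultimately show ?thesis unfolding C_def recovery_const_def distrib_right by (rule add_mono)
  qed
  let ?h = "\<lambda>y. f y - lincomb phi n chat y"
  have "Lp_norm 2 M ?h \<le> ennreal (sqrt b * (l2n n (\<lambda>j. c j - chat j) + 2 powr (1 / v) * T))"
    using T by (intro residual_norm[OF f e t2]) auto
  also have "\<dots> \<le> ennreal (C * sqrt b * (Y / sqrt (real s)))"
  proof (intro ennreal_leI)
    have "sqrt b * (l2n n (\<lambda>j. c j - chat j) + 2 powr (1 / v) * T) \<le> sqrt b * (C * (Y / sqrt (real s)))"
      using CY b_pos by (intro mult_left_mono) auto
    then show "sqrt b * (l2n n (\<lambda>j. c j - chat j) + 2 powr (1 / v) * T) \<le> C * sqrt b * (Y / sqrt (real s))"
      by (simp add: mult_ac)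
  qed
  finally have L2: "Lp_norm 2 M ?h \<le> ennreal (C * sqrt b * (Y / sqrt (real s)))" .
  also have "\<dots> \<le> L2_bound C a b s n u v c"
    unfolding Y_def using C by (intro L2_bound_attained[OF _ s \<sigma> R]) auto
  finally show "Lp_norm 2 M ?h \<le> L2_bound (recovery_const u v) a b s n u v c" unfolding C_def .
  assume p: "p > 2"
  show "Lp_norm p M ?h \<le> Lp_bound (recovery_const u v) a b K s n u v p c"
  proof (cases "tail_error n 1 c = \<infinity>")
    case True
    then show ?thesis using Lp_bound_infinite[OF C s, where u = u and v = v and c = c and n = n] unfolding C_def by simp
  next
    case False
    then obtain \<tau> where \<tau>: "\<tau> \<ge> 0" "tail_error n 1 c = ennreal \<tau>" by (cases "tail_error n 1 c") auto
    define r where "r = enn2real (1 / p)"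
    define Z where "Z = Y + \<tau>"
    have Z: "Z \<ge> 0" "Y \<le> Z" using Y \<tau> by (auto simp: Z_def)
    have L2Z: "Lp_norm 2 M ?h \<le> ennreal (C * sqrt b * (Z / sqrt (real s)))"
      using Z C b_pos s0 by (intro order_trans[OF L2] ennreal_leI mult_left_mono divide_right_mono) auto
    have main: "Lp_norm p M ?h \<le> ennreal (C * b powr r * K powr (1 - 2 * r) * (Z / real s powr r))"
    \<comment> \<open>If \<open>Z = 0\<close>, then \<open>0 powr 0 = 0\<close> breaks the calculation with exponents, but the error vanishes.\<close>
    proof (cases "Z = 0")
      case True
      then have "sq_norm M ?h \<le> ennreal (0\<^sup>2)" using L2Z by (subst sq_norm_le_iff) auto
      then have "(\<integral>\<^sup>+y. ennreal ((cmod (?h y))\<^sup>2) \<partial>M) = 0" by (simp add: sq_norm_def)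
      then have "AE y in M. ennreal ((cmod (?h y))\<^sup>2) = 0"
        by (subst (asm) nn_integral_0_iff_AE) auto
      then have "AE y in M. ?h y = 0" by eventually_elim simp
      then have "Lp_norm p M ?h = 0" by (intro Lp_norm_zero) auto
      then show ?thesis by simp
    next
      case False
      then have Zp: "Z > 0" using Z by simp
      have lK: "AE y in M. cmod (?h y) \<le> K * C * Z"
      proof -
        have "l1n n (\<lambda>j. c j - chat j) + \<tau> \<le> C * Z"
        proof -
          have "210 * (1 + noise_const u v) * Y + \<tau> \<le> C * Y + C * \<tau>"
          proof (rule add_mono)
            show "210 * (1 + noise_const u v) * Y \<le> C * Y"
              unfolding C_def recovery_const_def using Y by (intro mult_right_mono) auto
            have "1 \<le> C" unfolding C_def recovery_const_def using noise_const_pos[OF u v] by simp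
            then have "1 * \<tau> \<le> C * \<tau>" using \<tau> by (intro mult_right_mono)
            then show "\<tau> \<le> C * \<tau>" by simp
          qed
          then show ?thesis using l1 unfolding Y_def[symmetric] Z_def distrib_left by linarith
        qed
        then have le: "K * (l1n n (\<lambda>j. c j - chat j) + \<tau>) \<le> K * C * Z"
          using K_bound by (simp add: mult.assoc)
        have "AE y in M. cmod (?h y) \<le> K * (l1n n (\<lambda>j. c j - chat j) + \<tau>)"
          using \<tau> by (intro residual_bounded[OF null]) auto
        then show ?thesis by eventually_elim (use le in linarith)
      qed
      have "Lp_norm p M ?h \<le> ennreal ((C * sqrt b * (Z / sqrt (real s))) powr (2 * r) * (K * C * Z) powr (1 - 2 * r))"
        unfolding r_def using C b_pos Zp s0 K_bound(1) by (intro Lp_norm_interpolation L2Z lK p) auto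
      also have "(C * sqrt b * (Z / sqrt (real s))) powr (2 * r) * (K * C * Z) powr (1 - 2 * r)
          = C * b powr r * K powr (1 - 2 * r) * (Z / real s powr r)"
      proof -
        have sq: "sqrt w powr (2 * r) = w powr r" if "w > 0" for w
          using that by (simp add: powr_powr flip: powr_half_sqrt)
        have cz: "w powr (2 * r) * w powr (1 - 2 * r) = w" if "w > 0" for w :: real
          using that by (simp flip: powr_add)
        have "(C * sqrt b * (Z / sqrt (real s))) powr (2 * r) * (K * C * Z) powr (1 - 2 * r)
          = (C powr (2 * r) * C powr (1 - 2 * r)) * (Z powr (2 * r) * Z powr (1 - 2 * r)) * b powr r * K powr (1 - 2 * r) / real s powr r"
          using C b_pos Zp s0 s K_bound(1) sq[of b] sq[of "real s"] by (simp add: powr_mult powr_divide)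
        also have "\<dots> = C * b powr r * K powr (1 - 2 * r) * (Z / real s powr r)"
          using cz[OF C] cz[OF Zp] by simp
        finally show ?thesis .
      qed
      finally show ?thesis .
    qed
    also have "\<dots> \<le> Lp_bound C a b K s n u v p c"
      unfolding Z_def Y_def using C by (intro Lp_bound_attained[OF _ s \<sigma> R \<tau> r_def]) auto
    finally show ?thesis unfolding C_def .
  qed
qed

end

text \<open>
  If the tail term is infinite for given \<open>u, v\<close>, there is nothing to show. If it is finite for some
  \<open>u, v\<close>, then the dyadic exceptions form a null set and can serve as the set to be avoided.
\<close>
theorem recovery_guarantee_holds:
  fixes M :: "'a measure"
  shows "recovery_guarantee (2 * 10^11) recovery_const M"
  unfolding recovery_guarantee_def
proof (intro allI impI, elim conjE)
  fix phi a b K \<epsilon> s n m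
  assume A: "prob_space M" "bounded_riesz_basis M phi a b K" "0 < \<epsilon>" "\<epsilon> < 1" "1 \<le> s" "1 \<le> n" "1 \<le> m"
    and mb: "real m \<ge> 2 * 10^11 * (K\<^sup>2 / a) * real s * ((ln (2 * (K\<^sup>2 / a) * real s))\<^sup>2 * ln (2 * real n) + ln (2 / \<epsilon>))"
  interpret riesz M phi a b K
    using A by (simp add: riesz_def riesz_axioms_def)
  let ?P = "PiM {..<m} (\<lambda>_. M)"
  obtain E where E: "E \<in> sets ?P" "measure ?P E \<ge> 1 - \<epsilon>" "\<And>x. x \<in> E \<Longrightarrow> stable_samples s n m x"
    using stable_samples_event[OF A(3-7) mb] by blast
  have "\<exists>N\<in>null_sets M. (\<forall>y\<in>N. \<not> (\<lambda>i. c i * phi i y) sums f y) \<and>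
      (\<forall>x\<in>E. (\<forall>i<m. x i \<notin> N) \<longrightarrow> recovery_succeeds recovery_const M phi a b K s n m x f c)"
    if f: "f \<in> L2_space M" and e: "L2_expansion M phi c f" for f c
  proof -
    have fm: "f \<in> borel_measurable M" using f by (simp add: L2_space_def)
    define N where "N = (if dyadic_exceptions n c f \<in> null_sets M then dyadic_exceptions n c f else {})"
    have "N \<in> null_sets M" by (simp add: N_def)
    moreover have "\<not> (\<lambda>i. c i * phi i y) sums f y" if "y \<in> N" for y
      using that dyadic_exceptions_not_sums[OF A(6)] by (auto simp: N_def split: if_splits)
    moreover have "recovery_succeeds recovery_const M phi a b K s n m x f c"
      if x: "x \<in> E" "\<forall>i<m. x i \<notin> N" for x
      unfolding recovery_succeeds_def
    proof (intro ballI conjI allI impI; (elim conjE)?)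
      fix chat assume chat: "chat \<in> recovered_coeffs a phi s n m x f"
      then show "sparse (2 * s) chat" by (rule recovered_coeffs_sparse)
      fix u v :: real assume uv: "0 < u" "u < 2" "0 < v" "v < 2"
      have xs: "x i \<in> space M" if "i < m" for i
        using sets.sets_into_space[OF E(1)] x(1) that by (auto simp: space_PiM)
      have st: "stable_samples s n m x" using E(3) x(1) .
      have both: "Lp_norm 2 M (\<lambda>y. f y - lincomb phi n chat y) \<le> L2_bound (recovery_const u v) a b s n u v c \<and>
        (\<forall>p>2. Lp_norm p M (\<lambda>y. f y - lincomb phi n chat y) \<le> Lp_bound (recovery_const u v) a b K s n u v p c)"
      proof (cases "approx_tail_term s n u v c = \<infinity>")
        case True
        then show ?thesis
          using L2_bound_infinite[OF recovery_const_pos[OF uv], where u = u and v = v and c = c and n = n and s = s]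
            Lp_bound_infinite[OF recovery_const_pos[OF uv] A(5), where u = u and v = v and c = c and n = n] by simp
      next
        case False
        then have fin: "approx_tail_term s n u v c < \<infinity>" by (simp add: less_top)
        have null: "dyadic_exceptions n c f \<in> null_sets M"
          using fin unfolding approx_tail_term_eq
          by (intro dyadic_exceptions_null_if_finite[OF uv(3,4) A(6) fm e]) auto
        then have xN: "x i \<notin> dyadic_exceptions n c f" if "i < m" for i
          using x(2) that by (simp add: N_def)
        show ?thesis
          using recovery_bounds[OF uv A(5,6) fm e fin xs xN st chat] by blast
      qed
      then show "Lp_norm 2 M (\<lambda>y. f y - lincomb phi n chat y) \<le> L2_bound (recovery_const u v) a b s n u v c"
        "\<And>p. 2 < p \<Longrightarrow> Lp_norm p M (\<lambda>y. f y - lincomb phi n chat y) \<le> Lp_bound (recovery_const u v) a b K s n u v p c"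
        by blast+
    qed
    ultimately show ?thesis by blast
  qed
  with E(1,2) show "\<exists>E\<in>sets ?P. 1 - \<epsilon> \<le> measure ?P E \<and>
      (\<forall>f\<in>L2_space M. \<forall>c. L2_expansion M phi c f \<longrightarrow>
        (\<exists>N\<in>null_sets M. (\<forall>y\<in>N. \<not> (\<lambda>i. c i * phi i y) sums f y) \<and>
          (\<forall>x\<in>E. (\<forall>i<m. x i \<notin> N) \<longrightarrow> recovery_succeeds recovery_const M phi a b K s n m x f c)))"
    by blast
qed

section \<open>Passage to the distribution of the basis functions\<close>

lemma subseq_geometric:
  assumes "(\<lambda>n. sq_norm M (g n)) \<longlonglongrightarrow> 0"
  shows "\<exists>r. (\<forall>k. k \<le> r k) \<and> (\<forall>k. sq_norm M (g (r k)) \<le> ennreal (1 * (1/2) ^ k))"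
proof -
  have "\<exists>n\<ge>k. sq_norm M (g n) \<le> ennreal (1 * (1/2) ^ k)" for k
  proof -
    have "eventually (\<lambda>n. sq_norm M (g n) < ennreal (1 * (1/2) ^ k)) sequentially"
      using assms by (rule order_tendstoD) simp
    then have "eventually (\<lambda>n. sq_norm M (g n) < ennreal (1 * (1/2) ^ k) \<and> n \<ge> k) sequentially"
      by (intro eventually_conj eventually_ge_at_top)
    then show ?thesis by (auto simp: eventually_sequentially intro: less_imp_le)
  qed
  then show ?thesis by metis
qed

definition coord :: "nat \<Rightarrow> (nat \<Rightarrow> complex) \<Rightarrow> complex"
  where "coord i w = w i"

lemma coord_measurable[measurable]: "coord i \<in> borel_measurable (PiM UNIV (\<lambda>_. borel))"
  unfolding coord_def by measurable

context riesz
begin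

definition basis_values :: "'a \<Rightarrow> nat \<Rightarrow> complex"
  where "basis_values y = (\<lambda>i. phi i y)"

definition image_measure :: "(nat \<Rightarrow> complex) measure"
  where "image_measure = distr M (PiM UNIV (\<lambda>_. borel)) basis_values"

lemma basis_values_measurable[measurable]: "basis_values \<in> measurable M (PiM UNIV (\<lambda>_. borel))"
  unfolding basis_values_def by (rule measurable_PiM_single') (auto simp: phi_measurable)

lemma sets_image_measure[measurable_cong]: "sets image_measure = sets (PiM UNIV (\<lambda>_. borel))"
  by (simp add: image_measure_def)

lemma basis_values_measurable_image[measurable]: "basis_values \<in> measurable M image_measure"
  by (simp add: measurable_cong_sets[OF refl sets_image_measure])

lemma distr_image: "distr M image_measure basis_values = image_measure"
  unfolding image_measure_def by (rule distr_cong) auto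

lemma prob_space_image: "prob_space image_measure"
  unfolding image_measure_def by (rule prob_space_distr) simp

lemma lincomb_coord: "lincomb coord n c (basis_values y) = lincomb phi n c y"
  by (simp add: lincomb_def coord_def basis_values_def)

lemma coord_image[measurable]: "coord i \<in> borel_measurable image_measure"
  by (simp add: measurable_cong_sets[OF sets_image_measure refl])

lemma lincomb_coord_image[measurable]: "lincomb coord n c \<in> borel_measurable image_measure"
  by (intro lincomb_measurable coord_image)

lemma Lp_norm_image:
  assumes [measurable]: "g \<in> borel_measurable image_measure"
  shows "Lp_norm p image_measure g = Lp_norm p M (\<lambda>y. g (basis_values y))"
proof (cases "p = \<infinity>")
  case True
  have "(AE w in image_measure. ennreal (cmod (g w)) \<le> z) \<longleftrightarrow> (AE y in M. ennreal (cmod (g (basis_values y))) \<le> z)" for z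
    by (subst distr_image[symmetric], rule AE_distr_iff) auto
  then have "esssup image_measure (\<lambda>x. ennreal (cmod (g x))) = esssup M (\<lambda>y. ennreal (cmod (g (basis_values y))))"
    by (subst (1 2) esssup_eq_AE) auto
  then show ?thesis using True by (simp add: Lp_norm_def)
next
  case False
  have "(\<integral>\<^sup>+x. ennreal (cmod (g x) powr enn2real p) \<partial>image_measure) = (\<integral>\<^sup>+y. ennreal (cmod (g (basis_values y)) powr enn2real p) \<partial>M)"
    by (subst distr_image[symmetric], rule nn_integral_distr) auto
  then show ?thesis using False by (simp add: Lp_norm_def)
qed

lemma Lp_norm_cong_AE:
  assumes [measurable]: "f \<in> borel_measurable M" "g \<in> borel_measurable M" and "AE y in M. f y = g y"
  shows "Lp_norm p M f = Lp_norm p M g"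
proof (cases "p = \<infinity>")
  case True
  have "esssup M (\<lambda>y. ennreal (cmod (f y))) = esssup M (\<lambda>y. ennreal (cmod (g y)))"
    using assms(3) by (intro esssup_AE_cong) (auto elim!: eventually_mono)
  then show ?thesis using True by (simp add: Lp_norm_def)
next
  case False
  have "(\<integral>\<^sup>+x. ennreal (cmod (f x) powr enn2real p) \<partial>M) = (\<integral>\<^sup>+y. ennreal (cmod (g y) powr enn2real p) \<partial>M)"
    using assms(3) by (intro nn_integral_cong_AE) (auto elim!: eventually_mono)
  then show ?thesis using False by (simp add: Lp_norm_def)
qed

text \<open>
  Take the limit along a subsequence of partial sums that converges almost everywhere. As a limit of a
  subsequence, it agrees with the sum of the series at \<^emph>\<open>every\<close> point where the series converges.
\<close>
lemma factor_through_basis_values: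
  assumes f[measurable]: "f \<in> borel_measurable M" and e: "L2_expansion M phi c f"
  shows "\<exists>g \<in> borel_measurable image_measure. (AE y in M. g (basis_values y) = f y) \<and>
    (\<forall>w l. (\<lambda>i. c i * coord i w) sums l \<longrightarrow> g w = l)"
proof -
  obtain r where r: "\<And>k. k \<le> r k" "\<And>k. sq_norm M (\<lambda>y. f y - lincomb phi (r k) c y) \<le> ennreal (1 * (1/2) ^ k)"
    using subseq_geometric[OF e[unfolded L2_expansion_iff]] by auto
  define g where "g = (\<lambda>w. lim (\<lambda>k. lincomb coord (r k) c w))"
  have "g \<in> borel_measurable image_measure" unfolding g_def by measurable
  moreover have "AE y in M. (\<lambda>k. lincomb phi (r k) c y) \<longlonglongrightarrow> f y"
    by (rule AE_tendsto_if_sq_norm_geometric[OF _ _ r(2)]) auto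
  then have "AE y in M. g (basis_values y) = f y"
    by eventually_elim (auto simp: g_def lincomb_coord intro: limI)
  moreover have "g w = l" if "(\<lambda>i. c i * coord i w) sums l" for w l
  proof -
    have "(\<lambda>N. lincomb coord N c w) \<longlonglongrightarrow> l" using that by (simp add: sums_def lincomb_def)
    moreover have "filterlim r at_top sequentially"
      by (rule filterlim_at_top_mono[OF filterlim_ident]) (use r(1) in auto)
    ultimately have "(\<lambda>k. lincomb coord (r k) c w) \<longlonglongrightarrow> l" by (rule filterlim_compose)
    then show ?thesis unfolding g_def by (rule limI)
  qed
  ultimately show ?thesis by blast
qed

lemma Lp_norm_residual_image:
  assumes [measurable]: "f \<in> borel_measurable M" "g \<in> borel_measurable image_measure" and ae: "AE y in M. g (basis_values y) = f y"
  shows "Lp_norm p image_measure (\<lambda>w. g w - lincomb coord n z w) = Lp_norm p M (\<lambda>y. f y - lincomb phi n z y)"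
proof -
  have "Lp_norm p image_measure (\<lambda>w. g w - lincomb coord n z w) = Lp_norm p M (\<lambda>y. g (basis_values y) - lincomb phi n z y)"
    by (subst Lp_norm_image) (auto simp: lincomb_coord)
  also have "\<dots> = Lp_norm p M (\<lambda>y. f y - lincomb phi n z y)"
    using ae by (intro Lp_norm_cong_AE) (auto elim: eventually_mono)
  finally show ?thesis .
qed

lemma expansion_image:
  assumes f: "f \<in> borel_measurable M" and g: "g \<in> borel_measurable image_measure" "AE y in M. g (basis_values y) = f y"
  shows "L2_expansion image_measure coord c g \<longleftrightarrow> L2_expansion M phi c f"
  unfolding L2_expansion_def Lp_norm_residual_image[OF f g] ..

lemma L2_space_image:
  assumes f: "f \<in> borel_measurable M" and g: "g \<in> borel_measurable image_measure" "AE y in M. g (basis_values y) = f y"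
  shows "Lp_norm p image_measure g = Lp_norm p M f"
  using Lp_norm_residual_image[OF f g, of p 0] by (simp add: lincomb_def)

lemma basis_image: "bounded_riesz_basis image_measure coord a b K"
  unfolding bounded_riesz_basis_def
proof (intro conjI allI ballI impI)
  note B = basis[unfolded bounded_riesz_basis_def]
  show "a > 0" "b > 0" "K \<ge> 0" using B by auto
  have cn: "Lp_norm p image_measure (coord i) = Lp_norm p M (phi i)" for p i
    by (subst Lp_norm_image) (auto simp: coord_def basis_values_def)
  then show "coord i \<in> L2_space image_measure" for i
    using B by (auto simp: L2_space_def)
  show "(SUP i. Lp_norm \<infinity> image_measure (coord i)) = ennreal K" unfolding cn using B by blast
  show "\<exists>n z. Lp_norm 2 image_measure (\<lambda>y. f y - lincomb coord n z y) < ennreal \<delta>"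
    if f: "f \<in> L2_space image_measure" and \<delta>: "\<delta> > 0" for f and \<delta> :: real
  proof -
    have fm[measurable]: "f \<in> borel_measurable image_measure" using f by (simp add: L2_space_def)
    have "(\<lambda>y. f (basis_values y)) \<in> L2_space M"
      using f Lp_norm_image[OF fm, of 2] by (simp add: L2_space_def)
    moreover have "\<forall>f\<in>L2_space M. \<forall>\<delta>>0. \<exists>n z. Lp_norm 2 M (\<lambda>y. f y - lincomb phi n z y) < ennreal \<delta>"
      using B by (elim conjE)
    ultimately obtain n z where "Lp_norm 2 M (\<lambda>y. f (basis_values y) - lincomb phi n z y) < ennreal \<delta>"
      using \<delta> by (elim ballE allE impE exE) auto
    then have "Lp_norm 2 image_measure (\<lambda>y. f y - lincomb coord n z y) < ennreal \<delta>"
      by (subst Lp_norm_residual_image) auto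
    then show ?thesis by blast
  qed
  show "\<exists>g\<in>L2_space image_measure. L2_expansion image_measure coord c g \<and>
      ennreal a * (seq_norm 2 c)\<^sup>2 \<le> (Lp_norm 2 image_measure g)\<^sup>2 \<and> (Lp_norm 2 image_measure g)\<^sup>2 \<le> ennreal b * (seq_norm 2 c)\<^sup>2"
    if c: "seq_norm 2 c < \<infinity>" for c
  proof -
    obtain f where f: "f \<in> L2_space M" "L2_expansion M phi c f"
      "ennreal a * (seq_norm 2 c)\<^sup>2 \<le> (Lp_norm 2 M f)\<^sup>2" "(Lp_norm 2 M f)\<^sup>2 \<le> ennreal b * (seq_norm 2 c)\<^sup>2"
      using B c by blast
    have fm: "f \<in> borel_measurable M" using f by (simp add: L2_space_def)
    obtain g where g: "g \<in> borel_measurable image_measure" "AE y in M. g (basis_values y) = f y"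
      using factor_through_basis_values[OF fm f(2)] by (elim bexE conjE)
    have "g \<in> L2_space image_measure"
      using f(1) g(1) L2_space_image[OF fm g, of 2] by (simp add: L2_space_def)
    moreover have "L2_expansion image_measure coord c g"
      using f(2) expansion_image[OF fm g] by simp
    ultimately show ?thesis using f(3,4) L2_space_image[OF fm g, of 2] by auto
  qed
qed

lemma recovered_coeffs_cong:
  assumes A: "\<And>i j. i < m \<Longrightarrow> phi' j (x' i) = phi j (x i)" and d: "\<And>i. i < m \<Longrightarrow> f' (x' i) = f (x i)"
  shows "recovered_coeffs al phi' s n m x' f' = recovered_coeffs al phi s n m x f"
proof -
  have "srlasso_objective lam m n (sample_matrix m x' phi') (sample_vector m x' f')
      = srlasso_objective lam m n (sample_matrix m x phi) (sample_vector m x f)" for lam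
    unfolding srlasso_objective_def sample_matrix_def sample_vector_def using A d by (intro ext) simp
  then show ?thesis unfolding recovered_coeffs_def srlasso_minimizer_def by simp
qed

text \<open>
  The procedure sees \<open>f\<close> and the basis only through their values at the samples, so an event for
  the distribution of the basis values pulls back to one for \<open>M\<close>. The points where \<open>f\<close> differs from the factored function \<open>g\<close>
  must be avoided as well; the series does not sum to \<open>f\<close> there, because \<open>g\<close> takes the value of the
  sum wherever it exists.
\<close>
lemma guarantee_from_image:
  assumes G: "recovery_guarantee c0 C image_measure"
    and P: "0 < \<epsilon>" "\<epsilon> < 1" "s \<ge> 1" "n \<ge> 1" "m \<ge> 1"
    and mb: "real m \<ge> c0 * (K\<^sup>2 / a) * real s * ((ln (2 * (K\<^sup>2 / a) * real s))\<^sup>2 * ln (2 * real n) + ln (2 / \<epsilon>))"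
  shows "\<exists>E \<in> sets (PiM {..<m} (\<lambda>_. M)). measure (PiM {..<m} (\<lambda>_. M)) E \<ge> 1 - \<epsilon> \<and>
        (\<forall>f\<in>L2_space M. \<forall>c. L2_expansion M phi c f \<longrightarrow>
          (\<exists>N \<in> null_sets M.
            (\<forall>y\<in>N. \<not> (\<lambda>i. c i * phi i y) sums f y) \<and>
            (\<forall>x\<in>E. (\<forall>i<m. x i \<notin> N) \<longrightarrow> recovery_succeeds C M phi a b K s n m x f c)))"
proof -
  let ?P = "PiM {..<m} (\<lambda>_. M)" and ?P' = "PiM {..<m} (\<lambda>_. image_measure)"
  have "\<exists>E \<in> sets ?P'. measure ?P' E \<ge> 1 - \<epsilon> \<and>
        (\<forall>f\<in>L2_space image_measure. \<forall>c. L2_expansion image_measure coord c f \<longrightarrow>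
          (\<exists>N \<in> null_sets image_measure.
            (\<forall>y\<in>N. \<not> (\<lambda>i. c i * coord i y) sums f y) \<and>
            (\<forall>x\<in>E. (\<forall>i<m. x i \<notin> N) \<longrightarrow> recovery_succeeds C image_measure coord a b K s n m x f c)))"
    by (rule G[unfolded recovery_guarantee_def, rule_format]) (use P mb prob_space_image basis_image in blast)
  then obtain E' where E': "E' \<in> sets ?P'" "measure ?P' E' \<ge> 1 - \<epsilon>"
    and rec: "\<forall>f\<in>L2_space image_measure. \<forall>c. L2_expansion image_measure coord c f \<longrightarrow>
          (\<exists>N \<in> null_sets image_measure. (\<forall>y\<in>N. \<not> (\<lambda>i. c i * coord i y) sums f y) \<and>
            (\<forall>x\<in>E'. (\<forall>i<m. x i \<notin> N) \<longrightarrow> recovery_succeeds C image_measure coord a b K s n m x f c))"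
    by (elim bexE conjE)
  define \<theta> where "\<theta> = compose {..<m} basis_values"
  have \<theta>_meas[measurable]: "\<theta> \<in> measurable ?P ?P'"
    unfolding \<theta>_def compose_def by measurable
  have "distr ?P ?P' \<theta> = PiM {..<m} (\<lambda>_. distr M image_measure basis_values)"
    unfolding \<theta>_def by (rule distr_PiM_finite_prob_space') (auto intro: prob_space_axioms prob_space_image)
  then have dP: "distr ?P ?P' \<theta> = ?P'" by (simp add: distr_image)
  define E where "E = \<theta> -` E' \<inter> space ?P"
  have Es: "E \<in> sets ?P" unfolding E_def using E' by measurable
  have "measure ?P E = measure (distr ?P ?P' \<theta>) E'" unfolding E_def using E' by (subst measure_distr) auto
  then have Em: "measure ?P E \<ge> 1 - \<epsilon>" using E' by (simp add: dP)
  have "\<exists>N \<in> null_sets M. (\<forall>y\<in>N. \<not> (\<lambda>i. c i * phi i y) sums f y) \<and>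
            (\<forall>x\<in>E. (\<forall>i<m. x i \<notin> N) \<longrightarrow> recovery_succeeds C M phi a b K s n m x f c)"
    if f: "f \<in> L2_space M" and e: "L2_expansion M phi c f" for f c
  proof -
    have fm[measurable]: "f \<in> borel_measurable M" using f by (simp add: L2_space_def)
    obtain g where g[measurable]: "g \<in> borel_measurable image_measure" and ae: "AE y in M. g (basis_values y) = f y"
      and gs: "\<forall>w l. (\<lambda>i. c i * coord i w) sums l \<longrightarrow> g w = l"
      using factor_through_basis_values[OF fm e] by (elim bexE conjE)
    have "g \<in> L2_space image_measure"
      using f g L2_space_image[OF fm g ae, of 2] by (simp add: L2_space_def)
    moreover have "L2_expansion image_measure coord c g"
      using e expansion_image[OF fm g ae] by simp
    ultimately have "g \<in> L2_space image_measure" "L2_expansion image_measure coord c g" .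
    from rec[rule_format, OF this] obtain N' where N': "N' \<in> null_sets image_measure"
      and N'1: "\<forall>y\<in>N'. \<not> (\<lambda>i. c i * coord i y) sums g y"
      and N'2: "\<forall>x\<in>E'. (\<forall>i<m. x i \<notin> N') \<longrightarrow> recovery_succeeds C image_measure coord a b K s n m x g c"
      by blast
    define N where "N = (basis_values -` N' \<inter> space M) \<union> {y \<in> space M. g (basis_values y) \<noteq> f y}"
    have "basis_values -` N' \<inter> space M \<in> null_sets M"
      using N' null_sets_distr_iff[of basis_values M image_measure N'] by (simp add: distr_image)
    moreover have "{y \<in> space M. g (basis_values y) \<noteq> f y} \<in> null_sets M"
    proof (rule AE_iff_null_sets[THEN iffD2])
      show "{y \<in> space M. g (basis_values y) \<noteq> f y} \<in> sets M" by measurable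
      show "AE y in M. y \<notin> {y \<in> space M. g (basis_values y) \<noteq> f y}" using ae by eventually_elim simp
    qed
    ultimately have Nnull: "N \<in> null_sets M" unfolding N_def by (rule null_sets.Un)
    moreover have "\<not> (\<lambda>i. c i * phi i y) sums f y" if y: "y \<in> N" for y
    proof
      assume s: "(\<lambda>i. c i * phi i y) sums f y"
      then have s': "(\<lambda>i. c i * coord i (basis_values y)) sums f y" by (simp add: coord_def basis_values_def)
      then have "g (basis_values y) = f y" using gs by blast
      with y s' N'1 show False by (auto simp: N_def)
    qed
    moreover have "recovery_succeeds C M phi a b K s n m x f c" if x: "x \<in> E" and xN: "\<forall>i<m. x i \<notin> N" for x
    proof -
      have xs: "x i \<in> space M" if "i < m" for i using x that by (auto simp: E_def space_PiM)
      have \<theta>x: "\<theta> x i = basis_values (x i)" if "i < m" for i using that by (simp add: \<theta>_def compose_def)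
      have "\<theta> x \<in> E'" using x by (simp add: E_def)
      moreover have "\<forall>i<m. \<theta> x i \<notin> N'" using xN xs \<theta>x by (auto simp: N_def)
      ultimately have rs: "recovery_succeeds C image_measure coord a b K s n m (\<theta> x) g c" using N'2 by blast
      have gf: "g (basis_values (x i)) = f (x i)" if "i < m" for i using xN xs that by (auto simp: N_def)
      have rc: "recovered_coeffs a coord s n m (\<theta> x) g = recovered_coeffs a phi s n m x f"
        by (rule recovered_coeffs_cong) (simp_all add: \<theta>x gf, simp add: coord_def basis_values_def)
      show ?thesis
        using rs unfolding recovery_succeeds_def rc Lp_norm_residual_image[OF fm g ae] .
    qed
    ultimately show ?thesis by blast
  qed
  with Es Em show ?thesis by blast
qed

end

text \<open>
  Constants that serve all probability spaces over the type of sequences serve those over any type,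
  because the distribution of the basis functions is of the former kind.
\<close>
theorem theorem1p2:
  shows "(\<exists>c0 C. universal_recovery_constants c0 C) \<and>
    (\<forall>c0 C. universal_recovery_constants c0 C \<longrightarrow>
      (\<forall>M :: 'a measure. recovery_guarantee c0 C M))"
proof (intro conjI allI impI)
  have "universal_recovery_constants (2 * 10^11) recovery_const"
    unfolding universal_recovery_constants_def using recovery_guarantee_holds recovery_const_pos by auto
  then show "\<exists>c0 C. universal_recovery_constants c0 C" by blast
next
  fix c0 C and M :: "'a measure"
  assume U: "universal_recovery_constants c0 C"
  show "recovery_guarantee c0 C M"
    unfolding recovery_guarantee_def
  proof (intro allI impI, elim conjE)
    fix phi a b K \<epsilon> s n m
    assume A: "prob_space M" "bounded_riesz_basis M phi a b K" "0 < \<epsilon>" "\<epsilon> < 1" "1 \<le> s" "1 \<le> n" "1 \<le> m"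
      and mb: "c0 * (K\<^sup>2 / a) * real s * ((ln (2 * (K\<^sup>2 / a) * real s))\<^sup>2 * ln (2 * real n) + ln (2 / \<epsilon>)) \<le> real m"
    interpret riesz M phi a b K
      using A by (simp add: riesz_def riesz_axioms_def)
    have "recovery_guarantee c0 C image_measure" using U by (simp add: universal_recovery_constants_def)
    then show "\<exists>E \<in> sets (PiM {..<m} (\<lambda>_. M)). measure (PiM {..<m} (\<lambda>_. M)) E \<ge> 1 - \<epsilon> \<and>
        (\<forall>f\<in>L2_space M. \<forall>c. L2_expansion M phi c f \<longrightarrow>
          (\<exists>N \<in> null_sets M.
            (\<forall>y\<in>N. \<not> (\<lambda>i. c i * phi i y) sums f y) \<and>
            (\<forall>x\<in>E. (\<forall>i<m. x i \<notin> N) \<longrightarrow> recovery_succeeds C M phi a b K s n m x f c)))"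
      by (rule guarantee_from_image[OF _ A(3-7) mb])
  qed
qed

end
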